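(* Let $\alpha\in(0,1)$, $T>0$, let $0=t_0<t_1<\dots<t_M=T$ be a temporal mesh, $\tau:=t_1$, $\tau_j:=t_j-t_{j-1}$, $\rho_j:=\tau_{j+1}/\tau_j$, and let $\delta_t^{\alpha,*}$ be the associated Alikhanov discrete fractional-derivative operator. Suppose that either $0.4656\le\rho_j\le\rho_{j-1}$ for all $j\ge2$, or $\rho_j\ge4/7$ for all $j\ge2$. For $\gamma\in\mathbb{R}$ and $j\ge1$ set $$\mathcal V^j:=\tau\, t_j^{\alpha-1}\begin{cases}1 & \text{if } \gamma>0,\\ 1+\ln(t_j/\tau) & \text{if } \gamma=0,\\ (\tau/t_j)^{\gamma} & \text{if } \gamma<0,\end{cases}$$ and consider, for real numbers $\{V^j\}_{j=0}^M$, the stability property $$\Big(V^0=0\ \text{ and }\ |\delta_t^{\alpha,*} V^j|\lesssim(\tau/t_j)^{\gamma+1}\ \ \forall j\ge1\Big)\ \Longrightarrow\ |V^j|\lesssim\mathcal V^j\ \ \forall j\ge1.\qquad(\mathrm S^* )$$ (i) Let the temporal mesh additionally be quasi-graded with a parameter $r$ satisfying $1\le r\le(3-\alpha)/\alpha$. Then for any given $\gamma\in\mathbb{R}$ and $\{V^j\}_{j=0}^M$ the property $(\mathrm S^* )$ holds true. (ii) If $\gamma\le\alpha-1$, then, without further restrictions on the mesh, $(\mathrm S^* )$ holds true. (iii) The results (i) and (ii) remain valid if the condition $|\delta_t^{\alpha,*} V^j|\lesssim(\tau/t_j)^{\gamma+1}$ in $(\mathrm S^* )$ is replaced by $\delta_t^{\alpha,*}|V^j|\lesssim(\tau/t_j)^{\gamma+1}$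 (i.e. $\delta_t^{\alpha,*}$ is applied to the sequence $\{|V^i|\}$).
   Context: Caputo derivative: $D_t^\alpha v(t):=\frac1{\Gamma(1-\alpha)}\int_0^t(t-s)^{-\alpha}\,\partial_sv(s)\,ds$. Alikhanov operator: let $t_m^*:=t_m-\tfrac12\alpha\tau_m$. Let $\Pi_{1,j}$ and $\Pi_{2,j}$ be the Lagrange interpolation operators with interpolation points $\{t_{j-1},t_j\}$ (linear) and $\{t_{j-1},t_j,t_{j+1}\}$ (quadratic), respectively. For a sequence $\{U^j\}_{j=0}^M$ and $m=1,\dots,M$, $$\delta_t^{\alpha,*}U^m:=D_t^\alpha(\Pi^mU)(t_m^* ),\qquad \Pi^m:=\begin{cases}\Pi_{2,j}&\text{on }(t_{j-1},t_j)\ \ \forall j<m,\\ \Pi_{1,m}&\text{on }(t_{m-1},t_m^* ).\end{cases}$$ Quasi-graded mesh with parameter $r\ge1$: $$\tau:=t_1\simeq M^{-r},\qquad t_j\simeq\tau j^r,\qquad \tau_j\simeq\tau^{1/r}t_j^{1-1/r}\qquad\forall j=1,\dots,M.$$ Notation: $a\lesssim b$ means $a\le Cb$ with a generic constant $C>0$ that does not depend on the number $M$ of mesh intervals or on mesh indices (it may depend on fixed data such as $\alpha,T,r,\gamma$ and on the constants implicit in the hypotheses); $a\simeq b$ means $a\lesssim b$ and $b\lesssim a$.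
   Formalization: In (iii) applied to (ii), for M≥3 the constant may also depend on a positive lower bound of ρ_1=τ_2/τ_1; without this the claim fails, e.g. for steps proportional to 1, ε, 1 with V^1=b, V^2=0 and V^3 of order b/ε. *)

theory Defs
  imports "HOL-Analysis.Analysis"
begin

(* Meshes and grid functions are given by sequences of type nat => real of which
   only the entries with index 0..M matter. *)

definition temporal_mesh :: "real \<Rightarrow> nat \<Rightarrow> (nat \<Rightarrow> real) \<Rightarrow> bool" where
  "temporal_mesh T M t \<longleftrightarrow> 1 \<le> M \<and> t 0 = 0 \<and> t M = T \<and> (\<forall>j<M. t j < t (Suc j))"

definition mesh_step :: "(nat \<Rightarrow> real) \<Rightarrow> nat \<Rightarrow> real" where
  "mesh_step t j = t j - t (j - 1)"

definition step_ratio :: "(nat \<Rightarrow> real) \<Rightarrow> nat \<Rightarrow> real" where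
  "step_ratio t j = mesh_step t (j + 1) / mesh_step t j"

(* step_ratio t j involves t (j + 1), so on a mesh with M intervals it is defined
   for 1 <= j <= M - 1. *)
definition ratio_condition :: "nat \<Rightarrow> (nat \<Rightarrow> real) \<Rightarrow> bool" where
  "ratio_condition M t \<longleftrightarrow>
     (\<forall>j. 2 \<le> j \<and> j < M \<longrightarrow> 0.4656 \<le> step_ratio t j \<and> step_ratio t j \<le> step_ratio t (j - 1)) \<or>
     (\<forall>j. 2 \<le> j \<and> j < M \<longrightarrow> 4 / 7 \<le> step_ratio t j)"

(* a and b agree up to the two-sided constant K *)
definition equiv_upto :: "real \<Rightarrow> real \<Rightarrow> real \<Rightarrow> bool" where
  "equiv_upto K a b \<longleftrightarrow> a \<le> K * b \<and> b \<le> K * a"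

definition quasi_graded :: "real \<Rightarrow> real \<Rightarrow> nat \<Rightarrow> (nat \<Rightarrow> real) \<Rightarrow> bool" where
  "quasi_graded K r M t \<longleftrightarrow>
     equiv_upto K (t 1) (real M powr (- r)) \<and>
     (\<forall>j\<in>{1..M}. equiv_upto K (t j) (t 1 * real j powr r) \<and>
        equiv_upto K (mesh_step t j) (t 1 powr (1 / r) * t j powr (1 - 1 / r)))"

(* The derivative is taken pointwise; for continuous piecewise smooth v it may fail to
   exist at finitely many s, where the value of deriv does not affect the integral. *)
definition caputo :: "real \<Rightarrow> (real \<Rightarrow> real) \<Rightarrow> real \<Rightarrow> real" where
  "caputo \<alpha> v x =
     1 / Gamma (1 - \<alpha>) * integral {0..x} (\<lambda>s. (x - s) powr (- \<alpha>) * deriv v s)"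

definition lagrange_interp :: "(nat \<Rightarrow> real) \<Rightarrow> nat set \<Rightarrow> (nat \<Rightarrow> real) \<Rightarrow> real \<Rightarrow> real" where
  "lagrange_interp t I U s = (\<Sum>i\<in>I. U i * (\<Prod>k\<in>I - {i}. (s - t k) / (t i - t k)))"

definition interp1 :: "(nat \<Rightarrow> real) \<Rightarrow> nat \<Rightarrow> (nat \<Rightarrow> real) \<Rightarrow> real \<Rightarrow> real" where
  "interp1 t j = lagrange_interp t {j - 1, j}"

definition interp2 :: "(nat \<Rightarrow> real) \<Rightarrow> nat \<Rightarrow> (nat \<Rightarrow> real) \<Rightarrow> real \<Rightarrow> real" where
  "interp2 t j = lagrange_interp t {j - 1, j, j + 1}"

(* For s in [t (j - 1), t j) with 1 <= j < m, the LEAST expression equals j; only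
   s >= 0 is relevant. *)
definition alikhanov_interp ::
    "(nat \<Rightarrow> real) \<Rightarrow> nat \<Rightarrow> (nat \<Rightarrow> real) \<Rightarrow> real \<Rightarrow> real" where
  "alikhanov_interp t m U s =
     (if s < t (m - 1) then interp2 t (LEAST j. s < t j) U s else interp1 t m U s)"

definition alikhanov_point :: "real \<Rightarrow> (nat \<Rightarrow> real) \<Rightarrow> nat \<Rightarrow> real" where
  "alikhanov_point \<alpha> t m = t m - \<alpha> * mesh_step t m / 2"

definition alikhanov :: "real \<Rightarrow> (nat \<Rightarrow> real) \<Rightarrow> (nat \<Rightarrow> real) \<Rightarrow> nat \<Rightarrow> real" where
  "alikhanov \<alpha> t U m = caputo \<alpha> (alikhanov_interp t m U) (alikhanov_point \<alpha> t m)"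

definition stab_bound :: "real \<Rightarrow> real \<Rightarrow> (nat \<Rightarrow> real) \<Rightarrow> nat \<Rightarrow> real" where
  "stab_bound \<alpha> \<gamma> t j = t 1 * t j powr (\<alpha> - 1) *
     (if \<gamma> > 0 then 1 else if \<gamma> = 0 then 1 + ln (t j / t 1) else (t 1 / t j) powr \<gamma>)"

(* The stability property, uniformly over a class of meshes: the constant C in the
   conclusion depends on the class and on the constant B in the hypothesis, but not on
   M, the mesh, the mesh index or V. *)
definition stable_on :: "real \<Rightarrow> real \<Rightarrow> (nat \<Rightarrow> (nat \<Rightarrow> real) \<Rightarrow> bool) \<Rightarrow> bool" where
  "stable_on \<alpha> \<gamma> mesh_class \<longleftrightarrow>
     (\<forall>B>0. \<exists>C>0. \<forall>M t V. mesh_class M t \<longrightarrow>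
        V 0 = 0 \<and>
        (\<forall>j\<in>{1..M}. \<bar>alikhanov \<alpha> t V j\<bar> \<le> B * (t 1 / t j) powr (\<gamma> + 1)) \<longrightarrow>
        (\<forall>j\<in>{1..M}. \<bar>V j\<bar> \<le> C * stab_bound \<alpha> \<gamma> t j))"

definition stable_abs_on :: "real \<Rightarrow> real \<Rightarrow> (nat \<Rightarrow> (nat \<Rightarrow> real) \<Rightarrow> bool) \<Rightarrow> bool" where
  "stable_abs_on \<alpha> \<gamma> mesh_class \<longleftrightarrow>
     (\<forall>B>0. \<exists>C>0. \<forall>M t V. mesh_class M t \<longrightarrow>
        V 0 = 0 \<and>
        (\<forall>j\<in>{1..M}. alikhanov \<alpha> t (\<lambda>i. \<bar>V i\<bar>) j \<le> B * (t 1 / t j) powr (\<gamma> + 1)) \<longrightarrow>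
        (\<forall>j\<in>{1..M}. \<bar>V j\<bar> \<le> C * stab_bound \<alpha> \<gamma> t j))"

definition admissible :: "real \<Rightarrow> nat \<Rightarrow> (nat \<Rightarrow> real) \<Rightarrow> bool" where
  "admissible T M t \<longleftrightarrow> temporal_mesh T M t \<and> ratio_condition M t"

definition graded_class :: "real \<Rightarrow> real \<Rightarrow> real \<Rightarrow> nat \<Rightarrow> (nat \<Rightarrow> real) \<Rightarrow> bool" where
  "graded_class T K r M t \<longleftrightarrow> admissible T M t \<and> quasi_graded K r M t"

(* A class on which the first ratio is bounded below by c.  Every mesh lies in such a
   class for some c > 0, so quantifying over all c > 0 excludes no mesh and only lets the
   stability constant depend on c.  Without this dependence, the one-sided version of the
   stability property fails: ratio_condition leaves the first ratio free, and for M = 3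
   with steps proportional to 1, e, 1, the choice V 1 = b (b > 0 fixed), V 2 = 0 and V 3 of
   order b / e satisfies the hypothesis with a constant independent of e.
   For M <= 2 no bound is imposed, and the first alternative of ratio_condition with
   M >= 3 already gives the bound for c = 0.4656. *)
definition first_ratio_class :: "real \<Rightarrow> real \<Rightarrow> nat \<Rightarrow> (nat \<Rightarrow> real) \<Rightarrow> bool" where
  "first_ratio_class T c M t \<longleftrightarrow> admissible T M t \<and> (3 \<le> M \<longrightarrow> c \<le> step_ratio t 1)"

end

(* Up to the factor Gamma (1 - \<alpha>) the Alikhanov operator is a sum of kernel values times the
   increments of the grid function. Bounding the derivative of (x - s)^(-\<alpha>) by its value at the
   mesh point shared by two neighbouring intervals shows that the ratio condition makes the kernel
   increasing in the mesh index, except where the first step ratio enters, which is not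
   controlled. From the third level on the quadratic correction on the first interval is therefore
   dropped; it is bounded by the data, because the first two levels bound the first two
   slopes (in the one-sided case together with the lower bound on the first ratio). The reduced operator obeys a comparison principle, so one looks for barriers.

   For \<gamma> \<le> \<alpha> - 1 the constant tau^\<alpha>, started from 0, is a barrier on every mesh, after rescaling the
   data for a fixed target index. For \<gamma> > \<alpha> - 1 one superposes the shifted powers (a + s)^(\<alpha> - 1),
   started from 0, with a proportional to the mesh points t_p and with weights f_p - f_(p+1),
   f_p = (tau / t_p)^(\<gamma> + 1). Their exact fractional derivative is, up to Gamma (1 - \<alpha>),
   a^\<alpha> x^(-\<alpha>) / (a + x), and on a quasi-graded mesh with r \<le> (3 - \<alpha>) / \<alpha> the interpolation error
   is at most C (tau / a)^\<alpha> times this, hence harmless once a / tau is large. *)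

theory Submission
  imports Defs
begin

section \<open>Moments of the derivative of the kernel\<close>

text \<open>The shift is what makes one barrier work on all intervals: once a is a large multiple of
  tau, every step is at most a + t_i, so powers of a + s at neighbouring nodes are comparable even
  next to the origin.

  The bound on r comes from the intervals near the evaluation point. There the error is of order
  h^(3 - \<alpha>), which on the graded mesh carries tau^((3 - \<alpha>)/r); it is dominated by
  tau^\<alpha> when (3 - \<alpha>)/r \<ge> \<alpha>.

  The weights come from the size of one barrier: its discrete derivative is at least 1/(4a) at all
  levels with x \<le> a. Multiplied by a, it majorises a step function of the level, and differences
  of f_p as weights add these steps up to f_n. The resulting bound at t_N contains a lower Riemann
  sum of (tau/s)^(\<gamma> + 1), whose integral produces the three cases of
  \<open>stab_bound\<close>.

  In the two-sided case the first ratio may be arbitrary because a tiny second step, which makes the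
  averaged kernel useless at the second level, is exactly when the quadratic correction there is
  large.\<close>

definition ker :: "real \<Rightarrow> real \<Rightarrow> real \<Rightarrow> real" where
  "ker \<alpha> x s = (x - s) powr (- \<alpha>)"

definition ker' :: "real \<Rightarrow> real \<Rightarrow> real \<Rightarrow> real" where
  "ker' \<alpha> x s = \<alpha> * (x - s) powr (- \<alpha> - 1)"

text \<open>The weights are the linear functions vanishing at one endpoint and their product.
  Integrating \<open>ker\<close> by parts against the derivative of a linear or quadratic
  interpolant leaves these integrals, and positivity of \<open>ker'\<close> makes them easy to
  compare.\<close>

definition left_moment :: "real \<Rightarrow> real \<Rightarrow> real \<Rightarrow> real \<Rightarrow> real" where
  "left_moment \<alpha> x a b = integral {a..b} (\<lambda>s. ker' \<alpha> x s * (s - a))"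

definition right_moment :: "real \<Rightarrow> real \<Rightarrow> real \<Rightarrow> real \<Rightarrow> real" where
  "right_moment \<alpha> x a b = integral {a..b} (\<lambda>s. ker' \<alpha> x s * (b - s))"

definition bubble_moment :: "real \<Rightarrow> real \<Rightarrow> real \<Rightarrow> real \<Rightarrow> real" where
  "bubble_moment \<alpha> x a b = integral {a..b} (\<lambda>s. ker' \<alpha> x s * ((s - a) * (b - s)))"

lemma ker_deriv [derivative_intros]:
  "s < x \<Longrightarrow> (ker \<alpha> x has_real_derivative ker' \<alpha> x s) (at s within S)"
  unfolding ker_def[abs_def] ker'_def by (auto intro!: derivative_eq_intros)

lemma ker_pos: "s < x \<Longrightarrow> 0 < ker \<alpha> x s"
  by (simp add: ker_def)

lemma ker'_pos: "0 < \<alpha> \<Longrightarrow> s < x \<Longrightarrow> 0 < ker' \<alpha> x s"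
  by (simp add: ker'_def)

lemma ker_mono: "0 < \<alpha> \<Longrightarrow> s \<le> s' \<Longrightarrow> s' < x \<Longrightarrow> ker \<alpha> x s \<le> ker \<alpha> x s'"
  unfolding ker_def by (rule powr_mono2') auto

lemma ker'_mono: "0 < \<alpha> \<Longrightarrow> s \<le> s' \<Longrightarrow> s' < x \<Longrightarrow> ker' \<alpha> x s \<le> ker' \<alpha> x s'"
  unfolding ker'_def by (intro mult_left_mono powr_mono2') auto

lemma continuous_on_ker' [continuous_intros]:
  assumes "b < x" shows "continuous_on {a..b} (ker' \<alpha> x)"
  unfolding ker'_def[abs_def] using assms by (intro continuous_intros) auto

lemma ker'_integrable:
  assumes "b < x" "continuous_on {a..b} f"
  shows "(\<lambda>s. ker' \<alpha> x s * f s) integrable_on {a..b}"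
  using assms by (intro integrable_continuous_interval continuous_intros)

lemma ker'_integral:
  assumes "a \<le> b" "b < x"
  shows "(ker' \<alpha> x has_integral ker \<alpha> x b - ker \<alpha> x a) {a..b}"
proof (rule fundamental_theorem_of_calculus[OF assms(1)])
  fix s assume "s \<in> {a..b}"
  then show "(ker \<alpha> x has_vector_derivative ker' \<alpha> x s) (at s within {a..b})"
    using assms by (intro ker_deriv[THEN has_real_derivative_iff_has_vector_derivative[THEN iffD1]]) auto
qed

lemma ker'_weighted_le:
  assumes "0 < \<alpha>" "a \<le> b" "b < x" "continuous_on {a..b} f" "continuous_on {a..b} h"
    and "\<And>s. s \<in> {a..b} \<Longrightarrow> f s \<le> h s"
  shows "integral {a..b} (\<lambda>s. ker' \<alpha> x s * f s) \<le> integral {a..b} (\<lambda>s. ker' \<alpha> x s * h s)"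
proof (rule integral_le)
  fix s assume s: "s \<in> {a..b}"
  with assms have "0 \<le> ker' \<alpha> x s" by (auto intro!: less_imp_le[OF ker'_pos])
  then show "ker' \<alpha> x s * f s \<le> ker' \<alpha> x s * h s"
    using assms s by (intro mult_left_mono) auto
qed (use assms ker'_integrable in auto)

lemma ker_parts:
  assumes "a \<le> b" "b < x"
    and "\<And>s. s \<in> {a..b} \<Longrightarrow> (P has_real_derivative P' s) (at s within {a..b})"
  shows "((\<lambda>s. ker \<alpha> x s * P' s) has_integral
     ker \<alpha> x b * P b - ker \<alpha> x a * P a - integral {a..b} (\<lambda>s. ker' \<alpha> x s * P s)) {a..b}"
proof -
  have "continuous_on {a..b} P"
    using assms(3) DERIV_continuous_on by blast
  then have "((\<lambda>s. ker' \<alpha> x s * P s) has_integral integral {a..b} (\<lambda>s. ker' \<alpha> x s * P s)) {a..b}"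
    using assms ker'_integrable by (intro integrable_integral) auto
  moreover have "((\<lambda>s. ker \<alpha> x s * P' s + ker' \<alpha> x s * P s) has_integral
      ker \<alpha> x b * P b - ker \<alpha> x a * P a) {a..b}"
  proof (rule fundamental_theorem_of_calculus[OF assms(1)])
    fix s assume s: "s \<in> {a..b}"
    then have "s < x" using assms by auto
    then have "((\<lambda>s. ker \<alpha> x s * P s) has_real_derivative
       ker \<alpha> x s * P' s + ker' \<alpha> x s * P s) (at s within {a..b})"
      using assms(3)[OF s] by (auto intro!: derivative_eq_intros)
    then show "((\<lambda>s. ker \<alpha> x s * P s) has_vector_derivative
       ker \<alpha> x s * P' s + ker' \<alpha> x s * P s) (at s within {a..b})"
      by (simp add: has_real_derivative_iff_has_vector_derivative)
  qed
  ultimately show ?thesis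
    by (drule_tac has_integral_diff) (assumption, simp)
qed

lemma moments_add:
  assumes "a \<le> b" "b < x"
  shows "left_moment \<alpha> x a b + right_moment \<alpha> x a b = (b - a) * (ker \<alpha> x b - ker \<alpha> x a)"
proof -
  have "left_moment \<alpha> x a b + right_moment \<alpha> x a b =
      integral {a..b} (\<lambda>s. ker' \<alpha> x s * (s - a) + ker' \<alpha> x s * (b - s))"
    unfolding left_moment_def right_moment_def
    using assms by (intro integral_add[symmetric] ker'_integrable continuous_intros) auto
  also have "\<dots> = integral {a..b} (\<lambda>s. (b - a) * ker' \<alpha> x s)"
    by (intro arg_cong[where f = "integral {a..b}"] ext) (simp add: algebra_simps)
  also have "\<dots> = (b - a) * (ker \<alpha> x b - ker \<alpha> x a)"
    using ker'_integral[OF assms] by (simp add: integral_unique)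
  finally show ?thesis .
qed

text \<open>Since \<open>ker'\<close> is positive, each bound follows from a pointwise bound of the
  weight: s - a \<le> b - a for the comparison with the right moment, and the midpoint maximum (b -
  a)^2/4 of the bubble for the last one.\<close>

lemma
  assumes "0 < \<alpha>" "a \<le> b" "b < x"
  shows left_moment_nonneg: "0 \<le> left_moment \<alpha> x a b"
    and right_moment_nonneg: "0 \<le> right_moment \<alpha> x a b"
    and bubble_moment_nonneg: "0 \<le> bubble_moment \<alpha> x a b"
    and bubble_le_right_moment: "bubble_moment \<alpha> x a b \<le> (b - a) * right_moment \<alpha> x a b"
    and bubble_le_ker: "bubble_moment \<alpha> x a b \<le> (b - a)\<^sup>2 / 4 * (ker \<alpha> x b - ker \<alpha> x a)"
proof -
  note le = ker'_weighted_le[OF assms]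
  have cont: "continuous_on {a..b} (\<lambda>s. s - a)" "continuous_on {a..b} (\<lambda>s. b - s)"
    "continuous_on {a..b} (\<lambda>s. (s - a) * (b - s))"
    by (intro continuous_intros)+
  have "integral {a..b} (\<lambda>s. ker' \<alpha> x s * 0) \<le> left_moment \<alpha> x a b"
    unfolding left_moment_def by (intro le cont continuous_intros) auto
  then show "0 \<le> left_moment \<alpha> x a b" by simp
  have "integral {a..b} (\<lambda>s. ker' \<alpha> x s * 0) \<le> right_moment \<alpha> x a b"
    unfolding right_moment_def by (intro le cont continuous_intros) auto
  then show "0 \<le> right_moment \<alpha> x a b" by simp
  have "integral {a..b} (\<lambda>s. ker' \<alpha> x s * 0) \<le> bubble_moment \<alpha> x a b"
    unfolding bubble_moment_def by (intro le cont continuous_intros) auto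
  then show "0 \<le> bubble_moment \<alpha> x a b" by simp
  have "bubble_moment \<alpha> x a b \<le> integral {a..b} (\<lambda>s. ker' \<alpha> x s * ((b - a) * (b - s)))"
    unfolding bubble_moment_def
    by (intro le cont continuous_intros) (auto intro!: mult_right_mono)
  then show "bubble_moment \<alpha> x a b \<le> (b - a) * right_moment \<alpha> x a b"
    unfolding right_moment_def integral_mult_right[symmetric] by (simp only: mult.left_commute)
  have *: "(s - a) * (b - s) \<le> (b - a)\<^sup>2 / 4" for s
    using zero_le_power2[of "2 * s - a - b"] by (simp add: power2_eq_square algebra_simps)
  have "bubble_moment \<alpha> x a b \<le> integral {a..b} (\<lambda>s. ker' \<alpha> x s * ((b - a)\<^sup>2 / 4))"
    unfolding bubble_moment_def by (intro le cont continuous_intros *)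
  also have "\<dots> = (ker \<alpha> x b - ker \<alpha> x a) * ((b - a)\<^sup>2 / 4)"
    using has_integral_mult_left[OF ker'_integral[OF assms(2,3)]] by (rule integral_unique)
  finally show "bubble_moment \<alpha> x a b \<le> (b - a)\<^sup>2 / 4 * (ker \<alpha> x b - ker \<alpha> x a)"
    by (simp add: mult.commute)
qed

lemma poly_moment_integrals:
  fixes a b :: real
  assumes "a \<le> b"
  shows "((\<lambda>s. s - a) has_integral (b - a)\<^sup>2 / 2) {a..b}"
    and "((\<lambda>s. (s - a) * (b - s)) has_integral (b - a)^3 / 6) {a..b}"
proof -
  have "((\<lambda>s. s - a) has_integral (b - a)\<^sup>2 / 2 - (a - a)\<^sup>2 / 2) {a..b}"
    by (rule fundamental_theorem_of_calculus[OF assms])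
       (auto intro!: derivative_eq_intros simp: has_real_derivative_iff_has_vector_derivative[symmetric])
  then show "((\<lambda>s. s - a) has_integral (b - a)\<^sup>2 / 2) {a..b}" by simp
  have "((\<lambda>s. (s - a) * (b - s)) has_integral
     ((b - a) * (b - a)\<^sup>2 / 2 - (b - a)^3 / 3) - ((b - a) * (a - a)\<^sup>2 / 2 - (a - a)^3 / 3)) {a..b}"
    by (rule fundamental_theorem_of_calculus[OF assms])
       (auto intro!: derivative_eq_intros simp: has_real_derivative_iff_has_vector_derivative[symmetric]
         power2_eq_square field_simps)
  then show "((\<lambda>s. (s - a) * (b - s)) has_integral (b - a)^3 / 6) {a..b}"
    by (simp add: power2_eq_square power3_eq_cube mult.assoc)
qed

text \<open>\<open>ker'\<close> increases towards x, so freezing it at an endpoint leaves a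
  polynomial integral. The resulting factors 1/2 and 1/6 are those in
  \<open>ratio_inequality\<close>.\<close>

lemma
  assumes "0 < \<alpha>" "a \<le> b" "b < x"
  shows left_moment_ge: "(b - a)\<^sup>2 / 2 * ker' \<alpha> x a \<le> left_moment \<alpha> x a b"
    and bubble_moment_ge: "(b - a)^3 / 6 * ker' \<alpha> x a \<le> bubble_moment \<alpha> x a b"
    and bubble_moment_le: "bubble_moment \<alpha> x a b \<le> (b - a)^3 / 6 * ker' \<alpha> x b"
proof -
  have low: "ker' \<alpha> x a \<le> ker' \<alpha> x s" and up: "ker' \<alpha> x s \<le> ker' \<alpha> x b" if "s \<in> {a..b}" for s
    using that assms by (auto intro!: ker'_mono)
  have i: "(\<lambda>s. ker' \<alpha> x s * (s - a)) integrable_on {a..b}"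
      "(\<lambda>s. ker' \<alpha> x s * ((s - a) * (b - s))) integrable_on {a..b}"
    using assms by (intro ker'_integrable continuous_intros; simp)+
  note p = poly_moment_integrals[OF assms(2)]
  show "(b - a)\<^sup>2 / 2 * ker' \<alpha> x a \<le> left_moment \<alpha> x a b"
    unfolding left_moment_def
    by (rule has_integral_le[OF has_integral_mult_left[OF p(1)] integrable_integral[OF i(1)]])
      (use low in \<open>auto simp: mult.commute[of "_ - a"] intro!: mult_right_mono\<close>)
  show "(b - a)^3 / 6 * ker' \<alpha> x a \<le> bubble_moment \<alpha> x a b"
    unfolding bubble_moment_def
    by (rule has_integral_le[OF has_integral_mult_left[OF p(2)] integrable_integral[OF i(2)]])
      (use low in \<open>auto simp: mult.commute[of _ "ker' \<alpha> x a"] intro!: mult_right_mono\<close>)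
  show "bubble_moment \<alpha> x a b \<le> (b - a)^3 / 6 * ker' \<alpha> x b"
    unfolding bubble_moment_def
    by (rule has_integral_le[OF integrable_integral[OF i(2)] has_integral_mult_left[OF p(2)]])
      (use up in \<open>auto simp: mult.commute[of _ "ker' \<alpha> x b"] intro!: mult_right_mono\<close>)
qed

text \<open>The integrand is \<open>ker\<close> times the derivative of c (s - a) - d (s - a)(b -
  s). The bubble vanishes at both ends, so integration by parts gives it no boundary term and its
  contribution is d times the bubble moment, with a positive sign.\<close>

lemma ker_quadratic_integral:
  assumes "a < b" "b < x"
  shows "((\<lambda>s. ker \<alpha> x s * (c + d * (2 * s - a - b))) has_integral
    (ker \<alpha> x b - left_moment \<alpha> x a b / (b - a)) * (c * (b - a)) + d * bubble_moment \<alpha> x a b) {a..b}"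
proof -
  let ?P = "\<lambda>s. c * (s - a) - d * ((s - a) * (b - s))"
  have "((\<lambda>s. ker \<alpha> x s * (c + d * (2 * s - a - b))) has_integral
     ker \<alpha> x b * ?P b - ker \<alpha> x a * ?P a - integral {a..b} (\<lambda>s. ker' \<alpha> x s * ?P s)) {a..b}"
    using assms by (intro ker_parts) (auto intro!: derivative_eq_intros simp: algebra_simps)
  moreover have "integral {a..b} (\<lambda>s. ker' \<alpha> x s * ?P s) =
     integral {a..b} (\<lambda>s. c * (ker' \<alpha> x s * (s - a)) - d * (ker' \<alpha> x s * ((s - a) * (b - s))))"
    by (intro arg_cong[where f = "integral {a..b}"] ext) (simp add: algebra_simps)
  moreover have "\<dots> = c * left_moment \<alpha> x a b - d * bubble_moment \<alpha> x a b"
    unfolding left_moment_def bubble_moment_def integral_mult_right[symmetric] using assms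
    by (intro integral_diff integrable_on_mult_right ker'_integrable continuous_intros)
  moreover have "ker \<alpha> x b * ?P b - ker \<alpha> x a * ?P a - (c * left_moment \<alpha> x a b - d * bubble_moment \<alpha> x a b) =
      (ker \<alpha> x b - left_moment \<alpha> x a b / (b - a)) * (c * (b - a)) + d * bubble_moment \<alpha> x a b"
    using assms by (simp add: field_simps)
  ultimately show ?thesis by metis
qed

text \<open>The kernel blows up at x, but its antiderivative is continuous there because 1 -
  \<alpha> > 0; differentiability in the interior is enough.\<close>

lemma ker_end_integral:
  assumes "0 < \<alpha>" "\<alpha> < 1" "y < x"
  shows "(ker \<alpha> x has_integral (x - y) powr (1 - \<alpha>) / (1 - \<alpha>)) {y..x}"
proof -
  have "(ker \<alpha> x has_integral (- ((x - x) powr (1 - \<alpha>) / (1 - \<alpha>))) - (- ((x - y) powr (1 - \<alpha>) / (1 - \<alpha>)))) {y..x}"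
  proof (rule fundamental_theorem_of_calculus_interior)
    show "continuous_on {y..x} (\<lambda>s. - ((x - s) powr (1 - \<alpha>) / (1 - \<alpha>)))"
      using assms by (intro continuous_intros continuous_on_powr') auto
    fix s assume "s \<in> {y<..<x}"
    then show "((\<lambda>s. - ((x - s) powr (1 - \<alpha>) / (1 - \<alpha>))) has_vector_derivative ker \<alpha> x s) (at s)"
      unfolding has_real_derivative_iff_has_vector_derivative[symmetric] ker_def using assms
      by (auto intro!: derivative_eq_intros)
  qed (use assms in auto)
  then show ?thesis using assms by simp
qed

section \<open>The discrete operator\<close>

text \<open>Newton's form isolates the second divided difference, the only term by which the
  quadratic interpolant differs from the linear one through the first two nodes.\<close>

lemma newton_quadratic:
  fixes a b c :: real
  assumes "a < b" "b < c"
  shows "p * ((s - b) / (a - b) * ((s - c) / (a - c))) + (q * ((s - a) / (b - a) * ((s - c) / (b - c)))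
      + r * ((s - a) / (c - a) * ((s - b) / (c - b))))
    = p + (q - p) / (b - a) * (s - a)
      + ((r - q) / (c - b) - (q - p) / (b - a)) / ((b - a) + (c - b)) * ((s - a) * (s - b))"
proof -
  define u v w where "u = b - a" and "v = c - b" and "w = s - a"
  have uv: "u > 0" "v > 0" using assms by (auto simp: u_def v_def)
  have eq: "s - b = w - u" "a - b = - u" "s - c = w - u - v" "a - c = - (u + v)" "s - a = w"
    "b - a = u" "b - c = - v" "c - a = u + v" "c - b = v"
    by (auto simp: u_def v_def w_def)
  show ?thesis unfolding eq using uv
    by (simp add: divide_simps) (simp add: algebra_simps power2_eq_square add_pos_pos)
qed

locale caputo_mesh =
  fixes \<alpha> :: real and t :: "nat \<Rightarrow> real" and M :: nat
  assumes alpha_pos: "0 < \<alpha>" and alpha_less_1: "\<alpha> < 1"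
    and t_0: "t 0 = 0" and t_less_Suc: "j < M \<Longrightarrow> t j < t (Suc j)"
begin

text \<open>Intervals and time levels are indexed from 0: interval \<open>i\<close> is \<open>[t i, t (Suc i)]\<close>, and
  level \<open>n\<close> is the discrete derivative at mesh index \<open>Suc n\<close>.\<close>

definition h :: "nat \<Rightarrow> real" where "h i = t (Suc i) - t i"

definition x :: "nat \<Rightarrow> real" where "x n = t (Suc n) - \<alpha> * h n / 2"

definition slope :: "(nat \<Rightarrow> real) \<Rightarrow> nat \<Rightarrow> real" where
  "slope U i = (U (Suc i) - U i) / h i"

text \<open>The integral of the kernel over interval i divided by \<open>h i\<close>. On the last
  interval the integral stops at \<open>x n\<close>, but the divisor is still the full step, because
  the interpolant has slope (U (Suc n) - U n) / h n.\<close>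

definition avg :: "nat \<Rightarrow> nat \<Rightarrow> real" where
  "avg n i = (if i < n then ker \<alpha> (x n) (t (Suc i)) - left_moment \<alpha> (x n) (t i) (t (Suc i)) / h i
     else (x n - t n) powr (1 - \<alpha>) / (1 - \<alpha>) / h n)"

text \<open>Contribution of the quadratic part on interval i: the second divided difference is the
  difference of slopes over \<open>h i + h (Suc i)\<close>, and its integral against the kernel is
  the bubble moment.\<close>

definition corr :: "nat \<Rightarrow> nat \<Rightarrow> real" where
  "corr n i = bubble_moment \<alpha> (x n) (t i) (t (Suc i)) / (h i + h (Suc i))"

text \<open>With \<open>k = 0\<close> this is the Alikhanov operator up to the factor \<open>Gamma (1 - \<alpha>)\<close>; with
  \<open>k = 1\<close> the interpolant is linear instead of quadratic on the first interval.\<close>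

definition frac :: "nat \<Rightarrow> (nat \<Rightarrow> real) \<Rightarrow> nat \<Rightarrow> real" where
  "frac k U n = (\<Sum>i\<le>n. avg n i * (U (Suc i) - U i)) +
     (\<Sum>i\<in>{k..<n}. corr n i * (slope U (Suc i) - slope U i))"

lemma t_mono: "i \<le> j \<Longrightarrow> j \<le> M \<Longrightarrow> t i \<le> t j"
proof (induction rule: dec_induct)
  case (step j)
  then show ?case using t_less_Suc[of j] by simp
qed simp

lemma t_less: "i < j \<Longrightarrow> j \<le> M \<Longrightarrow> t i < t j"
  using t_less_Suc[of i] t_mono[of "Suc i" j] by simp

lemma t_nonneg: "i \<le> M \<Longrightarrow> 0 \<le> t i"
  using t_mono[of 0 i] t_0 by simp

lemma h_pos: "i < M \<Longrightarrow> 0 < h i"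
  using t_less_Suc by (simp add: h_def)

lemma x_diff: "x n - t n = (1 - \<alpha> / 2) * h n"
  by (simp add: x_def h_def field_simps)

lemma x_gt: "n < M \<Longrightarrow> t n < x n"
  using x_diff[of n] h_pos[of n] alpha_less_1
  by (smt (verit) mult_pos_pos field_sum_of_halves)

lemma x_less: "n < M \<Longrightarrow> x n < t (Suc n)"
  using h_pos[of n] alpha_pos by (simp add: x_def)

lemma t_less_x: "i \<le> n \<Longrightarrow> n < M \<Longrightarrow> t i < x n"
  using t_mono[of i n] x_gt[of n] by simp

lemma x_pos: "n < M \<Longrightarrow> 0 < x n"
  using t_less_x[of 0 n] t_0 by simp

lemma x_ge_half: "n < M \<Longrightarrow> t (Suc n) / 2 \<le> x n"
proof -
  assume n: "n < M"
  have "\<alpha> * h n \<le> h n" using h_pos[OF n] alpha_less_1 by simp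
  then show ?thesis using t_nonneg[of n] n by (simp add: x_def h_def)
qed

lemma interp2_newton:
  assumes "Suc i < M"
  shows "interp2 t (Suc i) U s = U i + slope U i * (s - t i) +
     (slope U (Suc i) - slope U i) / (h i + h (Suc i)) * ((s - t i) * (s - t (Suc i)))"
proof -
  have l: "t i < t (Suc i)" "t (Suc i) < t (Suc (Suc i))"
    using assms t_less_Suc by auto
  have s: "{Suc i - 1, Suc i, Suc i + 1} = {i, Suc i, Suc (Suc i)}" by simp
  have d: "{i, Suc i, Suc (Suc i)} - {i} = {Suc i, Suc (Suc i)}"
    "{i, Suc i, Suc (Suc i)} - {Suc i} = {i, Suc (Suc i)}"
    "{i, Suc i, Suc (Suc i)} - {Suc (Suc i)} = {i, Suc i}" by auto
  have "interp2 t (Suc i) U s = U i * ((s - t (Suc i)) / (t i - t (Suc i)) * ((s - t (Suc (Suc i))) / (t i - t (Suc (Suc i)))))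
     + (U (Suc i) * ((s - t i) / (t (Suc i) - t i) * ((s - t (Suc (Suc i))) / (t (Suc i) - t (Suc (Suc i)))))
     + U (Suc (Suc i)) * ((s - t i) / (t (Suc (Suc i)) - t i) * ((s - t (Suc i)) / (t (Suc (Suc i)) - t (Suc i)))))"
    unfolding interp2_def lagrange_interp_def s by (simp add: d)
  also note newton_quadratic[OF l]
  finally show ?thesis by (simp add: slope_def h_def)
qed

lemma interp1_newton:
  assumes "n < M"
  shows "interp1 t (Suc n) U s = U n + slope U n * (s - t n)"
proof -
  have l: "t n < t (Suc n)" using assms t_less_Suc by auto
  have s: "{Suc n - 1, Suc n} = {n, Suc n}" by simp
  have d: "{n, Suc n} - {n} = {Suc n}" "{n, Suc n} - {Suc n} = {n}" by auto
  have "interp1 t (Suc n) U s = U n * ((s - t (Suc n)) / (t n - t (Suc n))) + U (Suc n) * ((s - t n) / (t (Suc n) - t n))"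
    unfolding interp1_def lagrange_interp_def s by (simp add: d)
  also have "\<dots> = U n + slope U n * (s - t n)"
    using l by (simp add: slope_def h_def divide_simps) (simp add: algebra_simps)
  finally show ?thesis .
qed

lemma alikhanov_interp_deriv_inner:
  assumes "n < M" "i < n" "s \<in> {t i<..<t (Suc i)}"
  shows "deriv (alikhanov_interp t (Suc n) U) s = slope U i +
     (slope U (Suc i) - slope U i) / (h i + h (Suc i)) * (2 * s - t i - t (Suc i))"
proof (rule DERIV_imp_deriv)
  define D where "D = (slope U (Suc i) - slope U i) / (h i + h (Suc i))"
  have "((\<lambda>s. U i + slope U i * (s - t i) + D * ((s - t i) * (s - t (Suc i)))) has_real_derivative
      slope U i + D * (2 * s - t i - t (Suc i))) (at s)"
    by (auto intro!: derivative_eq_intros simp: algebra_simps)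
  moreover have "alikhanov_interp t (Suc n) U r =
      U i + slope U i * (r - t i) + D * ((r - t i) * (r - t (Suc i)))" if r: "r \<in> {t i<..<t (Suc i)}" for r
  proof -
    have "r < t n" using r t_mono[of "Suc i" n] assms by auto
    \<comment> \<open>The piece is selected by the first node to the right of r, so interval i uses
      the parabola with index \<open>Suc i\<close>, that is, with nodes i, i + 1 and i + 2.\<close>
    moreover have "(LEAST j. r < t j) = Suc i"
    proof (rule Least_equality)
      fix y assume "r < t y"
      then show "Suc i \<le> y"
        using r t_mono[of y i] assms by (cases "Suc i \<le> y") auto
    qed (use r in auto)
    ultimately show ?thesis
      using interp2_newton[of i U r] assms by (simp add: alikhanov_interp_def D_def)
  qed
  ultimately show "(alikhanov_interp t (Suc n) U has_real_derivative
      slope U i + (slope U (Suc i) - slope U i) / (h i + h (Suc i)) * (2 * s - t i - t (Suc i))) (at s)"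
    unfolding D_def[symmetric]
    using assms(3) by (auto elim!: has_field_derivative_transform_within_open[where S = "{t i<..<t (Suc i)}"])
qed

lemma alikhanov_interp_deriv_last:
  assumes "n < M" "t n < s"
  shows "deriv (alikhanov_interp t (Suc n) U) s = slope U n"
proof (rule DERIV_imp_deriv)
  have "((\<lambda>s. U n + slope U n * (s - t n)) has_real_derivative slope U n) (at s)"
    by (auto intro!: derivative_eq_intros)
  then show "(alikhanov_interp t (Suc n) U has_real_derivative slope U n) (at s)"
    by (rule has_field_derivative_transform_within_open[where S = "{t n<..}"])
      (use assms interp1_newton[of n U] in \<open>auto simp: alikhanov_interp_def\<close>)
qed

text \<open>On each interval the integrand agrees with an explicit one except possibly at mesh
  points, where the interpolant may have a kink; finitely many points do not affect the integral,
  and the pieces are then concatenated.\<close>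

lemma alikhanov_eq_frac:
  assumes n: "n < M"
  shows "alikhanov \<alpha> t U (Suc n) = frac 0 U n / Gamma (1 - \<alpha>)"
proof -
  define f where "f = (\<lambda>s. (x n - s) powr (- \<alpha>) * deriv (alikhanov_interp t (Suc n) U) s)"
  define c where "c i = avg n i * (U (Suc i) - U i) + corr n i * (slope U (Suc i) - slope U i)" for i
  have inner: "(f has_integral c i) {t i..t (Suc i)}" if i: "i < n" for i
  proof -
    define D where "D = (slope U (Suc i) - slope U i) / (h i + h (Suc i))"
    have l: "t i < t (Suc i)" "t (Suc i) < x n" using i n t_less_Suc t_less_x by auto
    have "((\<lambda>s. ker \<alpha> (x n) s * (slope U i + D * (2 * s - t i - t (Suc i)))) has_integral c i)
         {t i..t (Suc i)}"
    proof -
      have "(ker \<alpha> (x n) (t (Suc i)) - left_moment \<alpha> (x n) (t i) (t (Suc i)) / (t (Suc i) - t i)) *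
          (slope U i * (t (Suc i) - t i)) + D * bubble_moment \<alpha> (x n) (t i) (t (Suc i)) = c i"
        using i l by (simp add: c_def avg_def corr_def D_def slope_def h_def mult.commute)
      then show ?thesis
        using ker_quadratic_integral[OF l, of \<alpha> "slope U i" D] by simp
    qed
    then show ?thesis
      by (rule has_integral_spike_finite[of "{t i, t (Suc i)}", rotated 2])
        (use alikhanov_interp_deriv_inner[OF n i, of _ U] in \<open>auto simp: f_def ker_def D_def\<close>)
  qed
  have "(f has_integral (\<Sum>i<m. c i)) {0..t m}" if "m \<le> n" for m
    using that
  proof (induction m)
    case (Suc m)
    have "0 \<le> t m" "t m \<le> t (Suc m)" using Suc.prems n t_nonneg t_mono by auto
    moreover have "(f has_integral (\<Sum>i<m. c i)) {0..t m}" "(f has_integral c m) {t m..t (Suc m)}"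
      using Suc inner by auto
    ultimately show ?case using has_integral_combine[of 0 "t m" "t (Suc m)" f] by simp
  qed (simp add: t_0 has_integral_refl)
  then have "(f has_integral (\<Sum>i<n. c i)) {0..t n}" by simp
  moreover have "(f has_integral avg n n * (U (Suc n) - U n)) {t n..x n}"
  proof -
    have "((\<lambda>s. ker \<alpha> (x n) s * slope U n) has_integral avg n n * (U (Suc n) - U n)) {t n..x n}"
      using has_integral_mult_left[OF ker_end_integral[OF alpha_pos alpha_less_1 x_gt[OF n]], of "slope U n"]
      by (simp add: avg_def slope_def mult.commute)
    then show ?thesis
      by (rule has_integral_spike_finite[of "{t n}", rotated 2])
        (use alikhanov_interp_deriv_last[OF n, of _ U] in \<open>auto simp: f_def ker_def\<close>)
  qed
  ultimately have "(f has_integral (\<Sum>i<n. c i) + avg n n * (U (Suc n) - U n)) {0..x n}"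
    using has_integral_combine[of 0 "t n" "x n" f] t_nonneg[of n] x_gt[OF n] n by simp
  then have "integral {0..x n} f = frac 0 U n"
    by (simp add: integral_unique frac_def c_def sum.distrib atLeast0LessThan
        lessThan_Suc_atMost[symmetric])
  moreover have "alikhanov_point \<alpha> t (Suc n) = x n"
    by (simp add: alikhanov_point_def x_def h_def mesh_step_def)
  ultimately show ?thesis
    by (simp add: alikhanov_def caputo_def f_def)
qed

end

section \<open>Comparison principle\<close>

text \<open>Abel summation writes the newest value, times its positive coefficient, as a nonnegative
  quantity plus a combination of earlier values whose coefficients
  \<open>\<kappa> n (Suc i) - \<kappa> n i\<close> and \<open>\<kappa> n 0\<close> are nonnegative.
  Strong induction on the index then applies.\<close>

lemma comparison_abstract:
  fixes \<kappa> :: "nat \<Rightarrow> nat \<Rightarrow> real" and Z :: "nat \<Rightarrow> real"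
  assumes pos: "\<And>n. n < N \<Longrightarrow> 0 < \<kappa> n 0"
    and mono: "\<And>n i. n < N \<Longrightarrow> i < n \<Longrightarrow> \<kappa> n i \<le> \<kappa> n (Suc i)"
    and sum: "\<And>n. n < N \<Longrightarrow> 0 \<le> (\<Sum>i\<le>n. \<kappa> n i * (Z (Suc i) - Z i))"
    and Z0: "0 \<le> Z 0"
  shows "n \<le> N \<Longrightarrow> 0 \<le> Z n"
proof (induction n rule: less_induct)
  case (less m)
  show ?case
  proof (cases m)
    case (Suc n)
    have n: "n < N" using less.prems Suc by simp
    have abel: "(\<Sum>i\<le>l. \<kappa> n i * (Z (Suc i) - Z i)) =
        \<kappa> n l * Z (Suc l) - (\<Sum>i<l. (\<kappa> n (Suc i) - \<kappa> n i) * Z (Suc i)) - \<kappa> n 0 * Z 0" for l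
      by (induction l) (auto simp: algebra_simps)
    have k0: "0 < \<kappa> n i" if "i \<le> n" for i
      using that
    proof (induction i)
      case (Suc i)
      then show ?case using mono[of n i] n by force
    qed (use pos n in auto)
    have "0 \<le> (\<Sum>i<n. (\<kappa> n (Suc i) - \<kappa> n i) * Z (Suc i))"
      using less Suc n mono by (intro sum_nonneg mult_nonneg_nonneg) auto
    moreover have "0 \<le> \<kappa> n 0 * Z 0" using pos[OF n] Z0 by simp
    ultimately have "0 \<le> \<kappa> n n * Z (Suc n)"
      using sum[OF n] abel[of n] by linarith
    then show ?thesis using k0[of n] Suc by (simp add: zero_le_mult_iff)
  qed (use Z0 in auto)
qed

text \<open>Here p, q, s are three consecutive steps. With rho = q/p and denominators cleared, the
  second alternative uses 3 rho^2 (1 + rho) \<ge> 1 at rho = 4/7. The first uses p s \<le> q^2 to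
  bring in the term q^3 (p + q), so that (3 rho^2 + rho)(1 + rho) \<ge> 1 suffices, which holds at
  rho = 0.4656.\<close>

lemma ratio_inequality:
  fixes p q s :: real
  assumes "0 < p" "0 < q" "0 < s"
    and "0.4656 \<le> s / q \<and> 0.4656 \<le> q / p \<and> s / q \<le> q / p \<or> 4 / 7 \<le> q / p"
  shows "p^3 / (6 * (p + q) * q) \<le> q / 2 + q\<^sup>2 / (6 * s)"
proof -
  have main: "p^3 * s \<le> 3 * q\<^sup>2 * (p + q) * s + q^3 * (p + q)"
    using assms(4)
  proof
    assume a: "4 / 7 \<le> q / p"
    then have q: "4 / 7 * p \<le> q" using assms by (simp add: field_simps)
    have "(4 / 7 * p)\<^sup>2 * (p + 4 / 7 * p) \<le> q\<^sup>2 * (p + q)"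
      using q assms by (intro mult_mono power_mono) auto
    moreover have "0 \<le> p * (p * p)" using assms by simp
    ultimately have "p^3 \<le> 3 * q\<^sup>2 * (p + q)"
      by (simp add: power2_eq_square power3_eq_cube algebra_simps)
    then have "p^3 * s \<le> 3 * q\<^sup>2 * (p + q) * s" using assms by (intro mult_right_mono) auto
    then show ?thesis using assms by (smt (verit) mult_pos_pos zero_less_power)
  next
    assume a: "0.4656 \<le> s / q \<and> 0.4656 \<le> q / p \<and> s / q \<le> q / p"
    then have q: "0.4656 * p \<le> q" and s: "p * s \<le> q\<^sup>2"
      using assms by (auto simp: field_simps power2_eq_square)
    have "(0.4656 * p)\<^sup>2 * (p + 0.4656 * p) \<le> q\<^sup>2 * (p + q)"
      using q assms by (intro mult_mono power_mono) auto
    moreover have "0.4656 * p * p * (p + 0.4656 * p) \<le> q * p * (p + q)"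
      using q assms by (intro mult_mono) auto
    moreover have "0 \<le> p * (p * p)" using assms by simp
    ultimately have "p^3 \<le> 3 * q\<^sup>2 * (p + q) + q * p * (p + q)"
      by (simp add: power2_eq_square power3_eq_cube algebra_simps)
    then have "p^3 * s \<le> (3 * q\<^sup>2 * (p + q) + q * p * (p + q)) * s"
      using assms by (intro mult_right_mono) auto
    moreover have "q * (p + q) * (p * s) \<le> q * (p + q) * q\<^sup>2"
      using s assms by (intro mult_left_mono) auto
    ultimately show ?thesis by (simp add: power2_eq_square power3_eq_cube algebra_simps)
  qed
  have "q / 2 + q\<^sup>2 / (6 * s) - p^3 / (6 * (p + q) * q) =
     (3 * q\<^sup>2 * (p + q) * s + q^3 * (p + q) - p^3 * s) / (6 * (p + q) * q * s)"
    using assms by (simp add: divide_simps add_pos_pos) (simp add: power2_eq_square power3_eq_cube algebra_simps)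
  moreover have "0 \<le> \<dots>" using main assms by (intro divide_nonneg_nonneg mult_nonneg_nonneg) auto
  ultimately show ?thesis by linarith
qed

section \<open>Coefficients of the discrete operator and their monotonicity\<close>

context caputo_mesh
begin

text \<open>Extending the corrections by zero outside the summation range lets the index shift in
  \<open>frac_eq_kernel\<close> run over all intervals without boundary terms.\<close>

definition weight :: "nat \<Rightarrow> nat \<Rightarrow> nat \<Rightarrow> real" where
  "weight k n i = (if k \<le> i \<and> i < n then corr n i else 0)"

text \<open>The slope on interval i occurs twice in the corrections: positively in that of interval
  i - 1 and negatively in that of interval i.\<close>

definition kernel :: "nat \<Rightarrow> nat \<Rightarrow> nat \<Rightarrow> real" where
  "kernel k n i = avg n i + ((case i of 0 \<Rightarrow> 0 | Suc j \<Rightarrow> weight k n j) - weight k n i) / h i"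

lemma frac_eq_kernel: "frac k U n = (\<Sum>i\<le>n. kernel k n i * (U (Suc i) - U i))"
proof -
  let ?w = "weight k n"
  have "(\<Sum>i\<in>{k..<n}. corr n i * (slope U (Suc i) - slope U i)) =
      (\<Sum>i<n. ?w i * (slope U (Suc i) - slope U i))"
    by (rule sum.mono_neutral_cong_left) (auto simp: weight_def)
  also have "\<dots> = (\<Sum>i<n. ?w i * slope U (Suc i)) - (\<Sum>i<n. ?w i * slope U i)"
    by (simp add: right_diff_distrib sum_subtractf)
  also have "(\<Sum>i<n. ?w i * slope U (Suc i)) = (\<Sum>i<Suc n. (case i of 0 \<Rightarrow> 0 | Suc j \<Rightarrow> ?w j) * slope U i)"
    by (subst sum.lessThan_Suc_shift) simp
  also have "(\<Sum>i<n. ?w i * slope U i) = (\<Sum>i<Suc n. ?w i * slope U i)"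
    by (simp add: weight_def)
  finally show ?thesis
    by (simp add: frac_def kernel_def slope_def lessThan_Suc_atMost[symmetric] sum.distrib[symmetric]
        sum_subtractf[symmetric] algebra_simps add_divide_distrib diff_divide_distrib
        del: sum.lessThan_Suc)
qed

lemma frac_diff: "frac k (\<lambda>i. U i - V i) n = frac k U n - frac k V n"
  by (simp add: frac_eq_kernel sum_subtractf[symmetric] algebra_simps)

lemma frac_add: "frac k (\<lambda>i. U i + V i) n = frac k U n + frac k V n"
  by (simp add: frac_eq_kernel sum.distrib[symmetric] algebra_simps)

lemma frac_scale: "frac k (\<lambda>i. c * U i) n = c * frac k U n"
  by (simp add: frac_eq_kernel sum_distrib_left algebra_simps)

lemma frac_uminus: "frac k (\<lambda>i. - U i) n = - frac k U n"
  using frac_scale[of k "-1"] by simp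

lemma frac_sum: "frac k (\<lambda>i. \<Sum>p\<in>P. U p i) n = (\<Sum>p\<in>P. frac k (U p) n)"
proof (induction P rule: infinite_finite_induct)
  case (insert p P)
  then show ?case by (simp add: frac_add)
qed (simp_all add: frac_def slope_def)

lemma frac_step:
  "frac k (\<lambda>i. if i = 0 then 0 else c) n = c * kernel k n 0"
proof -
  have "frac k (\<lambda>i. if i = 0 then 0 else c) n =
      (\<Sum>i\<le>n. if i = 0 then c * kernel k n 0 else 0)"
    unfolding frac_eq_kernel by (rule sum.cong) auto
  then show ?thesis by simp
qed

lemma corr_nonneg: "i < n \<Longrightarrow> n < M \<Longrightarrow> 0 \<le> corr n i"
  unfolding corr_def using t_less_Suc[of i] h_pos[of i] h_pos[of "Suc i"] t_less_x[of "Suc i" n] alpha_pos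
  by (intro divide_nonneg_nonneg bubble_moment_nonneg) auto

lemma avg_eq_right_moment:
  assumes "i < n" "n < M"
  shows "avg n i = ker \<alpha> (x n) (t i) + right_moment \<alpha> (x n) (t i) (t (Suc i)) / h i"
proof -
  have "t i \<le> t (Suc i)" "t (Suc i) < x n" using assms t_mono t_less_x by auto
  from moments_add[OF this, of \<alpha>] show ?thesis
    using assms h_pos[of i] by (simp add: avg_def h_def field_simps)
qed

text \<open>On an inner interval the mean exceeds the left endpoint value by the right moment over
  \<open>h i\<close>, and that surplus pays for the correction because the bubble is at most the
  step times b - s. On the last interval, truncation costs the factor 1 - \<alpha>/2, but the
  singularity gains 1/(1 - \<alpha>), which is larger.\<close>

lemma avg_weight_ge:
  assumes "i \<le> n" "n < M"
  shows "ker \<alpha> (x n) (t i) \<le> avg n i - weight k n i / h i"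
proof (cases "i < n")
  case True
  define R where "R = right_moment \<alpha> (x n) (t i) (t (Suc i))"
  have l: "t i \<le> t (Suc i)" "t (Suc i) < x n" using assms True t_mono t_less_x by auto
  have h: "0 < h i" "0 < h (Suc i)" using assms True h_pos by auto
  have R: "0 \<le> R" unfolding R_def by (rule right_moment_nonneg[OF alpha_pos l])
  have "weight k n i \<le> corr n i" using corr_nonneg assms True by (simp add: weight_def)
  also have "corr n i \<le> h i * R / (h i + h (Suc i))"
    using bubble_le_right_moment[OF alpha_pos l] h
    by (simp add: corr_def R_def h_def divide_right_mono)
  also have "\<dots> \<le> R" using R h by (simp add: divide_simps add_pos_pos) (simp add: algebra_simps)
  finally have "weight k n i / h i \<le> R / h i" using h by (simp add: divide_right_mono)
  then show ?thesis using avg_eq_right_moment[OF True assms(2)] by (simp add: R_def)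
next
  case False
  then have i: "i = n" using assms by simp
  have y: "0 < x n - t n" using x_gt assms by simp
  have h: "h n > 0" using assms h_pos by simp
  have p: "(x n - t n) powr (1 - \<alpha>) = (x n - t n) * (x n - t n) powr (- \<alpha>)"
    using y powr_mult_base[of "x n - t n" "- \<alpha>"] by simp
  have "avg n n = (1 - \<alpha> / 2) / (1 - \<alpha>) * (x n - t n) powr (- \<alpha>)"
    using h by (simp add: avg_def p) (simp add: x_diff)
  moreover have "1 \<le> (1 - \<alpha> / 2) / (1 - \<alpha>)" using alpha_pos alpha_less_1 by simp
  ultimately have "1 * (x n - t n) powr (- \<alpha>) \<le> avg n n"
    by (metis mult_right_mono powr_ge_zero)
  then show ?thesis by (simp add: i weight_def ker_def)
qed

lemma kernel_0_ge:
  assumes "n < M"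
  shows "x n powr (- \<alpha>) \<le> kernel k n 0"
  using avg_weight_ge[of 0 n k] assms by (simp add: kernel_def ker_def t_0 diff_divide_distrib)

lemma kernel_0_pos: "n < M \<Longrightarrow> 0 < kernel k n 0"
  using kernel_0_ge[of n k] x_pos[of n] by (smt (verit) powr_gt_zero)

lemma step_ratio_eq: "0 < i \<Longrightarrow> step_ratio t i = h i / h (i - 1)"
  by (simp add: step_ratio_def mesh_step_def h_def)

text \<open>Both coefficients are compared with the kernel at the shared node
  \<open>t (Suc i)\<close>: the right one is bounded below by \<open>avg_weight_ge\<close>, the left
  one above by \<open>key\<close>.\<close>

lemma kernel_mono:
  assumes rc: "ratio_condition M t" and i: "i < n" and n: "n < M" and k: "k \<noteq> 0 \<or> n \<le> 1"
  shows "kernel k n i \<le> kernel k n (Suc i)"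
proof -
  define L where "L = left_moment \<alpha> (x n) (t i) (t (Suc i))"
  define w where "w = (case i of 0 \<Rightarrow> 0 | Suc j \<Rightarrow> weight k n j)"
  have l: "t i \<le> t (Suc i)" "t (Suc i) < x n" using i n t_mono t_less_x by auto
  have h: "0 < h i" "0 < h (Suc i)" using i n h_pos by auto
  have L0: "0 \<le> L" unfolding L_def by (rule left_moment_nonneg[OF alpha_pos l])
  have w0: "0 \<le> weight k n i" using corr_nonneg i n by (simp add: weight_def)
  \<comment> \<open>Only \<open>w\<close>, the correction of the preceding interval, has the wrong
    sign. That interval lies to the left of \<open>t i\<close> and the compensating moments lie to
    its right, so by monotonicity \<open>ker'\<close> can be frozen at \<open>t i\<close> in all of
    them; what remains is an inequality between step lengths.\<close>
  have key: "w / h i \<le> L / h i + weight k n i * (1 / h (Suc i) + 1 / h i)"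
  proof (cases "\<exists>j. i = Suc j \<and> k \<le> j")
    case False
    then have "w = 0" by (auto simp: w_def weight_def split: nat.splits)
    then show ?thesis using L0 w0 h by simp
  next
    case True
    then obtain j where j: "i = Suc j" "k \<le> j" by blast
    have n2: "1 < n" using i j by simp
    then have k1: "1 \<le> k" using k by simp
    define G where "G = ker' \<alpha> (x n) (t i)"
    have G0: "0 < G" unfolding G_def using l by (intro ker'_pos alpha_pos) auto
    have lj: "t j \<le> t i" "t i < x n" using i n t_mono t_less_x j by auto
    have hj: "0 < h j" using j i n h_pos by simp
    have "w = bubble_moment \<alpha> (x n) (t j) (t i) / (h j + h i)"
      using j i by (simp add: w_def weight_def corr_def)
    also have "\<dots> \<le> (h j ^ 3 / 6 * G) / (h j + h i)"
      using bubble_moment_le[OF alpha_pos lj] hj h j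
      by (intro divide_right_mono) (auto simp: h_def G_def)
    finally have "w / h i \<le> (h j ^ 3 / 6 * G) / (h j + h i) / h i"
      using h by (intro divide_right_mono) auto
    also have "\<dots> = h j ^ 3 / (6 * (h j + h i) * h i) * G" by simp
    also have "\<dots> \<le> (h i / 2 + (h i)\<^sup>2 / (6 * h (Suc i))) * G"
    proof (intro mult_right_mono ratio_inequality)
      have s: "step_ratio t i = h i / h j" "step_ratio t (Suc i) = h (Suc i) / h i"
        using step_ratio_eq[of i] step_ratio_eq[of "Suc i"] j by auto
      \<comment> \<open>Since k is at least 1, so is j, and the ratio with index i \<ge> 2 falls
        under the condition. With k = 0 the ratio with index 1 would appear here.\<close>
      have "2 \<le> i" "Suc i < M" "i < M" using j k1 i n by auto
      then show "0.4656 \<le> h (Suc i) / h i \<and> 0.4656 \<le> h i / h j \<and> h (Suc i) / h i \<le> h i / h j \<or> 4 / 7 \<le> h i / h j"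
        using rc unfolding ratio_condition_def s[symmetric]
        by (metis diff_Suc_1 le_SucI)
    qed (use h hj G0 in auto)
    also have "\<dots> \<le> L / h i + weight k n i * (1 / h (Suc i) + 1 / h i)"
    proof -
      have "(h i)\<^sup>2 / 2 * G / h i \<le> L / h i"
        using left_moment_ge[OF alpha_pos l] h
        by (intro divide_right_mono) (auto simp: L_def G_def h_def)
      then have 1: "h i / 2 * G \<le> L / h i" using h by (simp add: power2_eq_square)
      have 2: "weight k n i * (1 / h (Suc i) + 1 / h i) =
          bubble_moment \<alpha> (x n) (t i) (t (Suc i)) / (h i * h (Suc i))"
        using j i h by (simp add: weight_def corr_def divide_simps add_pos_pos)
      have "h i ^ 3 / 6 * G / (h i * h (Suc i)) \<le>
          bubble_moment \<alpha> (x n) (t i) (t (Suc i)) / (h i * h (Suc i))"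
        using bubble_moment_ge[OF alpha_pos l] h
        by (intro divide_right_mono) (auto simp: G_def h_def)
      moreover have "h i ^ 3 / 6 * G / (h i * h (Suc i)) = (h i)\<^sup>2 / (6 * h (Suc i)) * G"
        using h by (simp add: power2_eq_square power3_eq_cube)
      ultimately have "(h i)\<^sup>2 / (6 * h (Suc i)) * G \<le> weight k n i * (1 / h (Suc i) + 1 / h i)"
        unfolding 2 by simp
      with 1 show ?thesis by (simp add: distrib_right)
    qed
    finally show ?thesis .
  qed
  have "kernel k n i = ker \<alpha> (x n) (t (Suc i)) - L / h i + (w - weight k n i) / h i"
    using i by (simp add: kernel_def avg_def L_def w_def)
  also have "\<dots> = ker \<alpha> (x n) (t (Suc i)) + w / h i - L / h i - weight k n i / h i"
    by (simp add: diff_divide_distrib)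
  also have "\<dots> \<le> ker \<alpha> (x n) (t (Suc i)) + weight k n i / h (Suc i)"
    using key by (simp add: distrib_left)
  also have "\<dots> \<le> avg n (Suc i) - weight k n (Suc i) / h (Suc i) + weight k n i / h (Suc i)"
    using avg_weight_ge[of "Suc i" n k] i n by simp
  also have "\<dots> = kernel k n (Suc i)" by (simp add: kernel_def diff_divide_distrib)
  finally show ?thesis .
qed

text \<open>The ratio of the first two steps is not controlled, so from the third level on the first
  quadratic correction can destroy the monotonicity of the kernel and has to be dropped.\<close>

definition start :: "nat \<Rightarrow> nat" where "start n = (if n \<le> 1 then 0 else 1)"

lemma comparison:
  assumes "ratio_condition M t" "N \<le> M" "U 0 \<le> W 0"
    and "\<And>n. n < N \<Longrightarrow> frac (start n) U n \<le> frac (start n) W n"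
    and "n \<le> N"
  shows "U n \<le> W n"
proof -
  have "0 \<le> (\<lambda>i. W i - U i) n"
  proof (rule comparison_abstract[where \<kappa> = "\<lambda>n. kernel (start n) n" and N = N])
    fix n assume n: "n < N"
    show "0 \<le> (\<Sum>i\<le>n. kernel (start n) n i * (W (Suc i) - U (Suc i) - (W i - U i)))"
      using assms(4)[OF n] frac_diff[of "start n" W U n] unfolding frac_eq_kernel by simp
    show "kernel (start n) n i \<le> kernel (start n) n (Suc i)" if "i < n" for i
      using that n assms by (intro kernel_mono) (auto simp: start_def)
  qed (use assms kernel_0_pos in auto)
  then show ?thesis by simp
qed

lemma frac_start:
  "frac (start n) U n = frac 0 U n - (if n \<le> 1 then 0 else corr n 0 * (slope U 1 - slope U 0))"
  by (simp add: frac_def start_def sum.atLeast_Suc_lessThan)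

section \<open>The first two levels and comparison with a constant\<close>

lemma h_0: "h 0 = t 1"
  by (simp add: h_def t_0)

lemma t1_pos: "0 < M \<Longrightarrow> 0 < t 1"
  using t_less[of 0 1] t_0 by simp

text \<open>The crude bound by the kernel at \<open>t 1\<close> degenerates when \<open>x n\<close>
  is close to \<open>t 1\<close>. Integrating exactly and using (x - t_1)^(-\<alpha>) \<ge>
  x^(-\<alpha>) gives a bound in terms of \<open>x n\<close> alone.\<close>

lemma avg_0_le:
  assumes "n < M"
  shows "avg n 0 \<le> x n powr (- \<alpha>) / (1 - \<alpha>)"
proof (cases "n = 0")
  case True
  have x: "0 < x 0" "x 0 \<le> t 1" using x_pos[of 0] x_less[of 0] assms True by auto
  have "avg 0 0 = x 0 / t 1 * (x 0 powr (- \<alpha>) / (1 - \<alpha>))"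
    using x powr_mult_base[of "x 0" "- \<alpha>"] by (simp add: avg_def t_0 h_0 field_simps)
  also have "\<dots> \<le> 1 * (x 0 powr (- \<alpha>) / (1 - \<alpha>))"
    using x alpha_less_1 by (intro mult_right_mono) auto
  finally show ?thesis using True by simp
next
  case False
  have t1: "0 < t 1" "t 1 < x n" using t_less[of 0 1] t_0 assms t_less_x[of 1 n] False by auto
  have "(ker \<alpha> (x n) has_integral avg n 0 * t 1) {0..t 1}"
    using ker_quadratic_integral[OF t1, of \<alpha> 1 0] False by (simp add: avg_def t_0 h_0)
  moreover have "(ker \<alpha> (x n) has_integral (- ((x n - t 1) powr (1 - \<alpha>) / (1 - \<alpha>))) -
     (- ((x n - 0) powr (1 - \<alpha>) / (1 - \<alpha>)))) {0..t 1}"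
  proof (rule fundamental_theorem_of_calculus)
    fix s assume "s \<in> {0..t 1}"
    then show "((\<lambda>s. - ((x n - s) powr (1 - \<alpha>) / (1 - \<alpha>))) has_vector_derivative ker \<alpha> (x n) s) (at s within {0..t 1})"
      unfolding has_real_derivative_iff_has_vector_derivative[symmetric] ker_def using t1 alpha_less_1
      by (auto intro!: derivative_eq_intros)
  qed (use t1 in auto)
  ultimately have eq: "avg n 0 * t 1 = (x n powr (1 - \<alpha>) - (x n - t 1) powr (1 - \<alpha>)) / (1 - \<alpha>)"
    by (drule_tac has_integral_unique) (auto simp: diff_divide_distrib)
  have "(x n - t 1) * x n powr (- \<alpha>) \<le> (x n - t 1) * (x n - t 1) powr (- \<alpha>)"
    using t1 alpha_pos by (intro mult_left_mono powr_mono2') auto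
  also have "\<dots> = (x n - t 1) powr (1 - \<alpha>)"
    using t1 powr_mult_base[of "x n - t 1" "- \<alpha>"] by simp
  finally have "x n powr (1 - \<alpha>) - (x n - t 1) powr (1 - \<alpha>) \<le> t 1 * x n powr (- \<alpha>)"
    using powr_mult_base[of "x n" "- \<alpha>"] t1 by (simp add: algebra_simps)
  then have "avg n 0 * t 1 \<le> t 1 * x n powr (- \<alpha>) / (1 - \<alpha>)"
    unfolding eq using alpha_less_1 by (intro divide_right_mono) auto
  then have "t 1 * avg n 0 \<le> t 1 * (x n powr (- \<alpha>) / (1 - \<alpha>))" by (simp add: mult.commute)
  then show ?thesis using t1 mult_le_cancel_left_pos by blast
qed

text \<open>The evaluation point is at least half of \<open>t (Suc n)\<close>; the factor 4 = 2^2
  covers every exponent up to 2, in particular \<alpha> and \<alpha> + 1.\<close>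

lemma x_powr_le:
  assumes "n < M" "0 \<le> e" "e \<le> 2"
  shows "x n powr (- e) \<le> 4 * t (Suc n) powr (- e)"
proof -
  have t: "0 < t (Suc n)" using t_less[of 0 "Suc n"] t_0 assms by simp
  have "x n powr (- e) \<le> (t (Suc n) / 2) powr (- e)"
    using x_ge_half[OF assms(1)] t assms by (intro powr_mono2') auto
  also have "\<dots> = 2 powr e * t (Suc n) powr (- e)"
    using t by (simp add: powr_divide powr_minus field_simps)
  also have "\<dots> \<le> 2 powr 2 * t (Suc n) powr (- e)"
    using assms by (intro mult_right_mono powr_mono) auto
  finally show ?thesis by simp
qed

lemma corr_0_le:
  assumes "0 < n" "n < M"
  shows "corr n 0 \<le> t 1 * avg n 0"
proof -
  have t1: "0 < t 1" using t1_pos assms by simp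
  have "0 < ker \<alpha> (x n) 0" using ker_pos x_pos assms by simp
  then have "corr n 0 / t 1 \<le> avg n 0"
    using avg_weight_ge[of 0 n 0] assms t_0 by (simp add: weight_def h_0)
  then show ?thesis using t1 by (simp add: field_simps)
qed

lemma first_value_le:
  assumes "0 < M" "U 0 = 0" "frac 0 U 0 \<le> B" "0 \<le> B"
  shows "U 1 \<le> B * t 1 powr \<alpha>"
proof -
  have "t 1 powr (- \<alpha>) \<le> x 0 powr (- \<alpha>)"
    using x_pos[of 0] x_less[of 0] assms alpha_pos by (intro powr_mono2') auto
  also have "\<dots> \<le> kernel 0 0 0" using kernel_0_ge[of 0 0] assms by simp
  finally have k: "t 1 powr (- \<alpha>) \<le> kernel 0 0 0" .
  have "kernel 0 0 0 * U 1 \<le> B" using assms by (simp add: frac_eq_kernel)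
  then have "t 1 powr (- \<alpha>) * U 1 \<le> B"
    using k assms by (smt (verit) mult_right_mono powr_gt_zero mult_nonneg_nonpos powr_ge_zero)
  then show ?thesis using t1_pos[OF assms(1)] by (simp add: powr_minus field_simps)
qed

text \<open>At the second level the slope of the second interval is multiplied by
  \<open>avg 1 1 * h 1 + corr 1 0\<close>, and everything else involves only the data and
  \<open>U 1\<close>. Bounding the slope, rather than the increment, by a constant independent of
  \<open>h 1 / h 0\<close> requires a lower bound for this sum.\<close>

lemma second_slope_le:
  assumes M: "1 < M" and U0: "U 0 = 0" and U1: "\<bar>U 1\<bar> \<le> C1 * t 1 powr \<alpha>"
    and F: "frac 0 U 1 \<le> C2 * (t 1 / t 2) powr \<alpha>"
    and C: "0 \<le> C1" "0 \<le> C2"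
  shows "slope U 1 \<le> (C2 + 8 * C1 / (1 - \<alpha>)) * 24 / \<alpha> * t 1 powr (\<alpha> - 1)"
proof (cases "slope U 1 \<le> 0")
  case True
  moreover have "0 \<le> (C2 + 8 * C1 / (1 - \<alpha>)) * 24 / \<alpha> * t 1 powr (\<alpha> - 1)"
    using C alpha_pos alpha_less_1 by (intro mult_nonneg_nonneg divide_nonneg_nonneg add_nonneg_nonneg) auto
  ultimately show ?thesis by linarith
next
  case False
  have t1: "0 < t 1" "t 1 < t 2" using t1_pos t_less[of 1 2] M by auto
  have h1: "h 1 = t 2 - t 1" by (simp add: h_def numeral_2_eq_2)
  have x1: "t 1 < x 1" "x 1 < t 2" using x_gt[of 1] x_less[of 1] M by (auto simp: numeral_2_eq_2)
  define P where "P = t 1 powr \<alpha> * t 2 powr (- \<alpha>)"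
  have P: "(t 1 / t 2) powr \<alpha> = P" using t1 by (simp add: P_def powr_divide powr_minus field_simps)
  define A where "A = avg 1 1 * h 1 + corr 1 0"
  have a10: "avg 1 0 \<le> 4 * t 2 powr (- \<alpha>) / (1 - \<alpha>)"
    using avg_0_le[of 1] x_powr_le[of 1 \<alpha>] M alpha_pos alpha_less_1
    by (smt (verit) divide_right_mono One_nat_def Suc_1)
  have a10p: "0 < avg 1 0"
    using avg_weight_ge[of 0 1 1] ker_pos[of "t 0" "x 1" \<alpha>] M x1 t1 t_0 by (simp add: weight_def)
  have c0: "0 \<le> corr 1 0" using corr_nonneg[of 0 1] M by simp
  \<comment> \<open>If the second step is the longer one, the averaged kernel alone suffices.
    Otherwise its contribution may vanish with \<open>h 1\<close>, but then \<open>t 2\<close> is at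
    most 2 \<open>t 1\<close> and the correction has the required size: t_1^3/6 from the bubble
    moment, divided by at most 2 t_1, and one more factor 2 from \<open>t 2\<close>, which gives
    24.\<close>
  have low: "\<alpha> / 24 * (t 1 * t 2 powr (- \<alpha>)) \<le> A"
  proof (cases "t 1 \<le> h 1")
    case True
    have "\<alpha> / 24 * (t 1 * t 2 powr (- \<alpha>)) \<le> 1 * (h 1 * h 1 powr (- \<alpha>))"
      using True t1 h1 alpha_pos alpha_less_1 by (intro mult_mono powr_mono2') auto
    also have "\<dots> \<le> h 1 * ker \<alpha> (x 1) (t 1)"
      unfolding ker_def x_diff using True t1 alpha_pos alpha_less_1
      by (auto intro!: mult_left_mono powr_mono2')
    also have "\<dots> \<le> h 1 * avg 1 1"
      using avg_weight_ge[of 1 1 0] M True t1 by (intro mult_left_mono) (auto simp: weight_def)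
    finally show ?thesis using c0 by (simp add: A_def mult.commute)
  next
    case False
    then have t2: "t 2 \<le> 2 * t 1" using h1 by simp
    have "\<alpha> / 24 * (t 1 * t 2 powr (- \<alpha>)) = t 2 * (\<alpha> / 24 * (t 1 * t 2 powr (- \<alpha> - 1)))"
      using powr_mult_base[of "t 2" "- \<alpha> - 1"] t1 by simp
    also have "\<dots> \<le> 2 * t 1 * (\<alpha> / 24 * (t 1 * x 1 powr (- \<alpha> - 1)))"
      using t2 t1 x1 alpha_pos by (intro mult_mono powr_mono2') auto
    also have "\<dots> = (t 1 ^ 3 / 6 * ker' \<alpha> (x 1) 0) / (2 * t 1)"
      using t1 by (simp add: ker'_def power3_eq_cube)
    also have "\<dots> \<le> (t 1 ^ 3 / 6 * ker' \<alpha> (x 1) 0) / t 2"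
      using t1 t2 x1 alpha_pos by (intro divide_left_mono) (auto simp: ker'_def)
    also have "\<dots> \<le> bubble_moment \<alpha> (x 1) 0 (t 1) / t 2"
      using bubble_moment_ge[OF alpha_pos, of 0 "t 1" "x 1"] t1 x1 by (intro divide_right_mono) auto
    also have "\<dots> = corr 1 0" using t_0 h1 h_0 by (simp add: corr_def)
    also have "\<dots> \<le> A"
      using avg_weight_ge[of 1 1 0] ker_pos[of "t 1" "x 1" \<alpha>] M x1 t1 h1 by (simp add: A_def weight_def)
    finally show ?thesis .
  qed
  have s0: "slope U 0 = U 1 / t 1" by (simp add: slope_def h_0 U0)
  have "frac 0 U 1 = avg 1 0 * U 1 + avg 1 1 * (U 2 - U 1) + corr 1 0 * (slope U 1 - slope U 0)"
    by (simp add: frac_def U0 numeral_2_eq_2)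
  moreover have "U 2 - U 1 = h 1 * slope U 1"
    using t1 h1 by (simp add: slope_def numeral_2_eq_2)
  ultimately have "A * slope U 1 = frac 0 U 1 + corr 1 0 * (U 1 / t 1) - avg 1 0 * U 1"
    by (simp add: A_def s0 algebra_simps)
  also have "\<dots> \<le> C2 * P + 2 * avg 1 0 * (C1 * t 1 powr \<alpha>)"
  proof -
    have "corr 1 0 * (U 1 / t 1) \<le> corr 1 0 * (\<bar>U 1\<bar> / t 1)"
      using c0 t1 by (intro mult_left_mono divide_right_mono) auto
    also have "\<dots> \<le> (t 1 * avg 1 0) * (\<bar>U 1\<bar> / t 1)"
      using corr_0_le[of 1] M t1 by (intro mult_right_mono) auto
    finally have "corr 1 0 * (U 1 / t 1) \<le> (t 1 * avg 1 0) * (\<bar>U 1\<bar> / t 1)" .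
    moreover have "- avg 1 0 * U 1 \<le> avg 1 0 * \<bar>U 1\<bar>"
      using a10p by (smt (verit) mult_left_mono mult_minus_left mult_minus_right)
    moreover have "avg 1 0 * \<bar>U 1\<bar> \<le> avg 1 0 * (C1 * t 1 powr \<alpha>)"
      using a10p U1 by (intro mult_left_mono) auto
    ultimately show ?thesis using F[unfolded P] t1 by simp
  qed
  also have "\<dots> \<le> C2 * P + 2 * (4 * t 2 powr (- \<alpha>) / (1 - \<alpha>)) * (C1 * t 1 powr \<alpha>)"
    using a10 C by (intro add_left_mono mult_right_mono mult_left_mono) auto
  also have "\<dots> = (C2 + 8 * C1 / (1 - \<alpha>)) * P" by (simp add: P_def algebra_simps)
  finally have up: "A * slope U 1 \<le> (C2 + 8 * C1 / (1 - \<alpha>)) * P" .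
  have "\<alpha> / 24 * (t 1 * t 2 powr (- \<alpha>)) * slope U 1 \<le> A * slope U 1"
    using low False by (intro mult_right_mono) auto
  also note up
  finally have "(\<alpha> / 24 * t 1 * slope U 1) * t 2 powr (- \<alpha>) \<le>
      ((C2 + 8 * C1 / (1 - \<alpha>)) * t 1 powr \<alpha>) * t 2 powr (- \<alpha>)"
    by (simp add: P_def mult_ac)
  then have "\<alpha> / 24 * t 1 * slope U 1 \<le> (C2 + 8 * C1 / (1 - \<alpha>)) * t 1 powr \<alpha>"
    using t1 by (simp only: mult_le_cancel_right) auto
  then have "slope U 1 \<le> (C2 + 8 * C1 / (1 - \<alpha>)) * t 1 powr \<alpha> * 24 / (\<alpha> * t 1)"
    using t1 alpha_pos by (simp add: pos_le_divide_eq mult_ac)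
  also have "\<dots> = (C2 + 8 * C1 / (1 - \<alpha>)) * 24 / \<alpha> * t 1 powr (\<alpha> - 1)"
    using t1 by (simp add: powr_diff)
  finally show ?thesis .
qed

lemma quotient_powr:
  assumes "n < M"
  shows "(t 1 / t (Suc n)) powr e = t 1 powr e * t (Suc n) powr (- e)"
  using t1_pos t_less[of 0 "Suc n"] t_0 assms by (simp add: powr_divide powr_minus field_simps)

text \<open>A constant started from 0 sees only the first coefficient, which is at least
  t^(-\<alpha>). This matches both the data and the dropped correction. The correction is dropped
  only at levels n \<ge> 2, so its bound D is required only when N > 2.\<close>

lemma constant_stability:
  assumes rc: "ratio_condition M t" and N: "0 < N" "N \<le> M" and U0: "U 0 = 0"
    and F: "\<And>n. n < N \<Longrightarrow> frac 0 U n \<le> B * (t 1 / t (Suc n)) powr \<alpha>"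
    and D: "2 < N \<Longrightarrow> - D * t 1 powr (\<alpha> - 1) \<le> slope U 1 - slope U 0"
    and nonneg: "0 \<le> B" "0 \<le> D"
  shows "U N \<le> (B + 4 * D / (1 - \<alpha>)) * t 1 powr \<alpha>"
proof -
  define C where "C = B + 4 * D / (1 - \<alpha>)"
  have C: "B \<le> C" "0 \<le> C" using nonneg alpha_less_1 by (auto simp: C_def)
  have t1: "0 < t 1" using t1_pos N by simp
  define W where "W = (\<lambda>i::nat. if i = 0 then 0 else C * t 1 powr \<alpha>)"
  have "U N \<le> W N"
  proof (rule comparison[OF rc N(2)])
    fix n assume n: "n < N"
    then have nM: "n < M" using N by simp
    define P where "P = (t 1 / t (Suc n)) powr \<alpha>"
    have "t (Suc n) powr (- \<alpha>) \<le> x n powr (- \<alpha>)"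
      using x_pos[OF nM] x_less[OF nM] alpha_pos by (intro powr_mono2') auto
    also have "\<dots> \<le> kernel (start n) n 0" by (rule kernel_0_ge[OF nM])
    finally have "C * t 1 powr \<alpha> * t (Suc n) powr (- \<alpha>) \<le> C * t 1 powr \<alpha> * kernel (start n) n 0"
      using C by (intro mult_left_mono) auto
    then have W: "C * P \<le> frac (start n) W n"
      using quotient_powr[OF nM, of \<alpha>] by (simp add: W_def frac_step P_def mult.assoc)
    have "frac (start n) U n \<le> C * P"
    proof (cases "n \<le> 1")
      case True
      have "B * P \<le> C * P" using C by (intro mult_right_mono) (auto simp: P_def)
      then show ?thesis using F[OF n] True by (simp add: frac_start P_def)
    next
      case False
      have c: "0 \<le> corr n 0" "corr n 0 \<le> t 1 * (4 * t (Suc n) powr (- \<alpha>) / (1 - \<alpha>))"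
      proof -
        show "0 \<le> corr n 0" using corr_nonneg[of 0 n] nM False by simp
        have "x n powr (- \<alpha>) / (1 - \<alpha>) \<le> 4 * t (Suc n) powr (- \<alpha>) / (1 - \<alpha>)"
          using x_powr_le[OF nM, of \<alpha>] alpha_pos alpha_less_1 by (intro divide_right_mono) auto
        then have "avg n 0 \<le> 4 * t (Suc n) powr (- \<alpha>) / (1 - \<alpha>)"
          using avg_0_le[OF nM] by linarith
        then have "t 1 * avg n 0 \<le> t 1 * (4 * t (Suc n) powr (- \<alpha>) / (1 - \<alpha>))"
          using t1 by (intro mult_left_mono) auto
        then show "corr n 0 \<le> t 1 * (4 * t (Suc n) powr (- \<alpha>) / (1 - \<alpha>))"
          using corr_0_le[of n] nM False by simp
      qed
      have "corr n 0 * (- (slope U 1 - slope U 0)) \<le> corr n 0 * (D * t 1 powr (\<alpha> - 1))"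
        using D False n c by (intro mult_left_mono) auto
      also have "\<dots> \<le> t 1 * (4 * t (Suc n) powr (- \<alpha>) / (1 - \<alpha>)) * (D * t 1 powr (\<alpha> - 1))"
        using c nonneg by (intro mult_right_mono) auto
      also have "\<dots> = 4 * D / (1 - \<alpha>) * (t 1 * t 1 powr (\<alpha> - 1)) * t (Suc n) powr (- \<alpha>)"
        by (simp add: mult_ac)
      also have "\<dots> = 4 * D / (1 - \<alpha>) * P"
        using powr_mult_base[of "t 1" "\<alpha> - 1"] t1 quotient_powr[OF nM, of \<alpha>] by (simp add: P_def)
      finally show ?thesis
        using F[OF n, folded P_def] False by (simp add: frac_start C_def algebra_simps)
    qed
    with W show "frac (start n) U n \<le> frac (start n) W n" by linarith
  qed (use U0 W_def in auto)
  then show ?thesis using N by (simp add: W_def C_def)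
qed

end

section \<open>A barrier with explicit fractional derivative\<close>

text \<open>If the second derivative is at most c, then c/2 s^2 - f is convex and lies below its
  chord; for the parabola itself the chord error is exactly c/2 times the bubble.\<close>

lemma linear_interpolation_lower:
  fixes f f' f'' :: "real \<Rightarrow> real"
  assumes "p < q" "s \<in> {p..q}"
    and "\<And>s. s \<in> {p..q} \<Longrightarrow> (f has_real_derivative f' s) (at s)"
    and "\<And>s. s \<in> {p..q} \<Longrightarrow> (f' has_real_derivative f'' s) (at s)"
    and "\<And>s. s \<in> {p..q} \<Longrightarrow> f'' s \<le> c"
  shows "f p + (f q - f p) / (q - p) * (s - p) - c / 2 * ((s - p) * (q - s)) \<le> f s"
proof -
  define g where "g s = c / 2 * s\<^sup>2 - f s" for s
  have "convex_on {p..q} g"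
    unfolding g_def
    by (rule f''_ge0_imp_convex[where f' = "\<lambda>s. c * s - f' s" and f'' = "\<lambda>s. c - f'' s"])
       (use assms in \<open>auto intro!: derivative_eq_intros\<close>)
  from convex_onD_Icc'[OF this assms(2)]
  have "g s \<le> (g q - g p) / (q - p) * (s - p) + g p" by simp
  moreover have "(g q - g p) / (q - p) = c / 2 * (p + q) - (f q - f p) / (q - p)"
    using assms(1) by (simp add: g_def divide_simps) (simp add: algebra_simps power2_eq_square)
  ultimately have "g s \<le> (c / 2 * (p + q) - (f q - f p) / (q - p)) * (s - p) + g p" by simp
  moreover have "c / 2 * (p + q) * (s - p) - c / 2 * s\<^sup>2 + c / 2 * p\<^sup>2 = c / 2 * ((s - p) * (q - s))"
    by (simp add: field_simps power2_eq_square)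
  ultimately show ?thesis by (simp add: g_def left_diff_distrib)
qed

text \<open>The previous lemma for -f on the outer interval, evaluated at the middle node q and
  multiplied out.\<close>

lemma divided_difference_lower:
  fixes f f' f'' :: "real \<Rightarrow> real"
  assumes "p < q" "q < w"
    and "\<And>s. s \<in> {p..w} \<Longrightarrow> (f has_real_derivative f' s) (at s)"
    and "\<And>s. s \<in> {p..w} \<Longrightarrow> (f' has_real_derivative f'' s) (at s)"
    and "\<And>s. s \<in> {p..w} \<Longrightarrow> c \<le> f'' s"
  shows "c / 2 * ((q - p) + (w - q)) \<le> (f w - f q) / (w - q) - (f q - f p) / (q - p)"
proof -
  define u v where "u = q - p" and "v = w - q"
  have uv: "0 < u" "0 < v" "w - p = u + v" using assms by (auto simp: u_def v_def)
  have F: "- f p + (- f w - (- f p)) / (w - p) * (q - p) - (- c) / 2 * ((q - p) * (w - q)) \<le> - f q"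
    by (rule linear_interpolation_lower[where f' = "\<lambda>s. - f' s" and f'' = "\<lambda>s. - f'' s"])
       (use assms in \<open>auto intro!: derivative_eq_intros\<close>)
  have "(- f w - (- f p)) / (u + v) * u = - ((f w - f p) * u / (u + v))"
    using uv by (simp add: field_simps)
  moreover have "(- c) / 2 * (u * v) = - (c / 2 * (u * v))" by simp
  ultimately have "f q \<le> f p + (f w - f p) * u / (u + v) - c / 2 * (u * v)"
    using F unfolding uv(3) u_def[symmetric] v_def[symmetric] by linarith
  then have "f q * (u + v) \<le> (f p + (f w - f p) * u / (u + v) - c / 2 * (u * v)) * (u + v)"
    using uv by (intro mult_right_mono) auto
  also have "\<dots> = f p * (u + v) + (f w - f p) * u - c / 2 * (u * v) * (u + v)"
    using uv by (simp add: divide_simps add_pos_pos)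
  finally have "0 \<le> (f w - f q) * u - (f q - f p) * v - c / 2 * (u + v) * (u * v)"
    by (simp add: algebra_simps)
  then have "0 \<le> \<dots> / (u * v)" using uv by (intro divide_nonneg_pos) auto
  also have "\<dots> = (f w - f q) / v - (f q - f p) / u - c / 2 * (u + v)"
    using uv by (simp add: diff_divide_distrib)
  finally show ?thesis by (simp add: u_def v_def)
qed

text \<open>Expanding both end values about the midpoint, the even terms cancel in the difference,
  so only the third derivative enters; two cubic remainders on half the interval give 1/24.\<close>

lemma midpoint_slope_lower:
  fixes f f' f'' f''' :: "real \<Rightarrow> real"
  assumes "p < q"
    and d: "\<And>s. s \<in> {p..q} \<Longrightarrow> (f has_real_derivative f' s) (at s)"
      "\<And>s. s \<in> {p..q} \<Longrightarrow> (f' has_real_derivative f'' s) (at s)"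
      "\<And>s. s \<in> {p..q} \<Longrightarrow> (f'' has_real_derivative f''' s) (at s)"
    and T: "\<And>s. s \<in> {p..q} \<Longrightarrow> - T \<le> f''' s"
  shows "f' ((p + q) / 2) - T * (q - p)\<^sup>2 / 24 \<le> (f q - f p) / (q - p)"
proof -
  define c w where "c = (p + q) / 2" and "w = (q - p) / 2"
  define D where "D m = (if m = 0 then f else if m = 1 then f' else if m = 2 then f'' else f''')" for m :: nat
  have c: "p < c" "c < q" "q - c = w" "p - c = - w" "0 < w" using assms by (auto simp: c_def w_def field_simps)
  have DD: "\<forall>m s. m < 3 \<and> p \<le> s \<and> s \<le> q \<longrightarrow> (D m has_real_derivative D (Suc m) s) (at s)"
    using d by (auto simp: D_def less_Suc_eq numeral_3_eq_3)
  obtain t1 where t1: "c < t1" "t1 < q"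
    "f q = (\<Sum>m<3. D m c / fact m * (q - c) ^ m) + D 3 t1 / fact 3 * (q - c) ^ 3"
    using Taylor_up[of 3 D f p q c] DD c by (auto simp: D_def)
  obtain t2 where t2: "p < t2" "t2 < c"
    "f p = (\<Sum>m<3. D m c / fact m * (p - c) ^ m) + D 3 t2 / fact 3 * (p - c) ^ 3"
    using Taylor_down[of 3 D f p q c] DD c by (auto simp: D_def)
  have "f q = f c + f' c * w + f'' c / 2 * w\<^sup>2 + f''' t1 / 6 * w ^ 3"
    using t1(3) unfolding c(3) by (simp add: D_def numeral_3_eq_3 fact_numeral eval_nat_numeral)
  moreover have "f p = f c - f' c * w + f'' c / 2 * w\<^sup>2 - f''' t2 / 6 * w ^ 3"
    using t2(3) unfolding c(4) by (simp add: D_def numeral_3_eq_3 fact_numeral eval_nat_numeral)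
  ultimately have "f q - f p = 2 * w * f' c + (f''' t1 + f''' t2) / 6 * w ^ 3"
    by (simp add: algebra_simps add_divide_distrib)
  moreover have "(- T + - T) / 6 * w ^ 3 \<le> (f''' t1 + f''' t2) / 6 * w ^ 3"
    using T[of t1] T[of t2] t1 t2 c by (intro mult_right_mono divide_right_mono add_mono) auto
  ultimately have "2 * w * f' c - T / 3 * w ^ 3 \<le> f q - f p" by simp
  then have "(2 * w * f' c - T / 3 * w ^ 3) / (2 * w) \<le> (f q - f p) / (2 * w)"
    using c by (intro divide_right_mono) auto
  also have "(2 * w * f' c - T / 3 * w ^ 3) / (2 * w) = f' c - T * w\<^sup>2 / 6"
    using c by (simp add: field_simps power2_eq_square power3_eq_cube)
  finally have "f' c - T * w\<^sup>2 / 6 \<le> (f q - f p) / (2 * w)" .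
  moreover have "2 * w = q - p" "T * w\<^sup>2 / 6 = T * (q - p)\<^sup>2 / 24" by (auto simp: w_def power_divide)
  ultimately show ?thesis by (simp add: c_def)
qed

section \<open>The shifted power as a barrier\<close>

context caputo_mesh
begin

definition bar :: "real \<Rightarrow> real \<Rightarrow> real" where "bar a s = (a + s) powr (\<alpha> - 1)"
definition bar' :: "real \<Rightarrow> real \<Rightarrow> real" where "bar' a s = (\<alpha> - 1) * (a + s) powr (\<alpha> - 2)"
definition bar2 :: "real \<Rightarrow> real \<Rightarrow> real" where
  "bar2 a s = (1 - \<alpha>) * (2 - \<alpha>) * (a + s) powr (\<alpha> - 3)"
text \<open>The negative of the third derivative of \<open>bar\<close>, so that it is nonnegative
  and decreasing like \<open>bar2\<close>.\<close>

definition bar3 :: "real \<Rightarrow> real \<Rightarrow> real" where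
  "bar3 a s = (1 - \<alpha>) * (2 - \<alpha>) * (3 - \<alpha>) * (a + s) powr (\<alpha> - 4)"

lemma bar_derivs:
  assumes "0 < a" "0 \<le> s"
  shows "(bar a has_real_derivative bar' a s) (at s within S)"
    and "(bar' a has_real_derivative bar2 a s) (at s within S)"
    and "(bar2 a has_real_derivative - bar3 a s) (at s within S)"
  unfolding bar_def[abs_def] bar'_def[abs_def] bar2_def[abs_def] bar3_def using assms
  by (auto intro!: derivative_eq_intros simp: algebra_simps)

lemma bar2_antimono:
  assumes "0 < a" "0 \<le> s" "s \<le> s'"
  shows "bar2 a s' \<le> bar2 a s"
  unfolding bar2_def using assms alpha_pos alpha_less_1
  by (intro mult_left_mono powr_mono2') auto

lemma bar3_antimono:
  assumes "0 < a" "0 \<le> s" "s \<le> s'"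
  shows "bar3 a s' \<le> bar3 a s"
  unfolding bar3_def using assms alpha_pos alpha_less_1
  by (intro mult_left_mono powr_mono2') auto

lemma bar2_nonneg: "0 \<le> bar2 a s" and bar3_nonneg: "0 \<le> bar3 a s"
  using alpha_less_1 by (auto simp: bar2_def bar3_def)

text \<open>An antiderivative of \<open>ker * bar'\<close>: the fractional derivative of the barrier is known in
  closed form.\<close>

definition prim :: "nat \<Rightarrow> real \<Rightarrow> real \<Rightarrow> real" where
  "prim n a s = (x n - s) powr (1 - \<alpha>) * (a + s) powr (\<alpha> - 1) / (a + x n)"

text \<open>After pulling out the lower powers, the two product-rule terms share a factor in which
  (a + s) + (x - s) = a + x cancels the denominator.\<close>

lemma prim_deriv:
  assumes "0 < a" "0 \<le> s" "s < x n"
  shows "(prim n a has_real_derivative ker \<alpha> (x n) s * bar' a s) (at s within S)"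
proof -
  have "(prim n a has_real_derivative
     (- ((1 - \<alpha>) * (x n - s) powr (- \<alpha>)) * (a + s) powr (\<alpha> - 1) +
      (x n - s) powr (1 - \<alpha>) * ((\<alpha> - 1) * (a + s) powr (\<alpha> - 2))) / (a + x n)) (at s within S)"
    unfolding prim_def[abs_def]
  proof (intro DERIV_cdivide)
    have "((\<lambda>s. (x n - s) powr (1 - \<alpha>)) has_real_derivative - ((1 - \<alpha>) * (x n - s) powr (- \<alpha>))) (at s within S)"
      using assms by (auto intro!: derivative_eq_intros)
    moreover have "((\<lambda>s. (a + s) powr (\<alpha> - 1)) has_real_derivative (\<alpha> - 1) * (a + s) powr (\<alpha> - 2)) (at s within S)"
      using assms by (auto intro!: derivative_eq_intros)
    ultimately show "((\<lambda>s. (x n - s) powr (1 - \<alpha>) * (a + s) powr (\<alpha> - 1)) has_real_derivative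
      - ((1 - \<alpha>) * (x n - s) powr (- \<alpha>)) * (a + s) powr (\<alpha> - 1) +
      (x n - s) powr (1 - \<alpha>) * ((\<alpha> - 1) * (a + s) powr (\<alpha> - 2))) (at s within S)"
      by (drule_tac DERIV_mult) (auto simp: algebra_simps)
  qed
  moreover have "(x n - s) powr (1 - \<alpha>) = (x n - s) * (x n - s) powr (- \<alpha>)"
    using powr_mult_base[of "x n - s" "- \<alpha>"] assms by simp
  moreover have "(a + s) powr (\<alpha> - 1) = (a + s) * (a + s) powr (\<alpha> - 2)"
    using powr_mult_base[of "a + s" "\<alpha> - 2"] assms by simp
  moreover have "(- ((1 - \<alpha>) * k) * ((a + s) * b) + (x n - s) * k * ((\<alpha> - 1) * b)) / (a + x n) =
      k * ((\<alpha> - 1) * b)" for k b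
    using assms by (simp add: divide_simps) (simp add: algebra_simps)
  ultimately show ?thesis by (simp add: ker_def bar'_def)
qed

text \<open>Integration by parts turns the error of linear interpolation into the integral of
  \<open>ker'\<close> against a convex function minus its chord, which costs at most
  \<open>bar2\<close> at the left node times half the bubble moment. The quadratic correction
  returns at least the same moment with \<open>bar2\<close> two nodes further right, so only the
  variation of \<open>bar2\<close> is lost.\<close>

lemma inner_error:
  assumes a: "0 < a" and i: "i < n" and n: "n < M"
  shows "prim n a (t (Suc i)) - prim n a (t i)
      - bar2 a (t i) / 2 * bubble_moment \<alpha> (x n) (t i) (t (Suc i))
    \<le> avg n i * (bar a (t (Suc i)) - bar a (t i))"
    and "bar2 a (t (Suc (Suc i))) / 2 * bubble_moment \<alpha> (x n) (t i) (t (Suc i))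
    \<le> corr n i * (slope (\<lambda>j. bar a (t j)) (Suc i) - slope (\<lambda>j. bar a (t j)) i)"
proof -
  define p q where "p = t i" and "q = t (Suc i)"
  let ?k = "ker \<alpha> (x n)" and ?k' = "ker' \<alpha> (x n)"
  have pq: "p < q" "q < x n" "0 \<le> p" using i n t_less_Suc t_less_x t_nonneg by (auto simp: p_def q_def)
  define S where "S = (bar a q - bar a p) / (q - p)"
  define B where "B = bubble_moment \<alpha> (x n) p q"
  have B: "0 \<le> B" unfolding B_def using pq alpha_pos by (intro bubble_moment_nonneg) auto
  have cont: "continuous_on {p..q} (bar a)"
    by (rule DERIV_continuous_on[OF bar_derivs(1)[OF a]]) (use pq in auto)
  have "((\<lambda>s. ?k s * bar' a s) has_integral ?k q * (bar a q - bar a p) - ?k p * (bar a p - bar a p)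
     - integral {p..q} (\<lambda>s. ?k' s * (bar a s - bar a p))) {p..q}"
  proof (rule ker_parts)
    fix s assume "s \<in> {p..q}"
    then show "((\<lambda>s. bar a s - bar a p) has_real_derivative bar' a s) (at s within {p..q})"
      using bar_derivs(1)[OF a, of s] pq by (auto intro!: derivative_eq_intros)
  qed (use pq in auto)
  moreover have "((\<lambda>s. ?k s * bar' a s) has_integral prim n a q - prim n a p) {p..q}"
    using pq prim_deriv[OF a]
    by (intro fundamental_theorem_of_calculus)
       (auto simp: has_real_derivative_iff_has_vector_derivative[symmetric])
  ultimately have eq: "prim n a q - prim n a p = ?k q * (bar a q - bar a p)
     - integral {p..q} (\<lambda>s. ?k' s * (bar a s - bar a p))"
    by (drule_tac has_integral_unique) auto
  have "integral {p..q} (\<lambda>s. ?k' s * (S * (s - p) - bar2 a p / 2 * ((s - p) * (q - s))))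
      \<le> integral {p..q} (\<lambda>s. ?k' s * (bar a s - bar a p))"
  proof (rule ker'_weighted_le)
    fix s assume "s \<in> {p..q}"
    then have "bar a p + S * (s - p) - bar2 a p / 2 * ((s - p) * (q - s)) \<le> bar a s"
      unfolding S_def using pq bar_derivs[OF a] bar2_antimono[OF a]
      by (intro linear_interpolation_lower[where f' = "bar' a" and f'' = "bar2 a"]) auto
    then show "S * (s - p) - bar2 a p / 2 * ((s - p) * (q - s)) \<le> bar a s - bar a p" by linarith
  qed (use pq alpha_pos cont in \<open>auto intro!: continuous_intros\<close>)
  moreover have "integral {p..q} (\<lambda>s. ?k' s * (S * (s - p) - bar2 a p / 2 * ((s - p) * (q - s)))) =
     integral {p..q} (\<lambda>s. S * (?k' s * (s - p)) - bar2 a p / 2 * (?k' s * ((s - p) * (q - s))))"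
  proof -
    have "k * (S * u - d * v) = S * (k * u) - d * (k * v)" for k u d v :: real
      by (simp add: algebra_simps)
    then show ?thesis by presburger
  qed
  moreover have "\<dots> = S * left_moment \<alpha> (x n) p q - bar2 a p / 2 * B"
    unfolding left_moment_def B_def bubble_moment_def integral_mult_right[symmetric] using pq
    by (intro integral_diff integrable_on_mult_right ker'_integrable continuous_intros)
  moreover have "avg n i * (bar a q - bar a p) = ?k q * (bar a q - bar a p) - S * left_moment \<alpha> (x n) p q"
    using i pq by (simp add: avg_def S_def h_def p_def q_def algebra_simps)
  ultimately show "prim n a (t (Suc i)) - prim n a (t i) - bar2 a (t i) / 2 * bubble_moment \<alpha> (x n) (t i) (t (Suc i))
    \<le> avg n i * (bar a (t (Suc i)) - bar a (t i))"
    using eq by (simp add: p_def q_def B_def)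
  define w where "w = t (Suc (Suc i))"
  have w: "q < w" using i n t_less_Suc by (simp add: q_def w_def)
  have "bar2 a w / 2 * ((q - p) + (w - q)) \<le> (bar a w - bar a q) / (w - q) - (bar a q - bar a p) / (q - p)"
    using pq w bar_derivs[OF a] bar2_antimono[OF a]
    by (intro divided_difference_lower[where f' = "bar' a" and f'' = "bar2 a"]) auto
  then have "B / ((q - p) + (w - q)) * (bar2 a w / 2 * ((q - p) + (w - q))) \<le>
     B / ((q - p) + (w - q)) * ((bar a w - bar a q) / (w - q) - (bar a q - bar a p) / (q - p))"
    using B pq w by (intro mult_left_mono) auto
  moreover have "B / ((q - p) + (w - q)) * (bar2 a w / 2 * ((q - p) + (w - q))) = bar2 a w / 2 * B"
    using pq w by simp
  ultimately show "bar2 a (t (Suc (Suc i))) / 2 * bubble_moment \<alpha> (x n) (t i) (t (Suc i))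
    \<le> corr n i * (slope (\<lambda>j. bar a (t j)) (Suc i) - slope (\<lambda>j. bar a (t j)) i)"
    by (simp add: corr_def slope_def h_def p_def q_def w_def B_def)
qed

text \<open>The evaluation point \<open>x n\<close> makes the kernel orthogonal on \<open>[t n, x n]\<close> to the linear function
  vanishing at the midpoint of \<open>[t n, t (Suc n)]\<close>; this raises the order of the error by one.\<close>

lemma last_error:
  assumes a: "0 < a" and n: "n < M"
  shows "prim n a (x n) - prim n a (t n)
      - bar3 a (t n) * (h n)\<^sup>2 / 24 * ((x n - t n) powr (1 - \<alpha>) / (1 - \<alpha>))
    \<le> avg n n * (bar a (t (Suc n)) - bar a (t n))"
proof -
  define y z c where "y = t n" and "z = t (Suc n)" and "c = (y + z) / 2"
  have y: "0 \<le> y" "y < z" "y < x n" "x n < z"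
    using n t_nonneg t_less_Suc x_gt x_less by (auto simp: y_def z_def)
  define Q where "Q = (x n - y) powr (1 - \<alpha>) / (1 - \<alpha>)"
  have Q: "0 \<le> Q" using alpha_less_1 by (simp add: Q_def)
  \<comment> \<open>An antiderivative of the kernel times the tangent of \<open>bar'\<close> at the
    midpoint c, normalised to vanish at \<open>x n\<close>. Monotonicity of \<open>A - prim\<close>
    then replaces a comparison of integrals with singular integrands.\<close>
  define A where "A s = - (bar' a c * ((x n - s) powr (1 - \<alpha>) / (1 - \<alpha>))) + bar2 a c *
      ((x n - s) powr (2 - \<alpha>) / (2 - \<alpha>) - (x n - c) * ((x n - s) powr (1 - \<alpha>) / (1 - \<alpha>)))" for s
  have c: "0 \<le> c" "c \<in> {y..z}" using y by (auto simp: c_def)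
  have "A y - prim n a y \<le> A (x n) - prim n a (x n)"
  proof (rule DERIV_nonneg_imp_increasing_open[where f = "\<lambda>s. A s - prim n a s"])
    show "continuous_on {y..x n} (\<lambda>s. A s - prim n a s)"
    proof -
      have 1: "continuous_on {y..x n} (\<lambda>s. (x n - s) powr e)" if "0 < e" for e
        using that by (intro continuous_on_powr' continuous_intros) auto
      have 2: "continuous_on {y..x n} (\<lambda>s. (a + s) powr (\<alpha> - 1))"
        using a y by (intro continuous_intros) auto
      show ?thesis
        unfolding A_def prim_def using alpha_less_1 a y
        by (intro continuous_on_const continuous_on_diff continuous_on_add continuous_on_minus
            continuous_on_mult continuous_on_divide 1 2) auto
    qed
    fix s assume s: "y < s" "s < x n"
    \<comment> \<open>\<open>bar'\<close> is concave, since its second derivative is the negative of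
      \<open>bar3\<close>.\<close>
    have tangent: "bar' a s \<le> bar' a c + bar2 a c * (s - c)"
    proof -
      have "(- bar2 a c) * (s - c) \<le> (- bar' a s) - (- bar' a c)"
      proof (rule f''_imp_f'[where C = "{y..z}" and f'' = "bar3 a"])
        fix s assume "s \<in> {y..z}"
        then have "0 \<le> s" using y by simp
        then show "((\<lambda>s. - bar' a s) has_real_derivative - bar2 a s) (at s)"
          "((\<lambda>s. - bar2 a s) has_real_derivative bar3 a s) (at s)"
          using bar_derivs(2,3)[OF a, of s, THEN DERIV_minus] by simp_all
      qed (use bar3_nonneg c s y in auto)
      then show ?thesis by simp
    qed
    have e: "(x n - s) powr (1 - \<alpha>) = (x n - s) * (x n - s) powr (- \<alpha>)"
      using powr_mult_base[of "x n - s" "- \<alpha>"] s by simp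
    have d1: "((\<lambda>s. (x n - s) powr (1 - \<alpha>) / (1 - \<alpha>)) has_real_derivative - ker \<alpha> (x n) s) (at s)"
      using s alpha_less_1 by (auto intro!: derivative_eq_intros simp: ker_def)
    have d2: "((\<lambda>s. (x n - s) powr (2 - \<alpha>) / (2 - \<alpha>)) has_real_derivative - ((x n - s) * ker \<alpha> (x n) s)) (at s)"
      using s alpha_less_1 e by (auto intro!: derivative_eq_intros simp: ker_def)
    have "(A has_real_derivative - (bar' a c * - ker \<alpha> (x n) s) + bar2 a c *
         (- ((x n - s) * ker \<alpha> (x n) s) - (x n - c) * - ker \<alpha> (x n) s)) (at s)"
      unfolding A_def[abs_def] by (intro derivative_intros DERIV_cmult d1 d2)
    then have "((\<lambda>s. A s - prim n a s) has_real_derivative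
       (- (bar' a c * - ker \<alpha> (x n) s) + bar2 a c *
         (- ((x n - s) * ker \<alpha> (x n) s) - (x n - c) * - ker \<alpha> (x n) s)) - ker \<alpha> (x n) s * bar' a s) (at s)"
      using prim_deriv[OF a, of s n] s y by (intro DERIV_diff) auto
    moreover have "(- (bar' a c * - ker \<alpha> (x n) s) + bar2 a c *
         (- ((x n - s) * ker \<alpha> (x n) s) - (x n - c) * - ker \<alpha> (x n) s)) - ker \<alpha> (x n) s * bar' a s
         = ker \<alpha> (x n) s * (bar' a c + bar2 a c * (s - c) - bar' a s)"
      by (simp add: algebra_simps)
    moreover have "0 \<le> \<dots>" using tangent by (simp add: ker_def)
    ultimately show "\<exists>d. ((\<lambda>s. A s - prim n a s) has_real_derivative d) (at s) \<and> 0 \<le> d"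
      by auto
  qed (use y in auto)
  moreover have "A (x n) = 0" by (simp add: A_def)
  \<comment> \<open>This is the orthogonality: x_n - y = (1 - \<alpha>/2) h and x_n - c = (1 -
    \<alpha>) h/2 make both terms multiplied by \<open>bar2 a c\<close> equal to h/2 (x_n - y)^(1 -
    \<alpha>), and they cancel.\<close>
  moreover have "A y = - bar' a c * Q"
  proof -
    have h: "x n - y = (1 - \<alpha> / 2) * h n" "x n - c = (1 - \<alpha>) * h n / 2"
      by (simp_all add: y_def c_def z_def x_def h_def field_simps)
    have "(x n - y) powr (2 - \<alpha>) = (x n - y) * (x n - y) powr (1 - \<alpha>)"
      using powr_mult_base[of "x n - y" "1 - \<alpha>"] y by simp
    also have "\<dots> = (2 - \<alpha>) * (h n / 2) * (x n - y) powr (1 - \<alpha>)"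
      unfolding h(1) by (simp add: field_simps)
    finally have "(x n - y) powr (2 - \<alpha>) / (2 - \<alpha>) = h n / 2 * (x n - y) powr (1 - \<alpha>)"
      using alpha_less_1 by simp
    moreover have "(x n - c) * ((x n - y) powr (1 - \<alpha>) / (1 - \<alpha>)) = h n / 2 * (x n - y) powr (1 - \<alpha>)"
      unfolding h(2) using alpha_less_1 by (simp add: field_simps)
    ultimately show ?thesis unfolding A_def Q_def by (simp only: diff_self)
  qed
  ultimately have 1: "prim n a (x n) - prim n a y \<le> bar' a c * Q" by simp
  have "bar' a c - bar3 a y * (z - y)\<^sup>2 / 24 \<le> (bar a z - bar a y) / (z - y)"
    unfolding c_def
    by (rule midpoint_slope_lower[where f'' = "bar2 a" and f''' = "\<lambda>s. - bar3 a s"])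
       (use y bar_derivs[OF a] bar3_antimono[OF a] in auto)
  then have "(bar' a c - bar3 a y * (z - y)\<^sup>2 / 24) * Q \<le> (bar a z - bar a y) / (z - y) * Q"
    using Q by (rule mult_right_mono)
  moreover have "(bar a z - bar a y) / (z - y) * Q = avg n n * (bar a (t (Suc n)) - bar a (t n))"
    by (simp add: avg_def Q_def y_def z_def h_def mult.commute)
  ultimately have "bar' a c * Q - bar3 a y * (z - y)\<^sup>2 / 24 * Q \<le> avg n n * (bar a (t (Suc n)) - bar a (t n))"
    by (simp only: left_diff_distrib)
  with 1 have "prim n a (x n) - prim n a y - bar3 a y * (z - y)\<^sup>2 / 24 * Q
      \<le> avg n n * (bar a (t (Suc n)) - bar a (t n))" by linarith
  then show ?thesis by (simp only: y_def z_def h_def Q_def)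
qed

definition barrier :: "real \<Rightarrow> nat \<Rightarrow> real" where
  "barrier a i = (if i = 0 then 0 else bar a (t i))"

text \<open>On the first interval no gain from the correction is counted, because
  \<open>frac (start n)\<close> drops it there from the third level on.\<close>

definition inner_defect :: "real \<Rightarrow> nat \<Rightarrow> nat \<Rightarrow> real" where
  "inner_defect a n i = (bar2 a (t i) - (if i = 0 then 0 else bar2 a (t (Suc (Suc i))))) / 2
     * bubble_moment \<alpha> (x n) (t i) (t (Suc i))"

definition last_defect :: "real \<Rightarrow> nat \<Rightarrow> real" where
  "last_defect a n = bar3 a (t n) * (h n)\<^sup>2 / 24 * ((x n - t n) powr (1 - \<alpha>) / (1 - \<alpha>))"

text \<open>Starting the barrier from 0 adds to the shifted power a jump of height a^(\<alpha> - 1)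
  on the first interval, whose discrete derivative is at least that height times x^(-\<alpha>).
  Together with the telescoping values of \<open>prim\<close> this is exactly the closed form; the
  defects collect the interval errors.\<close>

lemma barrier_frac_ge:
  assumes a: "0 < a" and n: "n < M"
  shows "a powr \<alpha> * x n powr (- \<alpha>) / (a + x n) - (\<Sum>i<n. inner_defect a n i) - last_defect a n
    \<le> frac (start n) (barrier a) n"
proof -
  define k where "k = start n"
  define f where "f j = bar a (t j)" for j
  define c where "c i = (if k \<le> i then corr n i * (slope f (Suc i) - slope f i) else 0)" for i
  have "barrier a = (\<lambda>i. f i + (- f 0 + (if i = 0 then 0 else f 0)))"
    by (auto simp: barrier_def f_def)
  then have "frac k (barrier a) n = frac k f n + (frac k (\<lambda>i. - f 0) n + f 0 * kernel k n 0)"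
    using frac_add[of k f "\<lambda>i. - f 0 + (if i = 0 then 0 else f 0)" n]
      frac_add[of k "\<lambda>i. - f 0" "\<lambda>i. if i = 0 then 0 else f 0" n] frac_step[of k "f 0" n] by simp
  moreover have "frac k (\<lambda>i. - f 0) n = 0" by (simp add: frac_eq_kernel)
  ultimately have 1: "frac k (barrier a) n = frac k f n + f 0 * kernel k n 0" by simp
  have "(\<Sum>i\<in>{k..<n}. corr n i * (slope f (Suc i) - slope f i)) = (\<Sum>i<n. c i)"
    by (rule sum.mono_neutral_cong_left) (auto simp: c_def)
  then have 2: "frac k f n = (\<Sum>i<n. avg n i * (f (Suc i) - f i) + c i) + avg n n * (f (Suc n) - f n)"
    by (simp add: frac_def lessThan_Suc_atMost[symmetric] sum.distrib)
  have "(\<Sum>i<n. prim n a (t (Suc i)) - prim n a (t i) - inner_defect a n i)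
      \<le> (\<Sum>i<n. avg n i * (f (Suc i) - f i) + c i)"
  proof (rule sum_mono)
    fix i assume "i \<in> {..<n}"
    then have i: "i < n" by simp
    note e = inner_error[OF a i n]
    have "0 \<le> bar2 a (t (Suc (Suc i))) / 2 * bubble_moment \<alpha> (x n) (t i) (t (Suc i))"
      using i n t_less_Suc[of i] t_less_x[of "Suc i" n] alpha_pos bar2_nonneg
      by (intro mult_nonneg_nonneg bubble_moment_nonneg) auto
    moreover have "k \<le> i \<or> i = 0" by (auto simp: k_def start_def)
    ultimately show "prim n a (t (Suc i)) - prim n a (t i) - inner_defect a n i \<le>
        avg n i * (f (Suc i) - f i) + c i"
      using e unfolding c_def inner_defect_def f_def
      by (auto simp: left_diff_distrib diff_divide_distrib)
  qed
  moreover have "(\<Sum>i<n. prim n a (t (Suc i)) - prim n a (t i)) = prim n a (t n) - prim n a (t 0)"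
    by (rule sum_lessThan_telescope)
  ultimately have "prim n a (x n) - prim n a 0 - (\<Sum>i<n. inner_defect a n i) - last_defect a n \<le> frac k f n"
    unfolding 2 using last_error[OF a n] by (simp add: sum_subtractf t_0 last_defect_def f_def)
  moreover have "f 0 * x n powr (- \<alpha>) \<le> f 0 * kernel k n 0"
    using kernel_0_ge[OF n] by (intro mult_left_mono) (auto simp: f_def bar_def)
  moreover have "f 0 * x n powr (- \<alpha>) + prim n a (x n) - prim n a 0 = a powr \<alpha> * x n powr (- \<alpha>) / (a + x n)"
  proof -
    have x: "0 < x n" using x_pos[OF n] .
    have e: "x n powr (1 - \<alpha>) = x n * x n powr (- \<alpha>)" "a powr \<alpha> = a * a powr (\<alpha> - 1)"
      using powr_mult_base[of "x n" "- \<alpha>"] powr_mult_base[of a "\<alpha> - 1"] x a by auto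
    have "f 0 * x n powr (- \<alpha>) + prim n a (x n) - prim n a 0 =
       a powr (\<alpha> - 1) * x n powr (- \<alpha>) - x n powr (1 - \<alpha>) * a powr (\<alpha> - 1) / (a + x n)"
      by (simp add: f_def bar_def prim_def t_0)
    also have "\<dots> = a powr \<alpha> * x n powr (- \<alpha>) / (a + x n)"
      unfolding e using x a by (simp add: field_simps)
    finally show ?thesis .
  qed
  ultimately show ?thesis using 1 unfolding k_def by linarith
qed

end

section \<open>Interpolation error on quasi-graded meshes\<close>

lemma powr_divide_neg:
  fixes u c e :: real
  assumes "0 \<le> u" "0 < c"
  shows "(u / c) powr (- e) = c powr e * u powr (- e)"
  using assms by (simp add: powr_divide powr_minus field_simps)

text \<open>The summands bound the defect on the first interval, on intervals far from the
  evaluation point, on those near it, and on the last one.\<close>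

definition barrier_const :: "real \<Rightarrow> real \<Rightarrow> real \<Rightarrow> real" where
  "barrier_const \<alpha> r K = 8 * K^2 + 1152 * K^3 / (3 / r - \<alpha>) + 9216 * K^4 + 32 * K^3"

text \<open>The first entry makes a + t_i at most double over one step; the second makes the total
  defect at most half of the exact derivative.\<close>

definition barrier_scale :: "real \<Rightarrow> real \<Rightarrow> real \<Rightarrow> real" where
  "barrier_scale \<alpha> r K = max ((2 * K) powr r) ((2 * barrier_const \<alpha> r K) powr (1 / \<alpha>))"

locale graded_mesh = caputo_mesh +
  fixes K r :: real
  assumes M_pos: "0 < M" and K_ge_1: "1 \<le> K" and r_ge_1: "1 \<le> r" and r_le: "r * \<alpha> \<le> 3 - \<alpha>"
    and h_upper: "i < M \<Longrightarrow> h i \<le> K * (t 1 powr (1 / r) * t (Suc i) powr (1 - 1 / r))"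
    and h_lower: "i < M \<Longrightarrow> t 1 powr (1 / r) * t (Suc i) powr (1 - 1 / r) \<le> K * h i"
begin

definition tau :: real where "tau = t 1"
definition eta :: real where "eta = tau powr (1 / r)"
definition ex :: real where "ex = 1 - 1 / r"
text \<open>Three steps of size eta y^ex against a third derivative of size y^(\<alpha> - 4) leave
  eta^3 y^(-(1 + kap)), where y = a + t_i.\<close>

definition kap :: real where "kap = 3 / r - \<alpha>"

lemma tau_pos: "0 < tau" using t1_pos[OF M_pos] by (simp add: tau_def)
lemma eta_pos: "0 < eta" using tau_pos by (simp add: eta_def)
lemma ex_range: "0 \<le> ex" "ex < 1" using r_ge_1 by (auto simp: ex_def)
lemma kap_range: "0 < kap" "kap \<le> 3"
proof -
  have "r * \<alpha> < 3" using r_le alpha_pos by linarith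
  then have "\<alpha> < 3 / r" using r_ge_1 by (simp add: field_simps)
  moreover have "3 / r \<le> 3" using r_ge_1 by (simp add: field_simps)
  ultimately show "0 < kap" "kap \<le> 3" using alpha_pos by (auto simp: kap_def)
qed

text \<open>The restriction on the grading, in the form needed near the evaluation point.\<close>

lemma alpha_le_q: "\<alpha> \<le> (3 - \<alpha>) / r"
  using r_le r_ge_1 by (simp add: field_simps)

lemma tau_le: "i < M \<Longrightarrow> tau \<le> t (Suc i)"
  using t_mono[of 1 "Suc i"] by (simp add: tau_def)

lemma h_le: "i < M \<Longrightarrow> h i \<le> K * eta * t (Suc i) powr ex"
  using h_upper[of i] by (simp add: eta_def ex_def tau_def)

lemma h_ge: "i < M \<Longrightarrow> eta * t (Suc i) powr ex \<le> K * h i"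
  using h_lower[of i] by (simp add: eta_def ex_def tau_def)

lemma h_ge_tau:
  assumes "i < M"
  shows "tau \<le> K * h i"
proof -
  have "tau = eta * tau powr ex"
    using tau_pos by (simp add: eta_def ex_def powr_add[symmetric])
  also have "\<dots> \<le> eta * t (Suc i) powr ex"
    using tau_le[OF assms] tau_pos ex_range eta_pos by (intro mult_left_mono powr_mono2) auto
  finally show ?thesis using h_ge[OF assms] by linarith
qed

lemma x_minus_t1_ge:
  assumes "0 < n" "n < M"
  shows "x n \<le> 4 * K * (x n - tau)"
proof -
  have "h n \<le> t (Suc n) - tau"
    using t_mono[of 1 n] assms by (simp add: h_def tau_def)
  moreover have "\<alpha> * h n \<le> h n" using h_pos[OF assms(2)] alpha_less_1 by simp
  ultimately have 1: "(t (Suc n) - tau) / 2 \<le> x n - tau" by (simp add: x_def)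
  have "tau \<le> K * h 1" using h_ge_tau[of 1] assms by simp
  also have "\<dots> \<le> K * (t (Suc n) - tau)"
    using t_mono[of 2 "Suc n"] assms K_ge_1
    by (intro mult_left_mono) (auto simp: h_def tau_def numeral_2_eq_2)
  finally have "t (Suc n) \<le> (t (Suc n) - tau) + K * (t (Suc n) - tau)" by simp
  also have "\<dots> \<le> 2 * K * (t (Suc n) - tau)"
    using K_ge_1 tau_le[OF assms(2)] mult_right_mono[of 1 K "t (Suc n) - tau"] by simp
  also have "\<dots> \<le> 4 * K * (x n - tau)"
    using mult_left_mono[OF 1, of "4 * K"] K_ge_1 by simp
  finally show ?thesis using x_less[OF assms(2)] by linarith
qed

text \<open>By \<open>x_minus_t1_ge\<close> the distance from \<open>x n\<close> to the end of the
  first interval is comparable with \<open>x n\<close> itself, so \<open>ker'\<close> decays there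
  like x^(-\<alpha> - 1).\<close>

lemma ker'_tau_le:
  assumes n: "0 < n" "n < M"
  shows "ker' \<alpha> (x n) tau \<le> 16 * K^2 * (x n powr (- \<alpha>) / x n)"
proof -
  have x: "0 < x n" "tau < x n" using x_pos[of n] t_less_x[of 1 n] n by (auto simp: tau_def)
  have xt: "x n / (4 * K) \<le> x n - tau" using x_minus_t1_ge[OF n] K_ge_1 by (simp add: field_simps)
  have "(x n - tau) powr (- \<alpha> - 1) \<le> (x n / (4 * K)) powr (- \<alpha> - 1)"
    using xt x K_ge_1 alpha_pos by (intro powr_mono2') auto
  also have "\<dots> = (4 * K) powr (1 + \<alpha>) * x n powr (- \<alpha> - 1)"
  proof -
    have "- (1 + \<alpha>) = - \<alpha> - 1" by simp
    then show ?thesis using x K_ge_1 powr_divide_neg[of "x n" "4 * K" "1 + \<alpha>"]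
      by (metis less_imp_le mult_pos_pos zero_less_numeral zero_less_one order_less_le_trans)
  qed
  also have "\<dots> \<le> (4 * K) powr 2 * x n powr (- \<alpha> - 1)"
    using K_ge_1 alpha_less_1 by (intro mult_right_mono powr_mono) auto
  also have "\<dots> = 16 * K^2 * (x n powr (- \<alpha>) / x n)"
    using K_ge_1 x by (simp add: powr_diff power_mult_distrib)
  finally have "1 * (x n - tau) powr (- \<alpha> - 1) \<le> 16 * K^2 * (x n powr (- \<alpha>) / x n)" by simp
  moreover have "ker' \<alpha> (x n) tau \<le> 1 * (x n - tau) powr (- \<alpha> - 1)"
    unfolding ker'_def using alpha_less_1 by (intro mult_right_mono) auto
  ultimately show ?thesis by linarith
qed

section \<open>Defects of a barrier with a given shift\<close>

context
  fixes a :: real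
  assumes a_ge: "(2 * K) powr r * tau \<le> a"
begin

lemma tau_le_a: "tau \<le> a"
proof -
  have "1 * tau \<le> (2 * K) powr r * tau"
    using K_ge_1 r_ge_1 tau_pos by (intro mult_right_mono ge_one_powr_ge_zero) auto
  then show ?thesis using a_ge by simp
qed

lemma a_pos: "0 < a" using tau_le_a tau_pos by simp

lemma eta_le: "2 * K * eta \<le> a powr (1 / r)"
proof -
  have "2 * K * eta = ((2 * K) powr r * tau) powr (1 / r)"
    using K_ge_1 r_ge_1 tau_pos by (simp add: powr_mult powr_powr eta_def)
  also have "\<dots> \<le> a powr (1 / r)"
    using a_ge tau_pos r_ge_1 by (intro powr_mono2) auto
  finally show ?thesis .
qed

lemma h_le_shifted:
  assumes "i < M"
  shows "h i \<le> K * eta * (a + t (Suc i)) powr ex"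
proof -
  have "t (Suc i) powr ex \<le> (a + t (Suc i)) powr ex"
    using a_pos t_nonneg[of "Suc i"] assms ex_range by (intro powr_mono2) auto
  then have "K * eta * t (Suc i) powr ex \<le> K * eta * (a + t (Suc i)) powr ex"
    using K_ge_1 eta_pos by (intro mult_left_mono) auto
  then show ?thesis using h_le[OF assms] by linarith
qed

text \<open>The shift makes 2 K eta at most a^(1/r), so a step, at most K eta z^ex with z = a +
  t_(i+1), is at most z/2. Without the shift this would fail on the first interval.\<close>

lemma shifted_doubling:
  assumes "i < M"
  shows "a + t (Suc i) \<le> 2 * (a + t i)"
proof -
  define z where "z = a + t (Suc i)"
  have z: "a \<le> z" using t_nonneg[of "Suc i"] assms by (simp add: z_def)
  have "2 * h i \<le> (2 * K * eta) * z powr ex" using h_le_shifted[OF assms] by (simp add: z_def)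
  also have "\<dots> \<le> z powr (1 / r) * z powr ex"
  proof -
    have "a powr (1 / r) \<le> z powr (1 / r)" using z a_pos r_ge_1 by (intro powr_mono2) auto
    then show ?thesis using eta_le by (intro mult_right_mono) auto
  qed
  also have "\<dots> = z" using z a_pos by (simp add: powr_add[symmetric] ex_def)
  finally show ?thesis by (simp add: z_def h_def)
qed

lemma powr_ex_double: "0 \<le> u \<Longrightarrow> w \<le> 2 * u \<Longrightarrow> 0 \<le> w \<Longrightarrow> w powr ex \<le> 2 * u powr ex"
proof -
  assume u: "0 \<le> u" "w \<le> 2 * u" "0 \<le> w"
  have "w powr ex \<le> (2 * u) powr ex" using u ex_range by (intro powr_mono2) auto
  also have "\<dots> = 2 powr ex * u powr ex" using u by (simp add: powr_mult)
  also have "\<dots> \<le> 2 powr 1 * u powr ex" using ex_range by (intro mult_right_mono powr_mono) auto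
  finally show ?thesis by simp
qed

lemma h_le_left:
  assumes "i < M"
  shows "h i \<le> 2 * K * eta * (a + t i) powr ex"
proof -
  have "(a + t (Suc i)) powr ex \<le> 2 * (a + t i) powr ex"
    using shifted_doubling[OF assms] t_nonneg[of i] t_nonneg[of "Suc i"] assms a_pos
    by (intro powr_ex_double) auto
  then have "K * eta * (a + t (Suc i)) powr ex \<le> K * eta * (2 * (a + t i) powr ex)"
    using K_ge_1 eta_pos by (intro mult_left_mono) auto
  then show ?thesis using h_le_shifted[OF assms] by simp
qed

lemma h_Suc_le_left:
  assumes "Suc i < M"
  shows "h (Suc i) \<le> 4 * K * eta * (a + t i) powr ex"
proof -
  have "(a + t (Suc i)) powr ex \<le> 2 * (a + t i) powr ex"
    using shifted_doubling[of i] t_nonneg[of i] t_nonneg[of "Suc i"] assms a_pos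
    by (intro powr_ex_double) auto
  then have "2 * K * eta * (a + t (Suc i)) powr ex \<le> 2 * K * eta * (2 * (a + t i) powr ex)"
    using K_ge_1 eta_pos by (intro mult_left_mono) auto
  then show ?thesis using h_le_left[OF assms] by simp
qed

lemma bar3_le:
  assumes "0 \<le> s"
  shows "bar3 a s \<le> 6 * (a + s) powr (\<alpha> - 4)"
proof -
  have "(1 - \<alpha>) * (2 - \<alpha>) * (3 - \<alpha>) \<le> 1 * 2 * 3"
    using alpha_pos alpha_less_1 by (intro mult_mono) auto
  then show ?thesis unfolding bar3_def by (intro mult_right_mono) auto
qed

lemma bar2_diff_le:
  assumes "0 \<le> s" "s < s'"
  shows "bar2 a s - bar2 a s' \<le> 6 * (a + s) powr (\<alpha> - 4) * (s' - s)"
proof -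
  obtain z where z: "s < z" "z < s'" "bar2 a s' - bar2 a s = (s' - s) * (- bar3 a z)"
    using MVT2[OF assms(2), of "bar2 a" "\<lambda>z. - bar3 a z"] bar_derivs(3)[OF a_pos] assms by auto
  have "bar3 a z \<le> bar3 a s" using z assms a_pos by (intro bar3_antimono) auto
  also note bar3_le[OF assms(1)]
  finally have "(s' - s) * bar3 a z \<le> (s' - s) * (6 * (a + s) powr (\<alpha> - 4))"
    using assms by (intro mult_left_mono) auto
  then show ?thesis using z(3) by (simp add: mult_ac)
qed

text \<open>One step length comes from the variation of \<open>bar2\<close> over two intervals and
  two from the bubble moment; the increment of the kernel is kept, so that it can be either
  estimated or telescoped.\<close>

lemma inner_defect_le:
  assumes i: "0 < i" "i < n" and n: "n < M"
  shows "inner_defect a n i \<le> 18 * K^3 * eta^3 * (a + t i) powr (- (1 + kap)) *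
     (ker \<alpha> (x n) (t (Suc i)) - ker \<alpha> (x n) (t i))"
proof -
  define y dk where "y = a + t i" and "dk = ker \<alpha> (x n) (t (Suc i)) - ker \<alpha> (x n) (t i)"
  have y: "0 < y" using a_pos t_nonneg[of i] i n by (simp add: y_def add_pos_nonneg)
  have l: "t i \<le> t (Suc i)" "t (Suc i) < x n" using i n t_mono t_less_x by auto
  have dk: "0 \<le> dk" unfolding dk_def using l alpha_pos by (simp add: ker_mono)
  have h: "0 < h i" "0 < h (Suc i)" using i n h_pos by auto
  have hi: "h i \<le> 2 * K * eta * y powr ex" "h (Suc i) \<le> 4 * K * eta * y powr ex"
    using h_le_left[of i] h_Suc_le_left[of i] i n by (auto simp: y_def)
  have "bar2 a (t i) - bar2 a (t (Suc (Suc i))) \<le> 6 * y powr (\<alpha> - 4) * (h i + h (Suc i))"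
    using bar2_diff_le[of "t i" "t (Suc (Suc i))"] t_less[of i "Suc (Suc i)"] t_nonneg[of i] i n
    by (simp add: y_def h_def)
  also have "\<dots> \<le> 6 * y powr (\<alpha> - 4) * (6 * K * eta * y powr ex)"
    using hi by (intro mult_left_mono) auto
  finally have 1: "bar2 a (t i) - bar2 a (t (Suc (Suc i))) \<le> 36 * K * eta * (y powr (\<alpha> - 4) * y powr ex)"
    by (simp add: mult_ac)
  have b2: "0 \<le> bubble_moment \<alpha> (x n) (t i) (t (Suc i))"
    using bubble_moment_nonneg[OF alpha_pos l] .
  have "bubble_moment \<alpha> (x n) (t i) (t (Suc i)) \<le> (h i)\<^sup>2 / 4 * dk"
    using bubble_le_ker[OF alpha_pos l] by (simp add: h_def dk_def)
  also have "\<dots> \<le> (2 * K * eta * y powr ex)\<^sup>2 / 4 * dk"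
    using hi h dk by (intro mult_right_mono divide_right_mono power_mono) auto
  also have "\<dots> = K\<^sup>2 * eta\<^sup>2 * (y powr ex * y powr ex) * dk" by (simp add: power2_eq_square)
  finally have 2: "bubble_moment \<alpha> (x n) (t i) (t (Suc i)) \<le> K\<^sup>2 * eta\<^sup>2 * (y powr ex * y powr ex) * dk" .
  have "inner_defect a n i = (bar2 a (t i) - bar2 a (t (Suc (Suc i)))) / 2 * bubble_moment \<alpha> (x n) (t i) (t (Suc i))"
    using i by (simp add: inner_defect_def)
  also have "\<dots> \<le> (36 * K * eta * (y powr (\<alpha> - 4) * y powr ex)) / 2 * (K\<^sup>2 * eta\<^sup>2 * (y powr ex * y powr ex) * dk)"
    using 1 2 b2 K_ge_1 eta_pos by (intro mult_mono divide_right_mono) auto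
  also have "\<dots> = 18 * K^3 * eta^3 * (y powr (\<alpha> - 4) * y powr ex * (y powr ex * y powr ex)) * dk"
    by (simp add: power2_eq_square power3_eq_cube)
  also have "y powr (\<alpha> - 4) * y powr ex * (y powr ex * y powr ex) = y powr (- (1 + kap))"
    unfolding powr_add[symmetric] by (rule arg_cong[where f = "\<lambda>e. y powr e"]) (simp add: ex_def kap_def)
  finally show ?thesis by (simp add: y_def dk_def)
qed

text \<open>Factors for two telescoping sums. Away from \<open>x n\<close> the kernel increment is
  at most of size h (a + x_n)^(-(1 + \<alpha>)) and the powers (a + t_i)^(-kap) telescope; close to
  \<open>x n\<close> the powers of a + t_i are comparable with those of a + x_n and the kernel
  telescopes. The constants are 1152 = 18 * 4 * 16 and 4608 = 18 * 4^4.\<close>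

definition far :: "nat \<Rightarrow> real" where
  "far n = 1152 * K^3 / kap * eta^3 * (a + x n) powr (- (1 + \<alpha>))"

definition near :: "nat \<Rightarrow> real" where
  "near n = 4608 * K^3 * eta^3 * (a + x n) powr (- (1 + kap))"

lemma far_nonneg: "0 \<le> far n" and near_nonneg: "0 \<le> near n"
  using K_ge_1 eta_pos kap_range by (auto simp: far_def near_def)

lemma powr_neg_le:
  fixes u w c e :: real
  assumes "0 < w" "1 \<le> c" "w \<le> c * u" "0 \<le> e" "e \<le> 4"
  shows "u powr (- e) \<le> c ^ 4 * w powr (- e)"
proof -
  have "u powr (- e) \<le> (w / c) powr (- e)"
    using assms by (intro powr_mono2') (auto simp: field_simps)
  also have "\<dots> = c powr e * w powr (- e)"
    using assms by (intro powr_divide_neg) auto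
  also have "\<dots> \<le> c powr 4 * w powr (- e)"
    using assms by (intro mult_right_mono powr_mono) auto
  finally show ?thesis using assms by simp
qed

lemma inner_defect_far:
  assumes i: "0 < i" "i < n" and n: "n < M" and far: "a + t (Suc i) < (a + x n) / 2"
  shows "inner_defect a n i \<le> far n * ((a + t i) powr (- kap) - (a + t (Suc i)) powr (- kap))"
proof -
  define y z X where "y = a + t i" and "z = a + t (Suc i)" and "X = a + x n"
  have y: "0 < y" using a_pos t_nonneg[of i] i n by (simp add: y_def add_pos_nonneg)
  have h: "z - y = h i" "0 < h i" using i n h_pos by (auto simp: y_def z_def h_def)
  have yz: "y < z" "z \<le> 2 * y" using h shifted_doubling[of i] i n by (auto simp: y_def z_def)
  have l: "t i \<le> t (Suc i)" "t (Suc i) < x n" using i n t_mono t_less_x by auto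
  have X: "0 < X" using a_pos x_pos[OF n] by (simp add: X_def)
  have "ker \<alpha> (x n) (t (Suc i)) - ker \<alpha> (x n) (t i) \<le> h i * ker' \<alpha> (x n) (t (Suc i))"
  proof -
    obtain s where s: "t i < s" "s < t (Suc i)"
      "ker \<alpha> (x n) (t (Suc i)) - ker \<alpha> (x n) (t i) = (t (Suc i) - t i) * ker' \<alpha> (x n) s"
      using MVT2[of "t i" "t (Suc i)" "ker \<alpha> (x n)" "ker' \<alpha> (x n)"] ker_deriv l h by (auto simp: h_def)
    have "ker' \<alpha> (x n) s \<le> ker' \<alpha> (x n) (t (Suc i))" using s l alpha_pos by (intro ker'_mono) auto
    then show ?thesis using s h by (simp add: h_def mult_left_mono)
  qed
  also have "ker' \<alpha> (x n) (t (Suc i)) \<le> 1 * (4 * X powr (- (1 + \<alpha>)))"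
  proof -
    have "x n - t (Suc i) = X - z" by (simp add: X_def z_def)
    then have "X / 2 \<le> x n - t (Suc i)" using far by (simp add: X_def z_def)
    then have "(x n - t (Suc i)) powr (- (1 + \<alpha>)) \<le> (X / 2) powr (- (1 + \<alpha>))"
      using X alpha_pos by (intro powr_mono2') auto
    also have "\<dots> = 2 powr (1 + \<alpha>) * X powr (- (1 + \<alpha>))"
      using X by (intro powr_divide_neg) auto
    also have "\<dots> \<le> 2 powr 2 * X powr (- (1 + \<alpha>))"
      using alpha_less_1 by (intro mult_right_mono powr_mono) auto
    finally have "(x n - t (Suc i)) powr (- (1 + \<alpha>)) \<le> 4 * X powr (- (1 + \<alpha>))" by simp
    moreover have "- (1 + \<alpha>) = - \<alpha> - 1" by simp
    ultimately have "(x n - t (Suc i)) powr (- \<alpha> - 1) \<le> 4 * X powr (- (1 + \<alpha>))" by metis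
    then show ?thesis unfolding ker'_def using alpha_pos alpha_less_1 by (intro mult_mono) auto
  qed
  finally have dk: "ker \<alpha> (x n) (t (Suc i)) - ker \<alpha> (x n) (t i) \<le> h i * (4 * X powr (- (1 + \<alpha>)))"
    using h by (simp add: mult_left_mono)
  have "y powr (- (1 + kap)) \<le> 2 ^ 4 * z powr (- (1 + kap))"
    using yz y kap_range by (intro powr_neg_le) auto
  moreover have "kap * h i * z powr (- (1 + kap)) \<le> y powr (- kap) - z powr (- kap)"
  proof -
    obtain s where s: "y < s" "s < z" "z powr (- kap) - y powr (- kap) = (z - y) * (- kap * s powr (- kap - 1))"
    proof -
      have "((\<lambda>s. s powr (- kap)) has_real_derivative - kap * s powr (- kap - 1)) (at s)"
        if "y \<le> s" for s
        using that y has_real_derivative_powr[of s "- kap"] by simp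
      then show ?thesis
        using MVT2[OF yz(1), of "\<lambda>s. s powr (- kap)" "\<lambda>s. - kap * s powr (- kap - 1)"] that by blast
    qed
    have "z powr (- kap - 1) \<le> s powr (- kap - 1)" using s y kap_range by (intro powr_mono2') auto
    then have "kap * h i * z powr (- kap - 1) \<le> kap * h i * s powr (- kap - 1)"
      using h kap_range by (intro mult_left_mono) auto
    moreover have e: "z powr (- (1 + kap)) = z powr (- kap - 1)"
      by (rule arg_cong[where f = "\<lambda>e. z powr e"]) simp
    ultimately show ?thesis unfolding e using s(3) h(1) by (simp add: mult_ac)
  qed
  then have "h i * z powr (- (1 + kap)) \<le> (y powr (- kap) - z powr (- kap)) / kap"
    using kap_range by (simp add: field_simps)
  moreover have "h i * y powr (- (1 + kap)) \<le> h i * (2 ^ 4 * z powr (- (1 + kap)))"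
    using calculation(1) h(2) by (intro mult_left_mono) auto
  moreover have "h i * (2 ^ 4 * z powr (- (1 + kap))) = 16 * (h i * z powr (- (1 + kap)))" by simp
  ultimately have hy: "h i * y powr (- (1 + kap)) \<le> 16 * ((y powr (- kap) - z powr (- kap)) / kap)"
    by linarith
  have "inner_defect a n i \<le> 18 * K^3 * eta^3 * y powr (- (1 + kap)) *
      (ker \<alpha> (x n) (t (Suc i)) - ker \<alpha> (x n) (t i))"
    unfolding y_def by (rule inner_defect_le[OF i n])
  also have "\<dots> \<le> 18 * K^3 * eta^3 * y powr (- (1 + kap)) * (h i * (4 * X powr (- (1 + \<alpha>))))"
    using K_ge_1 eta_pos by (intro mult_left_mono[OF dk]) auto
  also have "\<dots> = 72 * K^3 * eta^3 * X powr (- (1 + \<alpha>)) * (h i * y powr (- (1 + kap)))" by simp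
  also have "\<dots> \<le> 72 * K^3 * eta^3 * X powr (- (1 + \<alpha>)) * (16 * ((y powr (- kap) - z powr (- kap)) / kap))"
    using K_ge_1 eta_pos by (intro mult_left_mono[OF hy]) auto
  also have "\<dots> = far n * (y powr (- kap) - z powr (- kap))" by (simp add: far_def X_def)
  finally show ?thesis by (simp add: y_def z_def)
qed

lemma inner_defect_near:
  assumes i: "0 < i" "i < n" and n: "n < M" and near: "(a + x n) / 2 \<le> a + t (Suc i)"
  shows "inner_defect a n i \<le> near n * (ker \<alpha> (x n) (t (Suc i)) - ker \<alpha> (x n) (t i))"
proof -
  have l: "t i \<le> t (Suc i)" "t (Suc i) < x n" using i n t_mono t_less_x by auto
  have X: "0 < a + x n" using a_pos x_pos[OF n] by simp
  have "a + x n \<le> 4 * (a + t i)" using near shifted_doubling[of i] i n by simp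
  then have "(a + t i) powr (- (1 + kap)) \<le> 4 ^ 4 * (a + x n) powr (- (1 + kap))"
    using X kap_range by (intro powr_neg_le) auto
  then have "18 * K^3 * eta^3 * (a + t i) powr (- (1 + kap)) \<le> near n"
    using mult_left_mono[of "(a + t i) powr (- (1 + kap))" "4 ^ 4 * (a + x n) powr (- (1 + kap))" "18 * K^3 * eta^3"]
      K_ge_1 eta_pos by (simp add: near_def)
  moreover have "0 \<le> ker \<alpha> (x n) (t (Suc i)) - ker \<alpha> (x n) (t i)" using l alpha_pos by (simp add: ker_mono)
  ultimately show ?thesis using inner_defect_le[OF i n] by (meson mult_right_mono order_trans)
qed

definition main_term :: "nat \<Rightarrow> real" where
  "main_term n = a powr \<alpha> * x n powr (- \<alpha>) / (a + x n)"

lemma ratio_powr_le: "\<alpha> \<le> e \<Longrightarrow> (tau / a) powr e \<le> (tau / a) powr \<alpha>"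
  using tau_pos a_pos tau_le_a by (intro powr_mono') auto

lemma main_term_nonneg: "n < M \<Longrightarrow> 0 \<le> main_term n"
  using a_pos x_pos[of n] by (simp add: main_term_def)

lemma tau_powr_eq: "tau powr \<alpha> * (x n powr (- \<alpha>) / (a + x n)) = (tau / a) powr \<alpha> * main_term n"
  using tau_pos a_pos by (simp add: main_term_def powr_divide)

lemma tau_powr_tail:
  assumes "n < M" "\<alpha> \<le> q"
  shows "tau powr q * (a + x n) powr (\<alpha> - q) \<le> tau powr \<alpha>"
proof -
  have "(a + x n) powr (\<alpha> - q) \<le> tau powr (\<alpha> - q)"
    using assms tau_pos tau_le_a x_pos[of n] by (intro powr_mono2') auto
  then have "tau powr q * (a + x n) powr (\<alpha> - q) \<le> tau powr q * tau powr (\<alpha> - q)"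
    by (intro mult_left_mono) auto
  then show ?thesis using tau_pos by (simp add: powr_add[symmetric])
qed

text \<open>Here eta^3 a^(-kap) = (tau/a)^(3/r) a^\<alpha>, and 3/r exceeds \<alpha>.\<close>

lemma far_sum_le:
  assumes n: "n < M"
  shows "far n * a powr (- kap) \<le> 1152 * K^3 / kap * ((tau / a) powr \<alpha> * main_term n)"
proof -
  have x: "0 < x n" using x_pos[OF n] .
  have "eta^3 = tau powr (3 / r)"
    using tau_pos by (simp add: eta_def powr_power)
  then have "eta^3 * a powr (- kap) = (tau / a) powr (3 / r) * a powr \<alpha>"
    using tau_pos a_pos by (simp add: kap_def powr_divide powr_diff powr_minus field_simps)
  also have "\<dots> \<le> (tau / a) powr \<alpha> * a powr \<alpha>"
    using kap_range by (intro mult_right_mono ratio_powr_le) (auto simp: kap_def)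
  finally have 1: "eta^3 * a powr (- kap) \<le> (tau / a) powr \<alpha> * a powr \<alpha>" .
  have "(a + x n) powr (- (1 + \<alpha>)) = (a + x n) powr (- \<alpha>) * (a + x n) powr (- 1)"
    unfolding powr_add[symmetric] by (rule arg_cong[where f = "\<lambda>e. (a + x n) powr e"]) simp
  also have "\<dots> \<le> x n powr (- \<alpha>) / (a + x n)"
  proof -
    have "(a + x n) powr (- \<alpha>) \<le> x n powr (- \<alpha>)"
      using x a_pos alpha_pos by (intro powr_mono2') auto
    then have "(a + x n) powr (- \<alpha>) / (a + x n) \<le> x n powr (- \<alpha>) / (a + x n)"
      using x a_pos by (intro divide_right_mono) auto
    moreover have "(a + x n) powr (- 1) = 1 / (a + x n)"
      using x a_pos by (simp add: powr_minus_divide)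
    ultimately show ?thesis by simp
  qed
  finally have 2: "(a + x n) powr (- (1 + \<alpha>)) \<le> x n powr (- \<alpha>) / (a + x n)" .
  have "far n * a powr (- kap) = 1152 * K^3 / kap * ((eta^3 * a powr (- kap)) * (a + x n) powr (- (1 + \<alpha>)))"
    by (simp add: far_def)
  also have "\<dots> \<le> 1152 * K^3 / kap * (((tau / a) powr \<alpha> * a powr \<alpha>) * (x n powr (- \<alpha>) / (a + x n)))"
    using K_ge_1 kap_range x a_pos by (intro mult_left_mono[OF mult_mono[OF 1 2]]) auto
  finally show ?thesis by (simp add: main_term_def)
qed

text \<open>The telescoped kernel leaves (x_n - t_n)^(-\<alpha>), which costs eta^(-\<alpha>) and
  reduces the available power of tau from 3/r to (3 - \<alpha>)/r; this is where the limit on r is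
  felt.\<close>

lemma near_sum_le:
  assumes n: "n < M"
  shows "near n * ker \<alpha> (x n) (t n) \<le> 9216 * K^4 * ((tau / a) powr \<alpha> * main_term n)"
proof -
  define X where "X = a + x n"
  have x: "0 < x n" "x n < t (Suc n)" using x_pos[OF n] x_less[OF n] by auto
  have X: "0 < X" "x n \<le> X" using x a_pos by (auto simp: X_def)
  have "x n powr ex \<le> t (Suc n) powr ex"
    using x ex_range by (intro powr_mono2) auto
  then have "eta * x n powr ex \<le> K * h n"
    using h_ge[OF n] mult_left_mono[of "x n powr ex" "t (Suc n) powr ex" eta] eta_pos by linarith
  moreover have "h n \<le> 2 * (x n - t n)" using h_pos[OF n] alpha_less_1 by (simp add: x_diff)
  ultimately have hn: "eta * x n powr ex / (2 * K) \<le> x n - t n"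
    using K_ge_1 mult_left_mono[of "h n" "2 * (x n - t n)" K] by (simp add: field_simps)
  have "ker \<alpha> (x n) (t n) \<le> (eta * x n powr ex / (2 * K)) powr (- \<alpha>)"
    unfolding ker_def using hn eta_pos x K_ge_1 alpha_pos by (intro powr_mono2') auto
  also have "\<dots> = (2 * K) powr \<alpha> * (eta powr (- \<alpha>) * x n powr (- (ex * \<alpha>)))"
    using eta_pos x K_ge_1 by (simp add: powr_divide powr_mult powr_powr powr_minus field_simps)
  also have "\<dots> \<le> (2 * K) * (eta powr (- \<alpha>) * (x n powr (- \<alpha>) * X powr (\<alpha> / r)))"
  proof (intro mult_mono)
    have "(2 * K) powr \<alpha> \<le> (2 * K) powr 1" using K_ge_1 alpha_less_1 by (intro powr_mono) auto
    then show "(2 * K) powr \<alpha> \<le> 2 * K" using K_ge_1 by simp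
    have "x n powr (- (ex * \<alpha>)) = x n powr (- \<alpha>) * x n powr (\<alpha> / r)"
      unfolding powr_add[symmetric] by (rule arg_cong[where f = "\<lambda>e. x n powr e"]) (simp add: ex_def algebra_simps)
    moreover have "x n powr (\<alpha> / r) \<le> X powr (\<alpha> / r)"
      using x X alpha_pos r_ge_1 by (intro powr_mono2) auto
    ultimately show "x n powr (- (ex * \<alpha>)) \<le> x n powr (- \<alpha>) * X powr (\<alpha> / r)"
      by (simp add: mult_left_mono)
  qed (use K_ge_1 in auto)
  finally have k: "ker \<alpha> (x n) (t n) \<le> (2 * K) * (eta powr (- \<alpha>) * (x n powr (- \<alpha>) * X powr (\<alpha> / r)))" .
  have "near n * ker \<alpha> (x n) (t n) \<le> near n * ((2 * K) * (eta powr (- \<alpha>) * (x n powr (- \<alpha>) * X powr (\<alpha> / r))))"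
    by (intro mult_left_mono[OF k] near_nonneg)
  also have "\<dots> = 9216 * K^4 * ((eta^3 * eta powr (- \<alpha>)) * (X powr (- (1 + kap)) * X powr (\<alpha> / r)) * x n powr (- \<alpha>))"
    by (simp add: near_def X_def power4_eq_xxxx power3_eq_cube)
  also have "eta^3 * eta powr (- \<alpha>) = tau powr ((3 - \<alpha>) / r)"
  proof -
    have "eta^3 * eta powr (- \<alpha>) = eta powr 3 * eta powr (- \<alpha>)" using eta_pos by simp
    also have "\<dots> = tau powr ((3 - \<alpha>) / r)"
      unfolding powr_add[symmetric] eta_def powr_powr by (simp add: diff_divide_distrib)
    finally show ?thesis .
  qed
  also have "X powr (- (1 + kap)) * X powr (\<alpha> / r) = X powr (\<alpha> - (3 - \<alpha>) / r) * X powr (- 1)"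
    unfolding powr_add[symmetric]
    by (rule arg_cong[where f = "\<lambda>e. X powr e"]) (simp add: kap_def diff_divide_distrib)
  also have "9216 * K^4 * (tau powr ((3 - \<alpha>) / r) * (X powr (\<alpha> - (3 - \<alpha>) / r) * X powr (- 1)) * x n powr (- \<alpha>))
     = 9216 * K^4 * ((tau powr ((3 - \<alpha>) / r) * X powr (\<alpha> - (3 - \<alpha>) / r)) * (x n powr (- \<alpha>) / X))"
    using X by (simp add: powr_minus_divide)
  also have "\<dots> \<le> 9216 * K^4 * (tau powr \<alpha> * (x n powr (- \<alpha>) / X))"
    using tau_powr_tail[OF n alpha_le_q] X K_ge_1
    by (intro mult_left_mono mult_right_mono) (auto simp: X_def)
  finally show ?thesis unfolding X_def tau_powr_eq .
qed

text \<open>The squared step times (x_n - t_n)^(1 - \<alpha>) is at most h^(3 - \<alpha>), again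
  giving tau^((3 - \<alpha>)/r); 32 = 6 * 16 * 8 / 24.\<close>

lemma last_defect_le:
  assumes n: "n < M"
  shows "last_defect a n \<le> 32 * K^3 * ((tau / a) powr \<alpha> * main_term n)"
proof -
  define X where "X = a + x n"
  define q where "q = (3 - \<alpha>) / r"
  have x: "0 < x n" "x n < t (Suc n)" "t (Suc n) \<le> 2 * x n"
    using x_pos[OF n] x_less[OF n] x_ge_half[OF n] by auto
  have X: "0 < X" "x n \<le> X" using x a_pos by (auto simp: X_def)
  have h: "0 < h n" using h_pos[OF n] .
  have tn: "0 \<le> t n" "t n < x n" using t_nonneg[of n] x_gt n by auto
  have "X \<le> 2 * (a + t n)" using shifted_doubling[OF n] x by (simp add: X_def)
  then have p: "(a + t n) powr (- (4 - \<alpha>)) \<le> 2 ^ 4 * X powr (- (4 - \<alpha>))"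
    using X alpha_pos alpha_less_1 by (intro powr_neg_le) auto
  have hz: "(a + t (Suc n)) powr ex \<le> 2 * X powr ex"
    using x a_pos X by (intro powr_ex_double) (auto simp: X_def)
  have hX: "h n \<le> 2 * K * eta * X powr ex"
  proof -
    have "K * eta * (a + t (Suc n)) powr ex \<le> K * eta * (2 * X powr ex)"
      using K_ge_1 eta_pos hz by (intro mult_left_mono) auto
    then show ?thesis using h_le_shifted[OF n] by simp
  qed
  have b: "bar3 a (t n) / (1 - \<alpha>) \<le> 6 * (16 * X powr (\<alpha> - 4))"
  proof -
    have "(2 - \<alpha>) * (3 - \<alpha>) \<le> 2 * 3" using alpha_pos alpha_less_1 by (intro mult_mono) auto
    moreover have "bar3 a (t n) / (1 - \<alpha>) = (2 - \<alpha>) * (3 - \<alpha>) * (a + t n) powr (\<alpha> - 4)"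
      using alpha_less_1 by (simp add: bar3_def)
    moreover have "(a + t n) powr (\<alpha> - 4) \<le> 16 * X powr (\<alpha> - 4)" using p by simp
    ultimately show ?thesis using mult_mono[of "(2 - \<alpha>) * (3 - \<alpha>)" "2 * 3" "(a + t n) powr (\<alpha> - 4)"
      "16 * X powr (\<alpha> - 4)"] by simp
  qed
  have hp: "h n ^ 2 * (x n - t n) powr (1 - \<alpha>) \<le> h n powr (3 - \<alpha>)"
  proof -
    have "x n - t n \<le> h n" using x by (simp add: h_def)
    then have "(x n - t n) powr (1 - \<alpha>) \<le> h n powr (1 - \<alpha>)"
      using tn alpha_less_1 by (intro powr_mono2) auto
    then have "h n ^ 2 * (x n - t n) powr (1 - \<alpha>) \<le> h n powr 2 * h n powr (1 - \<alpha>)"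
      using h by (simp add: mult_left_mono)
    then show ?thesis unfolding powr_add[symmetric] by simp
  qed
  have "h n powr (3 - \<alpha>) \<le> (2 * K * eta * X powr ex) powr (3 - \<alpha>)"
    using hX h alpha_less_1 by (intro powr_mono2) auto
  also have "\<dots> = (2 * K) powr (3 - \<alpha>) * (eta powr (3 - \<alpha>) * (X powr ex) powr (3 - \<alpha>))"
    using K_ge_1 eta_pos X by (simp add: powr_mult)
  also have "\<dots> \<le> (2 * K) powr 3 * (eta powr (3 - \<alpha>) * (X powr ex) powr (3 - \<alpha>))"
    using K_ge_1 alpha_pos by (intro mult_right_mono powr_mono) auto
  also have "\<dots> = 8 * K^3 * (tau powr q * X powr ((3 - \<alpha>) - q))"
    using K_ge_1 by (simp add: eta_def powr_powr q_def ex_def power_mult_distrib left_diff_distrib)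
  finally have hq: "h n powr (3 - \<alpha>) \<le> 8 * K^3 * (tau powr q * X powr ((3 - \<alpha>) - q))" .
  have "last_defect a n = bar3 a (t n) / (1 - \<alpha>) * (h n ^ 2 * (x n - t n) powr (1 - \<alpha>)) / 24"
    using alpha_less_1 by (simp add: last_defect_def field_simps)
  also have "\<dots> \<le> (6 * (16 * X powr (\<alpha> - 4))) * (8 * K^3 * (tau powr q * X powr ((3 - \<alpha>) - q))) / 24"
    using b hp hq h by (intro divide_right_mono mult_mono order_trans[OF hp hq]) auto
  also have "\<dots> = 32 * K^3 * (tau powr q * (X powr (\<alpha> - 4) * X powr ((3 - \<alpha>) - q)))" by simp
  also have "X powr (\<alpha> - 4) * X powr ((3 - \<alpha>) - q) = X powr (\<alpha> - q) * (X powr (- \<alpha>) * X powr (- 1))"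
    unfolding powr_add[symmetric] by (rule arg_cong[where f = "\<lambda>e. X powr e"]) simp
  also have "32 * K^3 * (tau powr q * (X powr (\<alpha> - q) * (X powr (- \<alpha>) * X powr (- 1)))) =
     32 * K^3 * ((tau powr q * X powr (\<alpha> - q)) * (X powr (- \<alpha>) / X))"
    using X by (simp add: powr_minus_divide)
  also have "\<dots> \<le> 32 * K^3 * (tau powr \<alpha> * (x n powr (- \<alpha>) / X))"
  proof (intro mult_left_mono mult_mono divide_right_mono)
    show "tau powr q * X powr (\<alpha> - q) \<le> tau powr \<alpha>"
      unfolding X_def q_def by (rule tau_powr_tail[OF n alpha_le_q])
    show "X powr (- \<alpha>) \<le> x n powr (- \<alpha>)" using X x alpha_pos by (intro powr_mono2') auto
  qed (use X K_ge_1 in auto)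
  finally show ?thesis unfolding X_def tau_powr_eq .
qed

text \<open>Without the correction the loss is of order a^(\<alpha> - 3) tau^3 x^(-\<alpha> - 1). As
  tau is below both a and x, one factor tau replaces 1/x by 2/(a + x) up to a factor a, leaving
  (tau/a)^2, which is more than enough.\<close>

lemma first_defect_le:
  assumes n: "0 < n" "n < M"
  shows "inner_defect a n 0 \<le> 8 * K^2 * ((tau / a) powr \<alpha> * main_term n)"
proof -
  have x: "0 < x n" "tau < x n" using x_pos[of n] t_less_x[of 1 n] n by (auto simp: tau_def)
  note kp = ker'_tau_le[OF n]
  have "bubble_moment \<alpha> (x n) 0 tau \<le> tau ^ 3 / 6 * ker' \<alpha> (x n) tau"
    using bubble_moment_le[OF alpha_pos, of 0 tau "x n"] tau_pos x by simp
  also have "\<dots> \<le> tau ^ 3 / 6 * (16 * K^2 * (x n powr (- \<alpha>) / x n))"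
    using kp tau_pos by (intro mult_left_mono) auto
  finally have bm: "bubble_moment \<alpha> (x n) 0 tau \<le> tau ^ 3 / 6 * (16 * K^2 * (x n powr (- \<alpha>) / x n))" .
  have b2: "bar2 a 0 \<le> 2 * a powr (\<alpha> - 3)"
  proof -
    have "(1 - \<alpha>) * (2 - \<alpha>) \<le> 1 * 2" using alpha_pos alpha_less_1 by (intro mult_mono) auto
    then show ?thesis unfolding bar2_def by (simp add: mult_right_mono)
  qed
  have b0: "0 \<le> bubble_moment \<alpha> (x n) 0 tau"
    using tau_pos x alpha_pos by (intro bubble_moment_nonneg) auto
  have "inner_defect a n 0 = bar2 a 0 / 2 * bubble_moment \<alpha> (x n) 0 tau"
    by (simp add: inner_defect_def t_0 tau_def)
  also have "\<dots> \<le> (2 * a powr (\<alpha> - 3)) / 2 * (tau ^ 3 / 6 * (16 * K^2 * (x n powr (- \<alpha>) / x n)))"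
    using b2 bm b0 by (intro mult_mono divide_right_mono) auto
  also have "\<dots> = 8 / 3 * K^2 * (a powr (\<alpha> - 3) * tau ^ 3 * x n powr (- \<alpha>)) * (1 / x n)"
    by simp
  also have "\<dots> \<le> 4 * K^2 * (a powr (\<alpha> - 3) * tau ^ 3 * x n powr (- \<alpha>)) * (1 / x n)"
    using x a_pos tau_pos by (intro mult_right_mono) auto
  also have "\<dots> \<le> 4 * K^2 * (a powr (\<alpha> - 3) * tau ^ 3 * x n powr (- \<alpha>)) * (2 * a / (tau * (a + x n)))"
  proof (intro mult_left_mono)
    have "tau * (a + x n) \<le> 2 * a * x n"
    proof -
      have "tau * x n \<le> a * x n" "tau * a \<le> x n * a"
        using x a_pos tau_le_a by (intro mult_right_mono; simp)+
      then show ?thesis by (simp add: algebra_simps)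
    qed
    then show "1 / x n \<le> 2 * a / (tau * (a + x n))"
      using x a_pos tau_pos by (simp add: divide_simps mult.commute)
  qed (use a_pos tau_pos in auto)
  also have "\<dots> = 8 * K^2 * ((tau / a) powr 2 * main_term n)"
  proof -
    have "4 * K^2 * (A / a^3 * tau^3 * P) * (2 * a / (tau * X)) = 8 * K^2 * ((tau / a)^2 * (A * P / X))"
      if "X \<noteq> 0" for A P X
      using that a_pos tau_pos by (simp add: power2_eq_square power3_eq_cube field_simps)
    moreover have "a powr (\<alpha> - 3) = a powr \<alpha> / a^3" using a_pos by (simp add: powr_diff)
    moreover have "(tau / a) powr 2 = (tau / a)^2" using a_pos tau_pos by simp
    ultimately show ?thesis using a_pos x by (simp add: main_term_def)
  qed
  also have "\<dots> \<le> 8 * K^2 * ((tau / a) powr \<alpha> * main_term n)"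
    using main_term_nonneg[OF n(2)] alpha_less_1
    by (intro mult_left_mono mult_right_mono ratio_powr_le) auto
  finally show ?thesis .
qed

lemma inner_sum_le:
  assumes n: "n < M"
  shows "(\<Sum>i<n. inner_defect a n i) \<le>
    (8 * K^2 + 1152 * K^3 / kap + 9216 * K^4) * ((tau / a) powr \<alpha> * main_term n)"
proof (cases "n = 0")
  case True
  then show ?thesis
    using main_term_nonneg[OF n] K_ge_1 kap_range by simp
next
  case False
  define p k where "p i = (a + t i) powr (- kap)" and "k i = ker \<alpha> (x n) (t i)" for i
  have "inner_defect a n i \<le> far n * (p i - p (Suc i)) + near n * (k (Suc i) - k i)"
    if i: "0 < i" "i < n" for i
  proof -
    have l: "t i \<le> t (Suc i)" "t (Suc i) < x n" using i n t_mono t_less_x by auto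
    have "0 \<le> k (Suc i) - k i" using l alpha_pos by (simp add: k_def ker_mono)
    then have 1: "0 \<le> near n * (k (Suc i) - k i)" using near_nonneg by simp
    have "p (Suc i) \<le> p i"
      unfolding p_def using l a_pos t_nonneg[of i] i n kap_range by (intro powr_mono2') auto
    then have 2: "0 \<le> far n * (p i - p (Suc i))" using far_nonneg by simp
    show ?thesis
      using inner_defect_far[OF i n] inner_defect_near[OF i n] 1 2 unfolding p_def k_def
      by (cases "a + t (Suc i) < (a + x n) / 2") auto
  qed
  then have "(\<Sum>i\<in>{1..<n}. inner_defect a n i) \<le>
      (\<Sum>i\<in>{1..<n}. far n * (p i - p (Suc i)) + near n * (k (Suc i) - k i))"
    by (intro sum_mono) auto
  also have "\<dots> = far n * (\<Sum>i\<in>{1..<n}. p i - p (Suc i)) + near n * (\<Sum>i\<in>{1..<n}. k (Suc i) - k i)"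
    by (simp add: sum.distrib sum_distrib_left)
  also have "(\<Sum>i\<in>{1..<n}. p i - p (Suc i)) = p 1 - p n"
    using sum_Suc_diff'[of 1 n "\<lambda>i. - p i"] False by simp
  also have "(\<Sum>i\<in>{1..<n}. k (Suc i) - k i) = k n - k 1"
    using sum_Suc_diff'[of 1 n k] False by simp
  also have "far n * (p 1 - p n) + near n * (k n - k 1) \<le> far n * a powr (- kap) + near n * k n"
  proof (intro add_mono mult_left_mono far_nonneg near_nonneg)
    have "p 1 \<le> a powr (- kap)"
      unfolding p_def using a_pos tau_pos kap_range by (intro powr_mono2') (auto simp: tau_def)
    then show "p 1 - p n \<le> a powr (- kap)" using powr_ge_zero[of "a + t n" "- kap"] unfolding p_def by linarith
    have "0 \<le> k 1" using ker_pos[of "t 1" "x n" \<alpha>] t_less_x[of 1 n] False n by (simp add: k_def)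
    then show "k n - k 1 \<le> k n" by simp
  qed
  also have "\<dots> \<le> 1152 * K^3 / kap * ((tau / a) powr \<alpha> * main_term n) + 9216 * K^4 * ((tau / a) powr \<alpha> * main_term n)"
    unfolding k_def by (intro add_mono far_sum_le near_sum_le n)
  finally have "(\<Sum>i\<in>{1..<n}. inner_defect a n i) \<le> \<dots>" .
  moreover have "(\<Sum>i<n. inner_defect a n i) = inner_defect a n 0 + (\<Sum>i\<in>{1..<n}. inner_defect a n i)"
    using False by (simp add: lessThan_atLeast0 sum.atLeast_Suc_lessThan)
  ultimately show ?thesis using first_defect_le[of n] False n by (simp add: distrib_right)
qed

end

theorem barrier_frac_lower:
  assumes a: "barrier_scale \<alpha> r K * tau \<le> a" and n: "n < M"
  shows "a powr \<alpha> * x n powr (- \<alpha>) / (a + x n) / 2 \<le> frac (start n) (barrier a) n"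
proof -
  define C where "C = barrier_const \<alpha> r K"
  have C: "0 < C"
    unfolding C_def barrier_const_def kap_def[symmetric] using K_ge_1 kap_range
    by (intro add_pos_pos) auto
  have s: "(2 * K) powr r \<le> barrier_scale \<alpha> r K" "(2 * C) powr (1 / \<alpha>) \<le> barrier_scale \<alpha> r K"
    by (auto simp: barrier_scale_def C_def)
  have a1: "(2 * K) powr r * tau \<le> a" and a2: "(2 * C) powr (1 / \<alpha>) * tau \<le> a"
    using a mult_right_mono[OF s(1) less_imp_le[OF tau_pos]] mult_right_mono[OF s(2) less_imp_le[OF tau_pos]]
    by linarith+
  have ap: "0 < a" using a_pos[OF a1] .
  define m where "m = main_term a n"
  have m: "0 \<le> m" unfolding m_def by (rule main_term_nonneg[OF a1 n])
  have "2 * C * tau powr \<alpha> = ((2 * C) powr (1 / \<alpha>) * tau) powr \<alpha>"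
    using C tau_pos alpha_pos by (simp add: powr_mult powr_powr)
  also have "\<dots> \<le> a powr \<alpha>" using a2 tau_pos alpha_pos by (intro powr_mono2) auto
  finally have "C * (tau / a) powr \<alpha> \<le> 1 / 2"
    using ap tau_pos by (simp add: powr_divide field_simps)
  then have "C * (tau / a) powr \<alpha> * m \<le> 1 / 2 * m" using m by (intro mult_right_mono) auto
  moreover have "(\<Sum>i<n. inner_defect a n i) + last_defect a n \<le> C * ((tau / a) powr \<alpha> * m)"
    using inner_sum_le[OF a1 n] last_defect_le[OF a1 n]
    by (simp add: C_def barrier_const_def kap_def m_def distrib_right)
  moreover have meq: "a powr \<alpha> * x n powr (- \<alpha>) / (a + x n) = m"
    by (simp add: m_def main_term_def[OF a1])
  moreover have "m - (\<Sum>i<n. inner_defect a n i) - last_defect a n \<le> frac (start n) (barrier a) n"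
    unfolding meq[symmetric] by (rule barrier_frac_ge[OF ap n])
  ultimately show ?thesis unfolding meq mult.assoc by linarith
qed

end

section \<open>Stability\<close>

context caputo_mesh
begin

lemma frac_eq_alikhanov:
  assumes "n < M"
  shows "frac 0 U n = Gamma (1 - \<alpha>) * alikhanov \<alpha> t U (Suc n)"
proof -
  have "0 < Gamma (1 - \<alpha>)" using alpha_less_1 by (intro Gamma_real_pos) simp
  then show ?thesis using alikhanov_eq_frac[OF assms, of U] by simp
qed

lemma slope_0: "U 0 = 0 \<Longrightarrow> slope U 0 = U 1 / t 1"
  by (simp add: slope_def h_0)

text \<open>Applying the bounds of the first two levels to U and to -U gives absolute values; the
  constant does not depend on the ratio of the first two steps.\<close>

lemma slope_diff_two_sided:
  assumes M: "1 < M" and U0: "U 0 = 0" and F0: "\<bar>frac 0 U 0\<bar> \<le> B"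
    and F1: "\<bar>frac 0 U 1\<bar> \<le> B * (t 1 / t 2) powr \<alpha>"
  shows "\<bar>slope U 1 - slope U 0\<bar> \<le> ((1 + 8 / (1 - \<alpha>)) * 24 / \<alpha> + 1) * B * t 1 powr (\<alpha> - 1)"
proof -
  have B: "0 \<le> B" using F0 by linarith
  have t1: "0 < t 1" using t1_pos M by simp
  have neg: "slope (\<lambda>i. - U i) i = - slope U i" for i
    by (simp add: slope_def minus_divide_left)
  have "U 1 \<le> B * t 1 powr \<alpha>" using first_value_le[of U B] F0 B M U0 by simp
  moreover have "- U 1 \<le> B * t 1 powr \<alpha>"
    using first_value_le[of "\<lambda>i. - U i" B] F0 B M U0 by (simp add: frac_uminus)
  ultimately have U1: "\<bar>U 1\<bar> \<le> B * t 1 powr \<alpha>" by linarith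
  define S where "S = (B + 8 * B / (1 - \<alpha>)) * 24 / \<alpha> * t 1 powr (\<alpha> - 1)"
  have "slope U 1 \<le> S"
    unfolding S_def using F1 B M U0 U1 by (intro second_slope_le) auto
  moreover have "slope (\<lambda>i. - U i) 1 \<le> S"
    unfolding S_def using F1 B M U0 U1 by (intro second_slope_le) (auto simp: frac_uminus)
  moreover have "\<bar>slope U 0\<bar> \<le> B * t 1 powr (\<alpha> - 1)"
    using U1 t1 by (simp add: slope_0[of U, OF U0] powr_diff divide_right_mono)
  ultimately have "\<bar>slope U 1 - slope U 0\<bar> \<le> S + B * t 1 powr (\<alpha> - 1)"
    unfolding neg by linarith
  also have "\<dots> = ((1 + 8 / (1 - \<alpha>)) * 24 / \<alpha> + 1) * B * t 1 powr (\<alpha> - 1)"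
    by (simp add: S_def algebra_simps add_divide_distrib)
  finally show ?thesis .
qed

text \<open>With one-sided data nothing bounds the second slope below except nonnegativity: it
  cannot fall faster than from \<open>U 1\<close> to 0 within \<open>h 1\<close>. The lower bound on
  the step ratio turns \<open>U 1 / h 1\<close> into a multiple of \<open>U 1 / t 1\<close>.\<close>

lemma slope_diff_one_sided:
  assumes M: "1 < M" and U0: "U 0 = 0" and F0: "frac 0 U 0 \<le> B" and B: "0 \<le> B"
    and U: "0 \<le> U 1" "0 \<le> U 2" and c: "0 < c" "c * t 1 \<le> h 1"
  shows "- ((1 / c + 1) * B) * t 1 powr (\<alpha> - 1) \<le> slope U 1 - slope U 0"
proof -
  have t1: "0 < t 1" using t1_pos M by simp
  have h1: "0 < h 1" using h_pos M by simp
  have "U 1 \<le> B * t 1 powr \<alpha>" using first_value_le[of U B] F0 B M U0 by simp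
  then have U1: "U 1 / t 1 \<le> B * t 1 powr (\<alpha> - 1)"
    using t1 by (simp add: powr_diff divide_right_mono)
  have "U 1 / h 1 \<le> U 1 / (c * t 1)"
    using U c t1 h1 by (intro divide_left_mono) auto
  also have "\<dots> = 1 / c * (U 1 / t 1)" by simp
  also have "\<dots> \<le> 1 / c * (B * t 1 powr (\<alpha> - 1))"
    using U1 c by (intro mult_left_mono) auto
  finally have "U 1 / h 1 \<le> 1 / c * (B * t 1 powr (\<alpha> - 1))" .
  moreover have "- (U 1 / h 1) \<le> slope U 1"
    using U h1 by (simp add: slope_def numeral_2_eq_2 diff_divide_distrib)
  ultimately have "- (1 / c * (B * t 1 powr (\<alpha> - 1))) - B * t 1 powr (\<alpha> - 1) \<le> slope U 1 - slope U 0"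
    using U1 slope_0[of U, OF U0] by linarith
  then show ?thesis by (simp add: algebra_simps)
qed

lemma exponent_weaken:
  assumes "n < M" "e \<le> e'"
  shows "(t 1 / t (Suc n)) powr e' \<le> (t 1 / t (Suc n)) powr e"
  using assms t1_pos t_mono[of 1 "Suc n"] by (intro powr_mono') (auto simp: divide_le_eq_1)

lemma constant_two_sided:
  assumes rc: "ratio_condition M t" and N: "0 < N" "N \<le> M" and U0: "U 0 = 0"
    and F: "\<And>n. n < N \<Longrightarrow> \<bar>frac 0 U n\<bar> \<le> B * (t 1 / t (Suc n)) powr \<alpha>"
  shows "\<bar>U N\<bar> \<le> (1 + 4 * ((1 + 8 / (1 - \<alpha>)) * 24 / \<alpha> + 1) / (1 - \<alpha>)) * B * t 1 powr \<alpha>"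
proof -
  define D where "D = ((1 + 8 / (1 - \<alpha>)) * 24 / \<alpha> + 1) * B"
  have F0: "\<bar>frac 0 U 0\<bar> \<le> B" using F[of 0] N t1_pos by simp
  then have B: "0 \<le> B" by linarith
  then have D: "0 \<le> D" using alpha_pos alpha_less_1 by (simp add: D_def)
  have "\<bar>slope U 1 - slope U 0\<bar> \<le> D * t 1 powr (\<alpha> - 1)" if "2 < N"
    unfolding D_def using that N U0 F[of 1] F0
    by (intro slope_diff_two_sided) (auto simp: numeral_2_eq_2)
  then have s: "- D * t 1 powr (\<alpha> - 1) \<le> slope U 1 - slope U 0"
    "- D * t 1 powr (\<alpha> - 1) \<le> slope (\<lambda>i. - U i) 1 - slope (\<lambda>i. - U i) 0" if "2 < N"
    using that by (auto simp: slope_def abs_le_iff diff_divide_distrib)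
  have "U N \<le> (B + 4 * D / (1 - \<alpha>)) * t 1 powr \<alpha>"
    using F s by (intro constant_stability[where U = U, OF rc N U0 _ _ B D]) (auto simp: abs_le_iff)
  moreover have "- U N \<le> (B + 4 * D / (1 - \<alpha>)) * t 1 powr \<alpha>"
    by (rule constant_stability[where U = "\<lambda>i. - U i", OF rc N _ _ _ B D])
      (use F s U0 in \<open>auto simp: abs_le_iff frac_uminus\<close>)
  ultimately have "\<bar>U N\<bar> \<le> (B + 4 * D / (1 - \<alpha>)) * t 1 powr \<alpha>" by linarith
  then show ?thesis by (simp add: D_def algebra_simps)
qed

lemma constant_one_sided:
  assumes rc: "ratio_condition M t" and N: "0 < N" "N \<le> M" and U0: "U 0 = 0"
    and F: "\<And>n. n < N \<Longrightarrow> frac 0 U n \<le> B * (t 1 / t (Suc n)) powr \<alpha>" and B: "0 \<le> B"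
    and U: "\<And>i. 0 \<le> U i" and c: "0 < c" "2 < M \<Longrightarrow> c * t 1 \<le> h 1"
  shows "U N \<le> (1 + 4 * (1 / c + 1) / (1 - \<alpha>)) * B * t 1 powr \<alpha>"
proof -
  define D where "D = (1 / c + 1) * B"
  have F0: "frac 0 U 0 \<le> B" using F[of 0] N t1_pos by simp
  have D: "0 \<le> D" using B c by (simp add: D_def)
  have "- D * t 1 powr (\<alpha> - 1) \<le> slope U 1 - slope U 0" if "2 < N"
    unfolding D_def using that N U0 F0 B U c
    by (intro slope_diff_one_sided) auto
  then have "U N \<le> (B + 4 * D / (1 - \<alpha>)) * t 1 powr \<alpha>"
    using F by (intro constant_stability[where U = U, OF rc N U0 _ _ B D]) auto
  then show ?thesis by (simp add: D_def algebra_simps)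
qed

lemma stab_bound_constant:
  assumes "n < M" "\<gamma> \<le> \<alpha> - 1"
  shows "stab_bound \<alpha> \<gamma> t (Suc n) = (t 1 / t (Suc n)) powr (\<gamma> + 1 - \<alpha>) * t 1 powr \<alpha>"
proof -
  have "0 < t 1" "0 < t (Suc n)" using assms t1_pos t_less[of 0 "Suc n"] t_0 by auto
  moreover have "\<gamma> < 0" using assms alpha_less_1 by simp
  ultimately show ?thesis
    by (simp add: stab_bound_def powr_divide powr_diff powr_add field_simps)
qed

text \<open>The exponent \<gamma> + 1 - \<alpha> is not positive, so the excess factor over the
  \<alpha>-power is largest at the target index m and can be frozen there.\<close>

lemma weight_constant:
  assumes "n \<le> m" "m < M" "\<gamma> \<le> \<alpha> - 1"
  shows "(t 1 / t (Suc n)) powr (\<gamma> + 1) \<le>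
    (t 1 / t (Suc m)) powr (\<gamma> + 1 - \<alpha>) * (t 1 / t (Suc n)) powr \<alpha>"
proof -
  have p: "0 < t 1" "0 < t (Suc n)" "0 < t (Suc m)"
    using assms t1_pos t_less[of 0 "Suc n"] t_less[of 0 "Suc m"] t_0 by auto
  have "(t 1 / t (Suc n)) powr (\<gamma> + 1 - \<alpha>) \<le> (t 1 / t (Suc m)) powr (\<gamma> + 1 - \<alpha>)"
    using p assms t_mono[of "Suc n" "Suc m"] by (intro powr_mono2') (auto intro!: divide_left_mono)
  then have "(t 1 / t (Suc n)) powr (\<gamma> + 1 - \<alpha>) * (t 1 / t (Suc n)) powr \<alpha> \<le>
     (t 1 / t (Suc m)) powr (\<gamma> + 1 - \<alpha>) * (t 1 / t (Suc n)) powr \<alpha>"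
    by (intro mult_right_mono) auto
  then show ?thesis by (simp add: powr_add[symmetric])
qed

end

section \<open>Superposition of barriers for \<gamma> > \<alpha> - 1\<close>

context graded_mesh
begin

text \<open>\<open>corr_0_le\<close> and \<open>avg_0_le\<close> yield decay of order \<alpha> only.
  The separation of \<open>x n\<close> from the first interval allows the bubble moment to be
  estimated by \<open>ker'\<close> and gains one more power; 11 rounds up 32/3.\<close>

lemma corr_0_decay:
  assumes n: "1 < n" "n < M"
  shows "corr n 0 * t 1 powr (\<alpha> - 1) \<le> 11 * K^2 * (t 1 / t (Suc n)) powr (\<alpha> + 1)"
proof -
  have x: "0 < x n" "tau < x n" using x_pos[of n] t_less_x[of 1 n] n by (auto simp: tau_def)
  have h: "0 < h 1" using h_pos n by simp
  have "bubble_moment \<alpha> (x n) 0 tau \<le> tau ^ 3 / 6 * ker' \<alpha> (x n) tau"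
    using bubble_moment_le[OF alpha_pos, of 0 tau "x n"] tau_pos x by simp
  also have "\<dots> \<le> tau ^ 3 / 6 * (16 * K^2 * (x n powr (- \<alpha>) / x n))"
    using ker'_tau_le[of n] n tau_pos by (intro mult_left_mono) auto
  also have "x n powr (- \<alpha>) / x n = x n powr (- (\<alpha> + 1))"
    using x by (simp add: powr_diff)
  also have "tau ^ 3 / 6 * (16 * K^2 * x n powr (- (\<alpha> + 1))) \<le>
      tau ^ 3 / 6 * (16 * K^2 * (4 * t (Suc n) powr (- (\<alpha> + 1))))"
    using x_powr_le[of n "\<alpha> + 1"] n alpha_pos alpha_less_1 tau_pos by (intro mult_left_mono) auto
  finally have b: "bubble_moment \<alpha> (x n) 0 tau \<le> 32 / 3 * K^2 * tau ^ 3 * t (Suc n) powr (- (\<alpha> + 1))"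
    by simp
  have b0: "0 \<le> bubble_moment \<alpha> (x n) 0 tau"
    using tau_pos x alpha_pos by (intro bubble_moment_nonneg) auto
  have "corr n 0 = bubble_moment \<alpha> (x n) 0 tau / (tau + h 1)" by (simp add: corr_def t_0 h_0 tau_def)
  also have "\<dots> \<le> bubble_moment \<alpha> (x n) 0 tau / tau"
    using b0 h tau_pos by (intro divide_left_mono) auto
  also have "\<dots> \<le> (32 / 3 * K^2 * tau ^ 3 * t (Suc n) powr (- (\<alpha> + 1))) / tau"
    using tau_pos by (intro divide_right_mono b) auto
  also have "\<dots> = 32 / 3 * K^2 * tau ^ 2 * t (Suc n) powr (- (\<alpha> + 1))"
    using tau_pos by (simp add: power2_eq_square power3_eq_cube)
  finally have "corr n 0 * tau powr (\<alpha> - 1) \<le>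
      32 / 3 * K^2 * tau ^ 2 * t (Suc n) powr (- (\<alpha> + 1)) * tau powr (\<alpha> - 1)"
    by (intro mult_right_mono) auto
  also have "\<dots> = 32 / 3 * K^2 * ((tau powr 2 * tau powr (\<alpha> - 1)) * t (Suc n) powr (- (\<alpha> + 1)))"
    using tau_pos by simp
  also have "tau powr 2 * tau powr (\<alpha> - 1) = tau powr (\<alpha> + 1)"
    unfolding powr_add[symmetric] by (simp add: add.commute)
  also have "32 / 3 * K^2 * (tau powr (\<alpha> + 1) * t (Suc n) powr (- (\<alpha> + 1))) \<le>
      11 * K^2 * (tau powr (\<alpha> + 1) * t (Suc n) powr (- (\<alpha> + 1)))"
    by (intro mult_right_mono) auto
  finally show ?thesis unfolding quotient_powr[OF n(2)] by (simp only: tau_def)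
qed

lemma barrier_scale_ge_1: "1 \<le> barrier_scale \<alpha> r K"
proof -
  have "1 \<le> (2 * K) powr r" using K_ge_1 r_ge_1 by (intro ge_one_powr_ge_zero) auto
  then show ?thesis by (simp add: barrier_scale_def)
qed

definition growth :: "real \<Rightarrow> nat \<Rightarrow> real" where
  "growth \<gamma> N = (if \<gamma> > 0 then 1 else if \<gamma> = 0 then 1 + ln (t N / t 1) else (t 1 / t N) powr \<gamma>)"

text \<open>Since \<gamma> > -1 the weight decreases, so by the mean value theorem each term is at
  most an increment of the antiderivative \<open>P\<close>. The sign of \<gamma> decides whether the
  integral is bounded, logarithmic or a growing power.\<close>

lemma weighted_step_sum:
  assumes \<gamma>: "- 1 < \<gamma>" and L: "L < M"
  shows "t 1 + (\<Sum>p<L. (t 1 / t (Suc (Suc p))) powr (\<gamma> + 1) * h (Suc p))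
    \<le> (1 + (if \<gamma> = 0 then 0 else 1 / \<bar>\<gamma>\<bar>)) * t 1 * growth \<gamma> (Suc L)"
proof -
  have t1: "0 < t 1" using tau_pos by (simp add: tau_def)
  define P where "P s = (if \<gamma> = 0 then t 1 * ln s else - (t 1 / \<gamma>) * (t 1 / s) powr \<gamma>)" for s
  have dP: "(P has_real_derivative (t 1 / s) powr (\<gamma> + 1)) (at s)" if s: "0 < s" for s
  proof (cases "\<gamma> = 0")
    case True
    then show ?thesis using s t1 unfolding P_def[abs_def] by (auto intro!: derivative_eq_intros)
  next
    case False
    have "((\<lambda>s. - (t 1 / \<gamma>) * t 1 powr \<gamma> * s powr (- \<gamma>)) has_real_derivative
        - (t 1 / \<gamma>) * t 1 powr \<gamma> * (- \<gamma> * s powr (- \<gamma> - 1))) (at s)"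
      using s by (auto intro!: derivative_eq_intros)
    also have "- (t 1 / \<gamma>) * t 1 powr \<gamma> * (- \<gamma> * s powr (- \<gamma> - 1)) = (t 1 / s) powr (\<gamma> + 1)"
      using s t1 False powr_minus_divide[of s "\<gamma> + 1"] by (simp add: powr_divide powr_add)
    finally show ?thesis
      by (rule has_field_derivative_transform_within_open[where S = "{0<..}"])
        (use s t1 False in \<open>auto simp: P_def powr_divide powr_minus field_simps\<close>)
  qed
  have "(\<Sum>p<L. (t 1 / t (Suc (Suc p))) powr (\<gamma> + 1) * h (Suc p)) \<le> (\<Sum>p<L. P (t (Suc (Suc p))) - P (t (Suc p)))"
  proof (rule sum_mono)
    fix p assume "p \<in> {..<L}"
    then have p: "Suc p < M" using L by simp
    have l: "0 < t (Suc p)" "t (Suc p) < t (Suc (Suc p))"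
      using p t_less[of 0 "Suc p"] t_0 t_less_Suc by auto
    obtain z where z: "t (Suc p) < z" "z < t (Suc (Suc p))"
      "P (t (Suc (Suc p))) - P (t (Suc p)) = (t (Suc (Suc p)) - t (Suc p)) * (t 1 / z) powr (\<gamma> + 1)"
      using MVT2[OF l(2), of P "\<lambda>z. (t 1 / z) powr (\<gamma> + 1)"] dP l by auto
    have "(t 1 / t (Suc (Suc p))) powr (\<gamma> + 1) \<le> (t 1 / z) powr (\<gamma> + 1)"
      using z l t1 \<gamma> by (intro powr_mono2) (auto intro!: divide_left_mono)
    then show "(t 1 / t (Suc (Suc p))) powr (\<gamma> + 1) * h (Suc p) \<le> P (t (Suc (Suc p))) - P (t (Suc p))"
      unfolding z(3) using l by (simp add: h_def mult.commute mult_left_mono)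
  qed
  also have "\<dots> = P (t (Suc L)) - P (t 1)"
    using sum_lessThan_telescope[of "\<lambda>p. P (t (Suc p))" L] by simp
  finally have le: "t 1 + (\<Sum>p<L. (t 1 / t (Suc (Suc p))) powr (\<gamma> + 1) * h (Suc p)) \<le>
      t 1 + (P (t (Suc L)) - P (t 1))" by simp
  have T: "t 1 \<le> t (Suc L)" using t_mono[of 1 "Suc L"] L by simp
  define q where "q = (t 1 / t (Suc L)) powr \<gamma>"
  have q: "0 \<le> q" by (simp add: q_def)
  consider "\<gamma> > 0" | "\<gamma> = 0" | "\<gamma> < 0" by linarith
  then have "t 1 + (P (t (Suc L)) - P (t 1)) \<le> (1 + (if \<gamma> = 0 then 0 else 1 / \<bar>\<gamma>\<bar>)) * t 1 * growth \<gamma> (Suc L)"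
  proof cases
    case 1
    have "t 1 + (P (t (Suc L)) - P (t 1)) = t 1 + t 1 / \<gamma> - t 1 / \<gamma> * q"
      using 1 t1 by (simp add: P_def q_def)
    also have "\<dots> \<le> t 1 + t 1 / \<gamma>" using 1 t1 q by simp
    finally show ?thesis using 1 by (simp add: growth_def algebra_simps)
  next
    case 2
    then show ?thesis using t1 T by (simp add: P_def growth_def ln_div algebra_simps)
  next
    case 3
    have "1 \<le> q"
    proof -
      have "1 \<le> (t (Suc L) / t 1) powr (- \<gamma>)" using t1 T 3 by (intro ge_one_powr_ge_zero) auto
      then show ?thesis using t1 T by (simp add: q_def powr_divide powr_minus field_simps)
    qed
    have "t 1 + (P (t (Suc L)) - P (t 1)) = t 1 * (1 + (q - 1) / (- \<gamma>))"
      using 3 t1 unfolding P_def q_def[symmetric] by (simp add: field_simps)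
    also have "\<dots> \<le> t 1 * (q + q / (- \<gamma>))"
      using 3 t1 \<open>1 \<le> q\<close> by (intro mult_left_mono add_mono divide_right_mono) auto
    also have "q = growth \<gamma> (Suc L)" using 3 by (simp add: growth_def q_def)
    finally show ?thesis using 3 by (simp add: algebra_simps)
  qed
  with le show ?thesis by linarith
qed

text \<open>The decay \<alpha> + 1 of the dropped correction must not be slower than that of the
  data, hence \<gamma> \<le> \<alpha>. Since each barrier is at most t_N^(\<alpha> - 1) at the
  target, the value of their combination is governed by the sum of
  \<open>w p * t (Suc p)\<close>.\<close>

lemma graded_stability:
  assumes rc: "ratio_condition M t" and N: "0 < N" "N \<le> M" and U0: "U 0 = 0"
    and \<gamma>: "- 1 < \<gamma>" "\<gamma> \<le> \<alpha>"
    and F: "\<And>n. n < N \<Longrightarrow> frac 0 U n \<le> B * (t 1 / t (Suc n)) powr (\<gamma> + 1)"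
    and D: "2 < N \<Longrightarrow> - D * t 1 powr (\<alpha> - 1) \<le> slope U 1 - slope U 0"
    and nonneg: "0 \<le> B" "0 \<le> D"
  shows "U N \<le> 4 * (B + 11 * K^2 * D) * barrier_scale \<alpha> r K *
     (1 + (if \<gamma> = 0 then 0 else 1 / \<bar>\<gamma>\<bar>)) * stab_bound \<alpha> \<gamma> t N"
proof -
  obtain L where L: "N = Suc L" using N by (cases N) auto
  then have LM: "L < M" using N by simp
  define \<Lambda> where "\<Lambda> = barrier_scale \<alpha> r K"
  have \<Lambda>: "1 \<le> \<Lambda>" unfolding \<Lambda>_def by (rule barrier_scale_ge_1)
  have t1: "0 < t 1" using tau_pos by (simp add: tau_def)
  have tp: "0 < t (Suc p)" if "p \<le> L" for p using t_less[of 0 "Suc p"] t_0 that LM by simp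
  define f where "f p = (t 1 / t (Suc p)) powr (\<gamma> + 1)" for p
  \<comment> \<open>The last weight keeps all of \<open>f L\<close>, so the weights from n to L add
    up to \<open>f n\<close>; they are nonnegative because f decreases.\<close>
  define w where "w p = f p - (if p < L then f (Suc p) else 0)" for p
  \<comment> \<open>The factor \<Lambda> makes \<open>barrier_frac_lower\<close> applicable for
    every p, and it gives \<open>x n \<le> a p\<close> whenever n \<le> p.\<close>
  define a where "a p = \<Lambda> * t (Suc p)" for p
  have w: "0 \<le> w p" if p: "p \<le> L" for p
  proof (cases "p < L")
    case True
    have "t 1 / t (Suc (Suc p)) \<le> t 1 / t (Suc p)"
      using True t1 tp[of p] t_less[of "Suc p" "Suc (Suc p)"] LM by (intro divide_left_mono) auto
    then have "f (Suc p) \<le> f p"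
      unfolding f_def using True t1 tp[of "Suc p"] \<gamma> by (intro powr_mono2) auto
    then show ?thesis using True by (simp add: w_def)
  qed (simp add: w_def f_def)
  have ap: "0 < a p" if "p \<le> L" for p using tp[OF that] \<Lambda> by (simp add: a_def)
  define C where "C = 4 * (B + 11 * K^2 * D)"
  have C: "0 \<le> C" using nonneg by (simp add: C_def)
  define W where "W i = (\<Sum>p\<le>L. (w p * a p) * barrier (a p) i)" for i
  have W: "f n / 4 \<le> frac (start n) W n" if n: "n \<le> L" for n
  proof -
    have nM: "n < M" using n LM by simp
    have x: "0 < x n" using x_pos[OF nM] .
    \<comment> \<open>For x \<le> a one has a^\<alpha> x^(-\<alpha>) \<ge> 1 and a/(a + x) \<ge>
      1/2; the other factor 1/2 comes from \<open>barrier_frac_lower\<close>. For n > p only the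
      sign is used.\<close>
    have b: "(if n \<le> p then 1 / 4 else 0) \<le> a p * frac (start n) (barrier (a p)) n" if p: "p \<le> L" for p
    proof -
      have "tau \<le> t (Suc p)" using tau_le[of p] p LM by simp
      then have "barrier_scale \<alpha> r K * tau \<le> a p"
        using \<Lambda> by (simp add: a_def \<Lambda>_def)
      from barrier_frac_lower[OF this nM]
      have 1: "a p * (a p powr \<alpha> * x n powr (- \<alpha>) / (a p + x n) / 2) \<le> a p * frac (start n) (barrier (a p)) n"
        using ap[OF p] by (intro mult_left_mono) auto
      show ?thesis
      proof (cases "n \<le> p")
        case True
        have "x n \<le> t (Suc p)"
          using True x_less[OF nM] t_mono[of "Suc n" "Suc p"] p LM by simp
        also have "\<dots> \<le> a p" using \<Lambda> tp[OF p] by (simp add: a_def)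
        finally have xa: "x n \<le> a p" .
        have "a p powr (- \<alpha>) \<le> x n powr (- \<alpha>)" using xa x alpha_pos by (intro powr_mono2') auto
        then have "a p powr \<alpha> * a p powr (- \<alpha>) \<le> a p powr \<alpha> * x n powr (- \<alpha>)"
          by (intro mult_left_mono) auto
        then have "1 \<le> a p powr \<alpha> * x n powr (- \<alpha>)" using ap[OF p] by (simp add: powr_add[symmetric])
        then have "a p * (1 / (2 * a p) / 2) \<le> a p * (a p powr \<alpha> * x n powr (- \<alpha>) / (a p + x n) / 2)"
          using ap[OF p] xa x by (intro mult_left_mono divide_right_mono frac_le) auto
        moreover have "a p * (1 / (2 * a p) / 2) = 1 / 4" using ap[OF p] by simp
        ultimately show ?thesis using 1 True by simp
      next
        case False
        have "0 \<le> a p * (a p powr \<alpha> * x n powr (- \<alpha>) / (a p + x n) / 2)"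
          using ap[OF p] x by simp
        then show ?thesis using 1 False by simp
      qed
    qed
    have tel: "(\<Sum>p\<in>{n..L}. w p) = f n"
    proof -
      have "{n..L} = insert L {n..<L}" using n by auto
      then have "(\<Sum>p\<in>{n..L}. w p) = (\<Sum>p\<in>{n..<L}. f p - f (Suc p)) + f L"
        by (simp add: w_def)
      also have "(\<Sum>p\<in>{n..<L}. f p - f (Suc p)) = f n - f L"
        using sum_Suc_diff'[OF n, of "\<lambda>p. - f p"] by simp
      finally show ?thesis by simp
    qed
    have "f n / 4 = (\<Sum>p\<in>{n..L}. w p * (1 / 4))" by (simp add: tel sum_divide_distrib[symmetric])
    also have "\<dots> = (\<Sum>p\<le>L. w p * (if n \<le> p then 1 / 4 else 0))"
      by (rule sum.mono_neutral_cong_left) auto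
    also have "\<dots> \<le> (\<Sum>p\<le>L. w p * (a p * frac (start n) (barrier (a p)) n))"
      using b w by (intro sum_mono mult_left_mono) auto
    also have "\<dots> = frac (start n) W n"
      unfolding W_def[abs_def] by (simp add: frac_sum frac_scale mult.assoc)
    finally show ?thesis .
  qed
  have UW: "U N \<le> C * W N"
  proof (rule comparison[OF rc N(2)])
    fix n assume n: "n < N"
    then have nL: "n \<le> L" "n < M" using L N by auto
    have f0: "0 \<le> f n" by (simp add: f_def)
    have "frac (start n) U n \<le> (B + 11 * K^2 * D) * f n"
    proof (cases "n \<le> 1")
      case True
      have "0 \<le> 11 * K^2 * D * f n" using nonneg f0 by simp
      moreover have "frac (start n) U n = frac 0 U n" using True by (simp add: frac_start)
      ultimately show ?thesis unfolding distrib_right using F[OF n, folded f_def] by linarith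
    next
      case False
      have "corr n 0 * (- (slope U 1 - slope U 0)) \<le> corr n 0 * (D * t 1 powr (\<alpha> - 1))"
        using D False n nL corr_nonneg[of 0 n] by (intro mult_left_mono) auto
      also have "\<dots> = D * (corr n 0 * t 1 powr (\<alpha> - 1))" by simp
      also have "\<dots> \<le> D * (11 * K^2 * (t 1 / t (Suc n)) powr (\<alpha> + 1))"
        using corr_0_decay[of n] False nL nonneg by (intro mult_left_mono) auto
      also have "\<dots> \<le> D * (11 * K^2 * f n)"
        unfolding f_def using nonneg \<gamma> nL exponent_weaken[of n "\<gamma> + 1" "\<alpha> + 1"]
        by (intro mult_left_mono) auto
      finally show ?thesis
        using F[OF n, folded f_def] False by (simp add: frac_start algebra_simps)
    qed
    also have "\<dots> = C * (f n / 4)" by (simp add: C_def)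
    also have "\<dots> \<le> C * frac (start n) W n" using W[OF nL(1)] C by (rule mult_left_mono)
    finally show "frac (start n) U n \<le> frac (start n) (\<lambda>i. C * W i) n" by (simp add: frac_scale)
  qed (use U0 in \<open>auto simp: W_def barrier_def\<close>)
  have WN: "W N \<le> \<Lambda> * t N powr (\<alpha> - 1) * (\<Sum>p\<le>L. w p * t (Suc p))"
  proof -
    have "W N \<le> (\<Sum>p\<le>L. (w p * a p) * t N powr (\<alpha> - 1))"
      unfolding W_def
    proof (intro sum_mono mult_left_mono)
      fix p assume "p \<in> {..L}"
      then have p: "p \<le> L" by simp
      have "(a p + t N) powr (\<alpha> - 1) \<le> t N powr (\<alpha> - 1)"
        using ap[OF p] tp[of L] L alpha_less_1 by (intro powr_mono2') auto
      then show "barrier (a p) N \<le> t N powr (\<alpha> - 1)" using N by (simp add: barrier_def bar_def)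
      show "0 \<le> w p * a p" using w[OF p] ap[OF p] by simp
    qed
    then show ?thesis by (simp add: a_def sum_distrib_left mult_ac)
  qed
  \<comment> \<open>Summation by parts moves the difference from the weights to the mesh points and
    produces the steps; \<open>f 0\<close> is 1.\<close>
  have "(\<Sum>p\<le>L. w p * t (Suc p)) = t 1 + (\<Sum>p<L. f (Suc p) * h (Suc p))"
  proof -
    have "(\<Sum>p\<le>L. w p * t (Suc p)) = (\<Sum>p\<le>L. f p * t (Suc p)) - (\<Sum>p<L. f (Suc p) * t (Suc p))"
      by (simp add: w_def lessThan_Suc_atMost[symmetric] left_diff_distrib sum_subtractf)
    also have "(\<Sum>p\<le>L. f p * t (Suc p)) = f 0 * t 1 + (\<Sum>p<L. f (Suc p) * t (Suc (Suc p)))"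
      by (simp add: lessThan_Suc_atMost[symmetric] sum.lessThan_Suc_shift del: sum.lessThan_Suc)
    finally show ?thesis
      using t1 by (simp add: f_def h_def sum_subtractf[symmetric] right_diff_distrib)
  qed
  also have "\<dots> \<le> (1 + (if \<gamma> = 0 then 0 else 1 / \<bar>\<gamma>\<bar>)) * t 1 * growth \<gamma> N"
    unfolding f_def L by (rule weighted_step_sum[OF \<gamma>(1) LM])
  finally have "\<Lambda> * t N powr (\<alpha> - 1) * (\<Sum>p\<le>L. w p * t (Suc p)) \<le>
      \<Lambda> * t N powr (\<alpha> - 1) * ((1 + (if \<gamma> = 0 then 0 else 1 / \<bar>\<gamma>\<bar>)) * t 1 * growth \<gamma> N)"
    using \<Lambda> by (intro mult_left_mono) auto
  then have "W N \<le> \<Lambda> * t N powr (\<alpha> - 1) * ((1 + (if \<gamma> = 0 then 0 else 1 / \<bar>\<gamma>\<bar>)) * t 1 * growth \<gamma> N)"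
    using WN by linarith
  then have "C * W N \<le> C * (\<Lambda> * t N powr (\<alpha> - 1) * ((1 + (if \<gamma> = 0 then 0 else 1 / \<bar>\<gamma>\<bar>)) * t 1 * growth \<gamma> N))"
    using C by (rule mult_left_mono)
  with UW have "U N \<le> C * (\<Lambda> * t N powr (\<alpha> - 1) * ((1 + (if \<gamma> = 0 then 0 else 1 / \<bar>\<gamma>\<bar>)) * t 1 * growth \<gamma> N))"
    by linarith
  moreover have "stab_bound \<alpha> \<gamma> t N = t 1 * t N powr (\<alpha> - 1) * growth \<gamma> N"
    by (simp add: stab_bound_def growth_def)
  ultimately show ?thesis by (simp add: C_def \<Lambda>_def mult_ac)
qed

text \<open>For positive \<gamma> the bound no longer depends on \<gamma>, so the data exponent can
  be lowered to the decay available for the dropped correction.\<close>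

lemma exponent_reduction:
  assumes "\<alpha> - 1 < \<gamma>"
  shows "- 1 < min \<gamma> \<alpha>" "stab_bound \<alpha> (min \<gamma> \<alpha>) t N = stab_bound \<alpha> \<gamma> t N"
  using assms alpha_pos by (auto simp: stab_bound_def min_def)

lemma graded_two_sided:
  assumes rc: "ratio_condition M t" and N: "0 < N" "N \<le> M" and U0: "U 0 = 0" and \<gamma>: "\<alpha> - 1 < \<gamma>"
    and F: "\<And>n. n < N \<Longrightarrow> \<bar>frac 0 U n\<bar> \<le> B * (t 1 / t (Suc n)) powr (\<gamma> + 1)"
  shows "\<bar>U N\<bar> \<le> 4 * (B + 11 * K^2 * (((1 + 8 / (1 - \<alpha>)) * 24 / \<alpha> + 1) * B)) * barrier_scale \<alpha> r K *
     (1 + (if min \<gamma> \<alpha> = 0 then 0 else 1 / \<bar>min \<gamma> \<alpha>\<bar>)) * stab_bound \<alpha> \<gamma> t N"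
    (is "_ \<le> ?R")
proof -
  define D where "D = ((1 + 8 / (1 - \<alpha>)) * 24 / \<alpha> + 1) * B"
  have F0: "\<bar>frac 0 U 0\<bar> \<le> B" using F[of 0] N t1_pos by simp
  then have B: "0 \<le> B" by linarith
  then have D: "0 \<le> D" using alpha_pos alpha_less_1 by (simp add: D_def)
  have weak: "\<bar>frac 0 U n\<bar> \<le> B * (t 1 / t (Suc n)) powr e" if "n < N" "e \<le> \<gamma> + 1" for n e
    using F[OF that(1)] mult_left_mono[OF exponent_weaken[of n e "\<gamma> + 1"] B] that N by simp
  have "\<bar>slope U 1 - slope U 0\<bar> \<le> D * t 1 powr (\<alpha> - 1)" if "2 < N"
    unfolding D_def using that N U0 weak[of 1 \<alpha>] F0 \<gamma>
    by (intro slope_diff_two_sided) (auto simp: numeral_2_eq_2)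
  then have s: "- D * t 1 powr (\<alpha> - 1) \<le> slope U 1 - slope U 0"
    "- D * t 1 powr (\<alpha> - 1) \<le> slope (\<lambda>i. - U i) 1 - slope (\<lambda>i. - U i) 0" if "2 < N"
    using that by (auto simp: slope_def abs_le_iff diff_divide_distrib)
  have F': "\<bar>frac 0 U n\<bar> \<le> B * (t 1 / t (Suc n)) powr (min \<gamma> \<alpha> + 1)" if "n < N" for n
    using weak that by simp
  note e = exponent_reduction[OF \<gamma>]
  have "U N \<le> ?R"
    unfolding e(2)[symmetric] D_def[symmetric] using F' s e(1)
    by (intro graded_stability[where U = U, OF rc N U0 _ _ _ _ B D]) (auto simp: abs_le_iff)
  moreover have "- U N \<le> ?R"
    unfolding e(2)[symmetric] D_def[symmetric]
    by (rule graded_stability[where U = "\<lambda>i. - U i", OF rc N _ _ _ _ _ B D])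
      (use F' s U0 e(1) in \<open>auto simp: abs_le_iff frac_uminus\<close>)
  ultimately show ?thesis by linarith
qed

lemma graded_one_sided:
  assumes rc: "ratio_condition M t" and N: "0 < N" "N \<le> M" and U0: "U 0 = 0" and \<gamma>: "\<alpha> - 1 < \<gamma>"
    and F: "\<And>n. n < N \<Longrightarrow> frac 0 U n \<le> B * (t 1 / t (Suc n)) powr (\<gamma> + 1)" and B: "0 \<le> B"
    and U: "\<And>i. 0 \<le> U i"
  shows "U N \<le> 4 * (B + 11 * K^2 * ((K + 1) * B)) * barrier_scale \<alpha> r K *
     (1 + (if min \<gamma> \<alpha> = 0 then 0 else 1 / \<bar>min \<gamma> \<alpha>\<bar>)) * stab_bound \<alpha> \<gamma> t N"
proof -
  define D where "D = (K + 1) * B"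
  have D: "0 \<le> D" using B K_ge_1 by (simp add: D_def)
  have F0: "frac 0 U 0 \<le> B" using F[of 0] N t1_pos by simp
  have "- D * t 1 powr (\<alpha> - 1) \<le> slope U 1 - slope U 0" if "2 < N"
  proof -
    have "1 / K * t 1 \<le> h 1" using h_ge_tau[of 1] that N K_ge_1 by (simp add: tau_def field_simps)
    then show ?thesis
      using slope_diff_one_sided[of U B "1 / K"] that N U0 F0 B U K_ge_1 by (simp add: D_def)
  qed
  moreover have "frac 0 U n \<le> B * (t 1 / t (Suc n)) powr (min \<gamma> \<alpha> + 1)" if "n < N" for n
    using F[OF that] mult_left_mono[OF exponent_weaken[of n "min \<gamma> \<alpha> + 1" "\<gamma> + 1"] B] that N by simp
  moreover note e = exponent_reduction[OF \<gamma>]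
  ultimately show ?thesis
    unfolding e(2)[symmetric] D_def[symmetric]
    by (intro graded_stability[where U = U, OF rc N U0 _ _ _ _ B D]) auto
qed

end

section \<open>Constants uniform over the mesh classes\<close>

lemma caputo_meshI:
  "0 < \<alpha> \<Longrightarrow> \<alpha> < 1 \<Longrightarrow> temporal_mesh T M t \<Longrightarrow> caputo_mesh \<alpha> t M"
  unfolding caputo_mesh_def temporal_mesh_def by auto

lemma graded_meshI:
  assumes \<alpha>: "0 < \<alpha>" "\<alpha> < 1" and r: "1 \<le> r" "r \<le> (3 - \<alpha>) / \<alpha>" and m: "graded_class T K r M t"
  shows "graded_mesh \<alpha> t M K r"
proof -
  have tm: "temporal_mesh T M t" and q: "quasi_graded K r M t"
    using m by (auto simp: graded_class_def admissible_def)
  interpret caputo_mesh \<alpha> t M using caputo_meshI[OF \<alpha> tm] .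
  have M: "0 < M" using tm by (simp add: temporal_mesh_def)
  have eq: "equiv_upto K (h i) (t 1 powr (1 / r) * t (Suc i) powr (1 - 1 / r))" if "i < M" for i
    using q that unfolding quasi_graded_def by (auto simp: mesh_step_def h_def dest: bspec[of _ _ "Suc i"])
  have t1: "0 < t 1" by (rule t1_pos[OF M])
  \<comment> \<open>On the first interval both sides of the step condition equal \<open>t 1\<close>,
    which forces K \<ge> 1.\<close>
  have "t 1 powr (1 / r) * t 1 powr (1 - 1 / r) = t 1" using t1 by (simp add: powr_add[symmetric])
  then have "t 1 \<le> K * t 1" using eq[of 0] M by (simp add: equiv_upto_def h_0)
  then have K: "1 \<le> K" using t1 by simp
  show ?thesis
  proof unfold_locales
    show "r * \<alpha> \<le> 3 - \<alpha>" using r \<alpha> by (simp add: field_simps)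
    show "h i \<le> K * (t 1 powr (1 / r) * t (Suc i) powr (1 - 1 / r))"
      "t 1 powr (1 / r) * t (Suc i) powr (1 - 1 / r) \<le> K * h i" if "i < M" for i
      using eq[OF that] by (simp_all add: equiv_upto_def)
  qed (use M K r in auto)
qed

lemma stab_bound_nonneg:
  assumes "temporal_mesh T M t" "j \<in> {1..M}"
  shows "0 \<le> stab_bound \<alpha> \<gamma> t j"
proof -
  \<comment> \<open>Only facts about the mesh are wanted; 1/2 is an arbitrary admissible order,
    unrelated to the \<alpha> of the statement.\<close>
  interpret caputo_mesh "1 / 2" t M using caputo_meshI[OF _ _ assms(1)] by simp
  have "0 < t 1" "t 1 \<le> t j" using t1_pos t_mono[of 1 j] assms(2) by auto
  then show ?thesis by (auto simp: stab_bound_def)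
qed

text \<open>It suffices to treat one target index j with data up to j, which permits a rescaling
  that depends on j. The maximum with 1 makes the constant positive.\<close>

lemma stable_onI:
  assumes "\<And>M t. mesh_class M t \<Longrightarrow> temporal_mesh T M t"
    and "\<And>B M t V j. 0 < B \<Longrightarrow> mesh_class M t \<Longrightarrow> V 0 = 0 \<Longrightarrow> j \<in> {1..M} \<Longrightarrow>
      (\<And>i. i \<in> {1..j} \<Longrightarrow> \<bar>alikhanov \<alpha> t V i\<bar> \<le> B * (t 1 / t i) powr (\<gamma> + 1)) \<Longrightarrow>
      \<bar>V j\<bar> \<le> C B * stab_bound \<alpha> \<gamma> t j"
  shows "stable_on \<alpha> \<gamma> mesh_class"
  unfolding stable_on_def
proof (intro allI impI)
  fix B :: real assume B: "0 < B"
  show "\<exists>C>0. \<forall>M t V. mesh_class M t \<longrightarrow>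
        V 0 = 0 \<and> (\<forall>j\<in>{1..M}. \<bar>alikhanov \<alpha> t V j\<bar> \<le> B * (t 1 / t j) powr (\<gamma> + 1)) \<longrightarrow>
        (\<forall>j\<in>{1..M}. \<bar>V j\<bar> \<le> C * stab_bound \<alpha> \<gamma> t j)"
  proof (intro exI[of _ "max 1 (C B)"] conjI allI impI ballI)
    fix M t V j
    assume m: "mesh_class M t" and j: "j \<in> {1..M}"
      and V: "V 0 = 0 \<and> (\<forall>j\<in>{1..M}. \<bar>alikhanov \<alpha> t V j\<bar> \<le> B * (t 1 / t j) powr (\<gamma> + 1))"
    have "\<bar>V j\<bar> \<le> C B * stab_bound \<alpha> \<gamma> t j" using V j by (intro assms(2)[OF B m]) auto
    also have "\<dots> \<le> max 1 (C B) * stab_bound \<alpha> \<gamma> t j"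
      using stab_bound_nonneg[OF assms(1)[OF m] j] by (intro mult_right_mono) auto
    finally show "\<bar>V j\<bar> \<le> max 1 (C B) * stab_bound \<alpha> \<gamma> t j" .
  qed simp
qed

lemma stable_abs_onI:
  assumes "\<And>M t. mesh_class M t \<Longrightarrow> temporal_mesh T M t"
    and "\<And>B M t V j. 0 < B \<Longrightarrow> mesh_class M t \<Longrightarrow> V 0 = 0 \<Longrightarrow> j \<in> {1..M} \<Longrightarrow>
      (\<And>i. i \<in> {1..j} \<Longrightarrow> alikhanov \<alpha> t (\<lambda>i. \<bar>V i\<bar>) i \<le> B * (t 1 / t i) powr (\<gamma> + 1)) \<Longrightarrow>
      \<bar>V j\<bar> \<le> C B * stab_bound \<alpha> \<gamma> t j"
  shows "stable_abs_on \<alpha> \<gamma> mesh_class"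
  unfolding stable_abs_on_def
proof (intro allI impI)
  fix B :: real assume B: "0 < B"
  show "\<exists>C>0. \<forall>M t V. mesh_class M t \<longrightarrow>
        V 0 = 0 \<and> (\<forall>j\<in>{1..M}. alikhanov \<alpha> t (\<lambda>i. \<bar>V i\<bar>) j \<le> B * (t 1 / t j) powr (\<gamma> + 1)) \<longrightarrow>
        (\<forall>j\<in>{1..M}. \<bar>V j\<bar> \<le> C * stab_bound \<alpha> \<gamma> t j)"
  proof (intro exI[of _ "max 1 (C B)"] conjI allI impI ballI)
    fix M t V j
    assume m: "mesh_class M t" and j: "j \<in> {1..M}"
      and V: "V 0 = 0 \<and> (\<forall>j\<in>{1..M}. alikhanov \<alpha> t (\<lambda>i. \<bar>V i\<bar>) j \<le> B * (t 1 / t j) powr (\<gamma> + 1))"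
    have "\<bar>V j\<bar> \<le> C B * stab_bound \<alpha> \<gamma> t j" using V j by (intro assms(2)[OF B m]) auto
    also have "\<dots> \<le> max 1 (C B) * stab_bound \<alpha> \<gamma> t j"
      using stab_bound_nonneg[OF assms(1)[OF m] j] by (intro mult_right_mono) auto
    finally show "\<bar>V j\<bar> \<le> max 1 (C B) * stab_bound \<alpha> \<gamma> t j" .
  qed simp
qed

lemma stable_on_admissible:
  assumes \<alpha>: "0 < \<alpha>" "\<alpha> < 1" and \<gamma>: "\<gamma> \<le> \<alpha> - 1"
  shows "stable_on \<alpha> \<gamma> (admissible T)"
proof (rule stable_onI[where T = T and C = "\<lambda>B.
      (1 + 4 * ((1 + 8 / (1 - \<alpha>)) * 24 / \<alpha> + 1) / (1 - \<alpha>)) * (Gamma (1 - \<alpha>) * B)"])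
  fix B M t V j
  assume B: "(0::real) < B" and m: "admissible T M t" and V0: "V 0 = 0" and j: "j \<in> {1..M}"
    and V: "\<And>i. i \<in> {1..j} \<Longrightarrow> \<bar>alikhanov \<alpha> t V i\<bar> \<le> B * (t 1 / t i) powr (\<gamma> + 1)"
  have tm: "temporal_mesh T M t" and rc: "ratio_condition M t" using m by (auto simp: admissible_def)
  interpret caputo_mesh \<alpha> t M using caputo_meshI[OF \<alpha> tm] .
  obtain k where k: "j = Suc k" "k < M" using j by (cases j) auto
  define s where "s = (t 1 / t (Suc k)) powr (\<gamma> + 1 - \<alpha>)"
  have G: "0 < Gamma (1 - \<alpha>)" using \<alpha> by (intro Gamma_real_pos) simp
  have "\<bar>V j\<bar> \<le> (1 + 4 * ((1 + 8 / (1 - \<alpha>)) * 24 / \<alpha> + 1) / (1 - \<alpha>)) * (Gamma (1 - \<alpha>) * B * s) * t 1 powr \<alpha>"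
  proof (rule constant_two_sided[where U = V, OF rc _ _ V0])
    fix n assume n: "n < j"
    have "\<bar>frac 0 V n\<bar> = Gamma (1 - \<alpha>) * \<bar>alikhanov \<alpha> t V (Suc n)\<bar>"
      using frac_eq_alikhanov[of n V] n k G by (simp add: abs_mult)
    also have "\<dots> \<le> Gamma (1 - \<alpha>) * (B * (t 1 / t (Suc n)) powr (\<gamma> + 1))"
      using V[of "Suc n"] n G by (intro mult_left_mono) auto
    also have "\<dots> \<le> Gamma (1 - \<alpha>) * (B * (s * (t 1 / t (Suc n)) powr \<alpha>))"
      using weight_constant[of n k \<gamma>] n k \<gamma> G B by (intro mult_left_mono) (auto simp: s_def)
    finally show "\<bar>frac 0 V n\<bar> \<le> Gamma (1 - \<alpha>) * B * s * (t 1 / t (Suc n)) powr \<alpha>" by (simp add: mult_ac)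
  qed (use j in auto)
  then show "\<bar>V j\<bar> \<le> (1 + 4 * ((1 + 8 / (1 - \<alpha>)) * 24 / \<alpha> + 1) / (1 - \<alpha>)) * (Gamma (1 - \<alpha>) * B) * stab_bound \<alpha> \<gamma> t j"
    using stab_bound_constant[OF k(2) \<gamma>] by (simp add: k(1) s_def mult.assoc)
qed (simp add: admissible_def)

lemma stable_abs_on_first_ratio:
  assumes \<alpha>: "0 < \<alpha>" "\<alpha> < 1" and \<gamma>: "\<gamma> \<le> \<alpha> - 1" and c: "0 < c"
  shows "stable_abs_on \<alpha> \<gamma> (first_ratio_class T c)"
proof (rule stable_abs_onI[where T = T and C = "\<lambda>B.
      (1 + 4 * (1 / c + 1) / (1 - \<alpha>)) * (Gamma (1 - \<alpha>) * B)"])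
  fix B M t V j
  assume B: "(0::real) < B" and m: "first_ratio_class T c M t" and V0: "V 0 = 0" and j: "j \<in> {1..M}"
    and V: "\<And>i. i \<in> {1..j} \<Longrightarrow> alikhanov \<alpha> t (\<lambda>i. \<bar>V i\<bar>) i \<le> B * (t 1 / t i) powr (\<gamma> + 1)"
  have tm: "temporal_mesh T M t" and rc: "ratio_condition M t"
    using m by (auto simp: first_ratio_class_def admissible_def)
  interpret caputo_mesh \<alpha> t M using caputo_meshI[OF \<alpha> tm] .
  obtain k where k: "j = Suc k" "k < M" using j by (cases j) auto
  define s where "s = (t 1 / t (Suc k)) powr (\<gamma> + 1 - \<alpha>)"
  have G: "0 < Gamma (1 - \<alpha>)" using \<alpha> by (intro Gamma_real_pos) simp
  have "\<bar>V j\<bar> \<le> (1 + 4 * (1 / c + 1) / (1 - \<alpha>)) * (Gamma (1 - \<alpha>) * B * s) * t 1 powr \<alpha>"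
  proof (rule constant_one_sided[OF rc, where U = "\<lambda>i. \<bar>V i\<bar>"])
    fix n assume n: "n < j"
    have "frac 0 (\<lambda>i. \<bar>V i\<bar>) n = Gamma (1 - \<alpha>) * alikhanov \<alpha> t (\<lambda>i. \<bar>V i\<bar>) (Suc n)"
      using frac_eq_alikhanov[of n] n k by simp
    also have "\<dots> \<le> Gamma (1 - \<alpha>) * (B * (t 1 / t (Suc n)) powr (\<gamma> + 1))"
      using V[of "Suc n"] n G by (intro mult_left_mono) auto
    also have "\<dots> \<le> Gamma (1 - \<alpha>) * (B * (s * (t 1 / t (Suc n)) powr \<alpha>))"
      using weight_constant[of n k \<gamma>] n k \<gamma> G B by (intro mult_left_mono) (auto simp: s_def)
    finally show "frac 0 (\<lambda>i. \<bar>V i\<bar>) n \<le> Gamma (1 - \<alpha>) * B * s * (t 1 / t (Suc n)) powr \<alpha>"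
      by (simp add: mult_ac)
  next
    assume "2 < M"
    then show "c * t 1 \<le> h 1"
      using m step_ratio_eq[of 1] t1_pos by (simp add: first_ratio_class_def h_0 field_simps)
  qed (use j V0 G B c in \<open>auto simp: s_def\<close>)
  then show "\<bar>V j\<bar> \<le> (1 + 4 * (1 / c + 1) / (1 - \<alpha>)) * (Gamma (1 - \<alpha>) * B) * stab_bound \<alpha> \<gamma> t j"
    using stab_bound_constant[OF k(2) \<gamma>] by (simp add: k(1) s_def mult.assoc)
qed (simp add: first_ratio_class_def admissible_def)

text \<open>Every step of a quasi-graded mesh is at least tau/K, so for \<gamma> \<le> \<alpha> - 1
  the one-sided result on graded meshes reduces to the class with c = 1/K.\<close>

lemma graded_class_first_ratio:
  assumes "0 < \<alpha>" "\<alpha> < 1" "1 \<le> r" "r \<le> (3 - \<alpha>) / \<alpha>" "graded_class T K r M t"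
  shows "first_ratio_class T (1 / K) M t"
proof -
  interpret graded_mesh \<alpha> t M K r using graded_meshI[OF assms] .
  have "1 / K \<le> step_ratio t 1" if "3 \<le> M"
  proof -
    have e: "step_ratio t 1 = h 1 / tau" using step_ratio_eq[of 1] by (simp add: h_0 tau_def)
    show ?thesis unfolding e using h_ge_tau[of 1] that K_ge_1 tau_pos by (simp add: field_simps)
  qed
  then show ?thesis using assms(5) by (simp add: first_ratio_class_def graded_class_def)
qed

lemma stable_on_graded:
  assumes \<alpha>: "0 < \<alpha>" "\<alpha> < 1" and r: "1 \<le> r" "r \<le> (3 - \<alpha>) / \<alpha>"
  shows "stable_on \<alpha> \<gamma> (graded_class T K r)"
proof (cases "\<gamma> \<le> \<alpha> - 1")
  case True
  then show ?thesis
    using stable_on_admissible[OF \<alpha> True, of T] unfolding stable_on_def graded_class_def by meson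
next
  case False
  show ?thesis
  proof (rule stable_onI[where T = T and C = "\<lambda>B. 4 * (Gamma (1 - \<alpha>) * B +
      11 * K^2 * (((1 + 8 / (1 - \<alpha>)) * 24 / \<alpha> + 1) * (Gamma (1 - \<alpha>) * B))) * barrier_scale \<alpha> r K *
      (1 + (if min \<gamma> \<alpha> = 0 then 0 else 1 / \<bar>min \<gamma> \<alpha>\<bar>))"])
    fix B M t V j
    assume m: "graded_class T K r M t" and V0: "V 0 = 0" and j: "j \<in> {1..M}"
      and V: "\<And>i. i \<in> {1..j} \<Longrightarrow> \<bar>alikhanov \<alpha> t V i\<bar> \<le> B * (t 1 / t i) powr (\<gamma> + 1)"
    interpret graded_mesh \<alpha> t M K r using graded_meshI[OF \<alpha> r m] .
    have rc: "ratio_condition M t" using m by (simp add: graded_class_def admissible_def)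
    have G: "0 < Gamma (1 - \<alpha>)" using \<alpha> by (intro Gamma_real_pos) simp
    show "\<bar>V j\<bar> \<le> 4 * (Gamma (1 - \<alpha>) * B +
      11 * K^2 * (((1 + 8 / (1 - \<alpha>)) * 24 / \<alpha> + 1) * (Gamma (1 - \<alpha>) * B))) * barrier_scale \<alpha> r K *
      (1 + (if min \<gamma> \<alpha> = 0 then 0 else 1 / \<bar>min \<gamma> \<alpha>\<bar>)) * stab_bound \<alpha> \<gamma> t j"
    proof (rule graded_two_sided[where U = V, OF rc _ _ V0])
      fix n assume n: "n < j"
      have "\<bar>frac 0 V n\<bar> = Gamma (1 - \<alpha>) * \<bar>alikhanov \<alpha> t V (Suc n)\<bar>"
        using frac_eq_alikhanov[of n V] n j G by (simp add: abs_mult)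
      also have "\<dots> \<le> Gamma (1 - \<alpha>) * (B * (t 1 / t (Suc n)) powr (\<gamma> + 1))"
        using V[of "Suc n"] n G by (intro mult_left_mono) auto
      finally show "\<bar>frac 0 V n\<bar> \<le> Gamma (1 - \<alpha>) * B * (t 1 / t (Suc n)) powr (\<gamma> + 1)"
        by (simp add: mult.assoc)
    qed (use j False in auto)
  qed (simp add: graded_class_def admissible_def)
qed

lemma stable_abs_on_graded:
  assumes \<alpha>: "0 < \<alpha>" "\<alpha> < 1" and r: "1 \<le> r" "r \<le> (3 - \<alpha>) / \<alpha>" and K: "0 < K"
  shows "stable_abs_on \<alpha> \<gamma> (graded_class T K r)"
proof (cases "\<gamma> \<le> \<alpha> - 1")
  case True
  have "0 < 1 / K" using K by simp
  then show ?thesis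
    using stable_abs_on_first_ratio[OF \<alpha> True, of "1 / K" T] graded_class_first_ratio[OF \<alpha> r]
    unfolding stable_abs_on_def by meson
next
  case False
  show ?thesis
  proof (rule stable_abs_onI[where T = T and C = "\<lambda>B. 4 * (Gamma (1 - \<alpha>) * B +
      11 * K^2 * ((K + 1) * (Gamma (1 - \<alpha>) * B))) * barrier_scale \<alpha> r K *
      (1 + (if min \<gamma> \<alpha> = 0 then 0 else 1 / \<bar>min \<gamma> \<alpha>\<bar>))"])
    fix B M t V j
    assume B: "(0::real) < B" and m: "graded_class T K r M t" and V0: "V 0 = 0" and j: "j \<in> {1..M}"
      and V: "\<And>i. i \<in> {1..j} \<Longrightarrow> alikhanov \<alpha> t (\<lambda>i. \<bar>V i\<bar>) i \<le> B * (t 1 / t i) powr (\<gamma> + 1)"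
    interpret graded_mesh \<alpha> t M K r using graded_meshI[OF \<alpha> r m] .
    have rc: "ratio_condition M t" using m by (simp add: graded_class_def admissible_def)
    have G: "0 < Gamma (1 - \<alpha>)" using \<alpha> by (intro Gamma_real_pos) simp
    show "\<bar>V j\<bar> \<le> 4 * (Gamma (1 - \<alpha>) * B +
      11 * K^2 * ((K + 1) * (Gamma (1 - \<alpha>) * B))) * barrier_scale \<alpha> r K *
      (1 + (if min \<gamma> \<alpha> = 0 then 0 else 1 / \<bar>min \<gamma> \<alpha>\<bar>)) * stab_bound \<alpha> \<gamma> t j"
    proof (rule graded_one_sided[OF rc, where U = "\<lambda>i. \<bar>V i\<bar>"])
      fix n assume n: "n < j"
      have "frac 0 (\<lambda>i. \<bar>V i\<bar>) n = Gamma (1 - \<alpha>) * alikhanov \<alpha> t (\<lambda>i. \<bar>V i\<bar>) (Suc n)"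
        using frac_eq_alikhanov[of n] n j by simp
      also have "\<dots> \<le> Gamma (1 - \<alpha>) * (B * (t 1 / t (Suc n)) powr (\<gamma> + 1))"
        using V[of "Suc n"] n G by (intro mult_left_mono) auto
      finally show "frac 0 (\<lambda>i. \<bar>V i\<bar>) n \<le> Gamma (1 - \<alpha>) * B * (t 1 / t (Suc n)) powr (\<gamma> + 1)"
        by (simp add: mult.assoc)
    qed (use j V0 False G B in auto)
  qed (simp add: graded_class_def admissible_def)
qed

theorem theorem4p2:
  fixes \<alpha> T :: real
  assumes "0 < \<alpha>" and "\<alpha> < 1" and "0 < T"
  shows
    "(\<forall>r K \<gamma>. 1 \<le> r \<and> r \<le> (3 - \<alpha>) / \<alpha> \<and> 0 < K \<longrightarrow> stable_on \<alpha> \<gamma> (graded_class T K r)) \<and>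
     (\<forall>\<gamma>. \<gamma> \<le> \<alpha> - 1 \<longrightarrow> stable_on \<alpha> \<gamma> (admissible T)) \<and>
     (\<forall>r K \<gamma>. 1 \<le> r \<and> r \<le> (3 - \<alpha>) / \<alpha> \<and> 0 < K \<longrightarrow> stable_abs_on \<alpha> \<gamma> (graded_class T K r)) \<and>
     (\<forall>\<gamma> c. \<gamma> \<le> \<alpha> - 1 \<and> 0 < c \<longrightarrow> stable_abs_on \<alpha> \<gamma> (first_ratio_class T c))"
  using assms
  by (auto intro!: stable_on_graded stable_on_admissible stable_abs_on_graded stable_abs_on_first_ratio)

end
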